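(* Let $d\ge 1$ be an integer, $\alpha\in(0,d)$, and let $r,p$ be real numbers with $\alpha\le r$ and $1<r<p\le d$. Then there is a constant $N$ depending only on $\alpha,d,r,p$ such that the following holds. Let $A$ be a number and let $b\ge 0$ be a measurable function on $\mathbb{R}^d$ such that for any $\rho>0$ and any open ball $B\subset\mathbb{R}^d$ of radius $\rho$ $$ \Big(\frac{1}{|B|}\int_{B}b^{p}\,dx\Big)^{1/p}\le A\rho^{-\alpha}. $$ Then for every $u\in C_0^\infty(\mathbb{R}^d)$ $$ \int_{\mathbb{R}^{d}}b^{r}|u|^{r}\,dx\le N A^{r}\int_{\mathbb{R}^{d}}\big|(-\Delta)^{\alpha/2}u\big|^{r}\,dx, $$ and, if $\alpha=1$ (and hence $d\ge 2$), also $$ \int_{\mathbb{R}^{d}}b^{r}|u|^{r}\,dx\le N A^{r}\int_{\mathbb{R}^{d}}|Du|^{r}\,dx . $$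
   Context: $|B|$ is the Lebesgue measure of $B$. $C_0^\infty(\mathbb{R}^d)$ is the set of infinitely differentiable compactly supported functions, $Du$ is the gradient of $u$, and $(-\Delta)^{\alpha/2}$ is the fractional power of the Laplacian, i.e. the Fourier multiplier operator with symbol $|\xi|^{\alpha}$. *)

theory Defs
  imports "HOL-Analysis.Analysis"
begin

primrec Ck :: "nat \<Rightarrow> ('a::real_normed_vector \<Rightarrow> 'b::real_normed_vector) \<Rightarrow> bool" where
  "Ck 0 f \<longleftrightarrow> continuous_on UNIV f"
| "Ck (Suc k) f \<longleftrightarrow>
     (\<forall>x. f differentiable (at x)) \<and> (\<forall>v. Ck k (\<lambda>x. frechet_derivative f (at x) v))"

definition Cc_infinity :: "('a::real_normed_vector \<Rightarrow> 'b::real_normed_vector) set" where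
  "Cc_infinity = {u. (\<forall>k. Ck k u) \<and> compact (closure {x. u x \<noteq> 0})}"

text \<open>The gradient is a vector of partial derivatives. For complex-valued u it lies in
  complex^'n, whose norm is the square root of the sum of the squared moduli of the
  partial derivatives.\<close>

definition grad :: "(real^'n \<Rightarrow> 'b::real_normed_vector) \<Rightarrow> real^'n \<Rightarrow> 'b^'n" where
  "grad u x = (\<chi> i. frechet_derivative u (at x) (axis i 1))"

definition fourier_transform :: "(real^'n \<Rightarrow> complex) \<Rightarrow> real^'n \<Rightarrow> complex" where
  "fourier_transform u \<xi> = (LINT x|lebesgue. cis (- (x \<bullet> \<xi>)) * u x)"

text \<open>The factor matches the normalization of the Fourier transform above: the symbol 1
  gives the identity on test functions.\<close>

definition fourier_multiplier :: "(real^'n \<Rightarrow> real) \<Rightarrow> (real^'n \<Rightarrow> complex) \<Rightarrow> real^'n \<Rightarrow> complex" where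
  "fourier_multiplier m u x =
     complex_of_real (1 / (2 * pi) ^ CARD('n)) *
     (LINT \<xi>|lebesgue. cis (x \<bullet> \<xi>) * complex_of_real (m \<xi>) * fourier_transform u \<xi>)"

text \<open>The fractional power s > 0 of the negative Laplacian, whose symbol is the square of the
  norm of \<open>\<xi>\<close>.\<close>

definition frac_laplacian :: "real \<Rightarrow> (real^'n \<Rightarrow> complex) \<Rightarrow> real^'n \<Rightarrow> complex" where
  "frac_laplacian s = fourier_multiplier (\<lambda>\<xi>. norm \<xi> powr (2 * s))"

text \<open>Integrability is stated explicitly because the Bochner integral of a non-integrable
  function is 0.\<close>

definition morrey_bound :: "real \<Rightarrow> real \<Rightarrow> real \<Rightarrow> (real^'n \<Rightarrow> real) \<Rightarrow> bool" where
  "morrey_bound p \<alpha> A b \<longleftrightarrow>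
     (\<forall>\<rho>>0. \<forall>x.
        set_integrable lebesgue (ball x \<rho>) (\<lambda>y. b y powr p) \<and>
        ((1 / measure lebesgue (ball x \<rho>)) * (LINT y:ball x \<rho>|lebesgue. b y powr p)) powr (1 / p)
          \<le> A * \<rho> powr (- \<alpha>))"

end

theory Submission
  imports Defs "HOL-Probability.Probability"
begin

text \<open>
  Both estimates reduce to a weighted inequality for Riesz potentials: a test function u satisfies
  \<open>|u(x)| \<le> C \<integral> |x - y|\<^sup>\<alpha>\<^sup>-\<^sup>d f(y) dy\<close> with f the modulus of \<open>(-\<Delta>)\<^sup>\<alpha>\<^sup>/\<^sup>2 u\<close>, respectively, for \<open>\<alpha> = 1\<close>, of Du.
  For the gradient this follows by averaging the fundamental theorem of calculus over rays; for the
  fractional Laplacian one writes \<open>|\<xi>|\<^sup>-\<^sup>\<alpha>\<close> as a Gamma integral of the Gaussians \<open>exp (-t |\<xi>|\<^sup>2)\<close> and uses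
  Fourier inversion, so that only the heat kernel has to be computed.

  For the weighted inequality let V be the maximal function of \<open>b\<^sup>p\<close> and \<open>w = V\<^sup>1\<^sup>/\<^sup>p\<close>. By the weak type
  (1,1) estimate and Kolmogorov's argument, \<open>w\<^sup>s\<close> is, for \<open>s < p\<close>, an A1 weight that still satisfies the Morrey bound.
  Splitting the Riesz potential at the scale where these two bounds balance gives
  \<open>I\<^sub>\<alpha>(w\<^sup>s) \<le> C A w\<^sup>s\<^sup>-\<^sup>1\<close> for \<open>1 < s < p\<close>, which is what Schur's test needs.
\<close>

section \<open>The maximal function\<close>

text \<open>The function \<open>b\<close> itself cannot serve as the weight: the Morrey bound limits
  averages of \<open>b^s\<close> from above, but nothing relates them to the value of
  \<open>b\<close> at the centre, which may vanish. Passing to \<open>w\<close> removes this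
  obstacle, since \<open>b \<le> w\<close> and the averages of \<open>w^s\<close> over balls of
  dyadic radius about x are at most a constant times \<open>w(x)^s\<close>. The potential estimate
  enters Schur's test twice: with an exponent t for the inner potential, and with
  \<open>s = 1 + t * (r - 1)\<close> after Tonelli. Both have to lie strictly between 1 and p: above
  1 so that the contributions of large radii are summable, below p because Kolmogorov's argument
  covers only powers of V with exponent less than 1. Such a t exists because r < p gives (p - 1) /
  (r - 1) > 1. Integrals of nonnegative functions live in \<open>ennreal\<close>, so no finiteness
  of the right-hand sides is assumed. Radii in the maximal function are powers of two: the supremum
  is then countable, hence measurable, and any ball fits into a dyadic one at the cost of a factor
  depending on the dimension.\<close>

text \<open>The normalisation is by the power of the radius and not by the volume of the ball; the
  unit ball volume reappears as an explicit constant in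
  \<open>morrey_bound_ball_avg\<close>.\<close>

definition ball_avg :: "real \<Rightarrow> ('a::euclidean_space \<Rightarrow> ennreal) \<Rightarrow> 'a \<Rightarrow> ennreal" where
  "ball_avg \<rho> h x = ennreal (\<rho> powr - real DIM('a)) *
     (\<integral>\<^sup>+y. (if dist x y < \<rho> then h y else 0) \<partial>lborel)"

text \<open>The maximum with h itself makes \<open>h \<le> maxfun h\<close> hold everywhere, without the Lebesgue
  differentiation theorem.\<close>

definition maxfun :: "('a::euclidean_space \<Rightarrow> ennreal) \<Rightarrow> 'a \<Rightarrow> ennreal" where
  "maxfun h x = max (h x) (SUP k::int. ball_avg (2 powr k) h x)"

lemma measurable_ball_avg [measurable]:
  fixes h :: "'a::euclidean_space \<Rightarrow> ennreal"
  assumes [measurable]: "h \<in> borel_measurable borel"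
  shows "ball_avg \<rho> h \<in> borel_measurable borel"
  unfolding ball_avg_def by measurable

lemma measurable_maxfun [measurable]:
  fixes h :: "'a::euclidean_space \<Rightarrow> ennreal"
  assumes [measurable]: "h \<in> borel_measurable borel"
  shows "maxfun h \<in> borel_measurable borel"
  unfolding maxfun_def by measurable

lemma maxfun_ge: "h x \<le> maxfun h x" "ball_avg (2 powr real_of_int k) h x \<le> maxfun h x"
  by (auto simp: maxfun_def intro!: max.coboundedI2 SUP_upper)

section \<open>The weak type (1,1) estimate and Kolmogorov's inequality\<close>

text \<open>Vitali covering: every point of the level set is the centre of a ball of radius r
  carrying h-mass at least \<open>l * r powr d\<close>. A disjoint subfamily whose fivefold dilates
  still cover the level set compares its volume with the total mass of h, whence the constant
  \<open>5 ^ d\<close> times the unit ball volume.\<close>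

lemma weak_type_avg:
  fixes h :: "'a::euclidean_space \<Rightarrow> ennreal" and l :: real
  assumes [measurable]: "h \<in> borel_measurable borel" and l: "0 < l"
    and fin: "(\<integral>\<^sup>+y. h y \<partial>lborel) < \<infinity>"
  shows "ennreal l * emeasure lborel {x. ennreal l < (SUP k::int. ball_avg (2 powr k) h x)}
     \<le> ennreal (5 ^ DIM('a) * unit_ball_vol DIM('a)) * (\<integral>\<^sup>+y. h y \<partial>lborel)"
proof -
  define d where "d = real DIM('a)"
  have d: "d > 0" by (simp add: d_def)
  define S where "S = {x. ennreal l < (SUP k::int. ball_avg (2 powr k) h x)}"
  define v where "v = unit_ball_vol d"
  have v: "v > 0" unfolding v_def by (rule unit_ball_vol_pos) (use d in auto)
  have [measurable]: "S \<in> sets borel" unfolding S_def by measurable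
  obtain I where I: "(\<integral>\<^sup>+y. h y \<partial>lborel) = ennreal I" "0 \<le> I"
    using fin by (cases "\<integral>\<^sup>+y. h y \<partial>lborel") auto
  have "\<exists>k::int. ennreal l < ball_avg (2 powr k) h x" if "x \<in> S" for x
    using that by (auto simp: S_def less_SUP_iff)
  then obtain k :: "'a \<Rightarrow> int" where k: "\<And>x. x \<in> S \<Longrightarrow> ennreal l < ball_avg (2 powr k x) h x"
    by metis
  define r where "r x = 2 powr real_of_int (k x)" for x
  have r: "r x > 0" for x by (simp add: r_def)
  have key: "ennreal (l * r x powr d) \<le> (\<integral>\<^sup>+y. h y * indicator (ball x (r x)) y \<partial>lborel)" if "x \<in> S" for x
  proof -
    have "ennreal (r x powr d) * ennreal l \<le> ennreal (r x powr d) * ball_avg (r x) h x"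
      using k[OF that] unfolding r_def by (intro mult_left_mono) auto
    also have "\<dots> = (ennreal (r x powr d) * ennreal (r x powr - d)) * (\<integral>\<^sup>+y. (if dist x y < r x then h y else 0) \<partial>lborel)"
      by (simp add: ball_avg_def d_def mult.assoc)
    also have "ennreal (r x powr d) * ennreal (r x powr - d) = 1"
      using r[of x] by (simp add: ennreal_mult[symmetric] powr_add[symmetric])
    also have "(\<integral>\<^sup>+y. (if dist x y < r x then h y else 0) \<partial>lborel) = (\<integral>\<^sup>+y. h y * indicator (ball x (r x)) y \<partial>lborel)"
      by (intro nn_integral_cong) (auto simp: indicator_def)
    finally show ?thesis using l by (simp add: ennreal_mult[symmetric] mult.commute)
  qed
  \<comment> \<open>Vitali's lemma needs bounded radii. The bound comes from \<open>key\<close>: the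
    mass in each ball is at least \<open>l * r x powr d\<close> and at most the total mass
    I.\<close>
  define B where "B = (I / l) powr (1/d)"
  have rB: "r x \<le> B" if "x \<in> S" for x
  proof -
    have "ennreal (l * r x powr d) \<le> (\<integral>\<^sup>+y. h y \<partial>lborel)"
      by (rule order_trans[OF key[OF that]]) (auto intro!: nn_integral_mono simp: indicator_def)
    then have "r x powr d \<le> I / l" using I l by (simp add: field_simps)
    then have "(r x powr d) powr (1/d) \<le> B" unfolding B_def using d by (intro powr_mono2) auto
    then show ?thesis using d r[of x] by (simp add: powr_powr)
  qed
  obtain C where C: "countable C" "C \<subseteq> S"
    "pairwise (\<lambda>i j. disjnt (ball i (r i)) (ball j (r j))) C"
    "S \<subseteq> (\<Union>i\<in>C. ball i (5 * r i))"
    by (rule Vitali_covering_lemma_balls[of S "\<lambda>i. i" r S B]) (use r rB in auto)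
  have "emeasure lborel S \<le> emeasure lborel (\<Union>i\<in>C. ball i (5 * r i))"
    using C(4) by (intro emeasure_mono) (auto intro!: borel_open)
  also have "\<dots> = (\<integral>\<^sup>+x. indicator (\<Union>i\<in>C. ball i (5 * r i)) x \<partial>lborel)"
    by (subst nn_integral_indicator) (auto intro!: borel_open)
  \<comment> \<open>The sum over the countable index set is written as an integral against
    \<open>count_space C\<close>, so that summation and integration can be exchanged.\<close>
  also have "\<dots> \<le> (\<integral>\<^sup>+x. (\<integral>\<^sup>+i. indicator (ball i (5 * r i)) x \<partial>count_space C) \<partial>lborel)"
  proof (rule nn_integral_mono)
    fix x
    show "indicator (\<Union>i\<in>C. ball i (5 * r i)) x \<le> (\<integral>\<^sup>+i. indicator (ball i (5 * r i)) x \<partial>count_space C)"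
    proof (cases "x \<in> (\<Union>i\<in>C. ball i (5 * r i))")
      case True
      then obtain i where i: "i \<in> C" "x \<in> ball i (5 * r i)" by auto
      have "1 = indicator (ball i (5 * r i)) x" using i by (simp add: indicator_def)
      also have "\<dots> = (\<integral>\<^sup>+j. indicator (ball j (5 * r j)) x * indicator {i} j \<partial>count_space C)"
        using i by (simp add: nn_integral_indicator_singleton)
      also have "\<dots> \<le> (\<integral>\<^sup>+j. indicator (ball j (5 * r j)) x \<partial>count_space C)"
        by (intro nn_integral_mono) (auto simp: indicator_def)
      finally show ?thesis using True by (simp add: indicator_def)
    qed simp
  qed
  also have "\<dots> = (\<integral>\<^sup>+i. (\<integral>\<^sup>+x. indicator (ball i (5 * r i)) x \<partial>lborel) \<partial>count_space C)"
    using C(1) by (intro nn_integral_count_space_nn_integral) (auto intro!: borel_measurable_indicator)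
  also have "\<dots> = (\<integral>\<^sup>+i. ennreal (v * (5 * r i) ^ DIM('a)) \<partial>count_space C)"
    using r by (intro nn_integral_cong) (simp add: emeasure_ball v_def d_def less_imp_le)
  finally have 1: "emeasure lborel S \<le> (\<integral>\<^sup>+i. ennreal (v * (5 * r i) ^ DIM('a)) \<partial>count_space C)" .
  have "ennreal l * emeasure lborel S \<le> ennreal l * (\<integral>\<^sup>+i. ennreal (v * (5 * r i) ^ DIM('a)) \<partial>count_space C)"
    by (intro mult_left_mono 1) auto
  also have "\<dots> = (\<integral>\<^sup>+i. ennreal l * ennreal (v * (5 * r i) ^ DIM('a)) \<partial>count_space C)"
    by (simp add: nn_integral_cmult)
  also have "\<dots> = (\<integral>\<^sup>+i. ennreal (5 ^ DIM('a) * v) * ennreal (l * r i powr d) \<partial>count_space C)"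
    using l v r by (intro nn_integral_cong)
      (simp add: ennreal_mult[symmetric] less_imp_le d_def powr_realpow power_mult_distrib mult_ac)
  also have "\<dots> = ennreal (5 ^ DIM('a) * v) * (\<integral>\<^sup>+i. ennreal (l * r i powr d) \<partial>count_space C)"
    by (simp add: nn_integral_cmult)
  also have "\<dots> \<le> ennreal (5 ^ DIM('a) * v) * (\<integral>\<^sup>+i. (\<integral>\<^sup>+y. h y * indicator (ball i (r i)) y \<partial>lborel) \<partial>count_space C)"
    using C(2) key by (intro mult_left_mono nn_integral_mono) auto
  \<comment> \<open>Read as measures with density h, the masses of the disjoint balls add up by
    countable additivity.\<close>
  also have "(\<integral>\<^sup>+i. (\<integral>\<^sup>+y. h y * indicator (ball i (r i)) y \<partial>lborel) \<partial>count_space C)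
     = (\<integral>\<^sup>+i. emeasure (density lborel h) (ball i (r i)) \<partial>count_space C)"
    by (intro nn_integral_cong) (simp add: emeasure_density)
  also have "\<dots> = emeasure (density lborel h) (\<Union>i\<in>C. ball i (r i))"
    using C(1,3) by (intro emeasure_UN_countable[symmetric])
      (auto simp: disjoint_family_on_def pairwise_def disjnt_def)
  also have "\<dots> \<le> (\<integral>\<^sup>+y. h y \<partial>lborel)"
    by (subst emeasure_density) (auto intro!: nn_integral_mono borel_open simp: indicator_def)
  finally show ?thesis unfolding S_def v_def d_def by (simp add: mult_left_mono)
qed

text \<open>The extra summand 1 in the constant is Markov's inequality for h itself, which is one of
  the two entries of the maximum.\<close>

lemma weak_type_maxfun:
  fixes h :: "'a::euclidean_space \<Rightarrow> ennreal" and l :: real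
  assumes [measurable]: "h \<in> borel_measurable borel" and l: "0 < l"
    and fin: "(\<integral>\<^sup>+y. h y \<partial>lborel) < \<infinity>"
  shows "ennreal l * emeasure lborel {x. ennreal l < maxfun h x}
     \<le> ennreal (5 ^ DIM('a) * unit_ball_vol DIM('a) + 1) * (\<integral>\<^sup>+y. h y \<partial>lborel)"
proof -
  let ?A = "{x. ennreal l < (SUP k::int. ball_avg (2 powr k) h x)}" and ?B = "{x. ennreal l < h x}"
  have "ennreal l * emeasure lborel ?B = (\<integral>\<^sup>+x. ennreal l * indicator ?B x \<partial>lborel)"
    by (subst nn_integral_cmult_indicator) auto
  also have "\<dots> \<le> (\<integral>\<^sup>+y. h y \<partial>lborel)"
    by (intro nn_integral_mono) (auto simp: indicator_def)
  finally have B: "ennreal l * emeasure lborel ?B \<le> (\<integral>\<^sup>+y. h y \<partial>lborel)" .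
  have "emeasure lborel {x. ennreal l < maxfun h x} \<le> emeasure lborel (?A \<union> ?B)"
    by (intro emeasure_mono) (auto simp: maxfun_def less_max_iff_disj)
  also have "\<dots> \<le> emeasure lborel ?A + emeasure lborel ?B"
    by (intro emeasure_subadditive) auto
  finally have "ennreal l * emeasure lborel {x. ennreal l < maxfun h x}
     \<le> ennreal l * emeasure lborel ?A + ennreal l * emeasure lborel ?B"
    by (simp add: distrib_left[symmetric] mult_left_mono)
  also have "\<dots> \<le> ennreal (5 ^ DIM('a) * unit_ball_vol DIM('a)) * (\<integral>\<^sup>+y. h y \<partial>lborel) + (\<integral>\<^sup>+y. h y \<partial>lborel)"
    by (intro add_mono weak_type_avg B assms)
  also have "\<dots> = ennreal (5 ^ DIM('a) * unit_ball_vol DIM('a) + 1) * (\<integral>\<^sup>+y. h y \<partial>lborel)"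
    by (subst ennreal_plus) (auto simp: distrib_right unit_ball_vol_nonneg)
  finally show ?thesis .
qed

lemma weak_type_maxfun_le:
  fixes h :: "'a::euclidean_space \<Rightarrow> ennreal" and l I :: real
  assumes [measurable]: "h \<in> borel_measurable borel" and l: "0 < l"
    and I: "(\<integral>\<^sup>+y. h y \<partial>lborel) \<le> ennreal I" "0 \<le> I"
  shows "emeasure lborel {x. ennreal l < maxfun h x}
     \<le> ennreal ((5 ^ DIM('a) * unit_ball_vol DIM('a) + 1) * I / l)"
proof -
  have "ennreal l * emeasure lborel {x. ennreal l < maxfun h x}
     \<le> ennreal (5 ^ DIM('a) * unit_ball_vol DIM('a) + 1) * ennreal I"
    using order.strict_trans1[OF I(1) ennreal_less_top]
    by (intro order_trans[OF weak_type_maxfun[OF assms(1,2)]] mult_left_mono I) auto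
  also have "\<dots> = ennreal l * ennreal ((5 ^ DIM('a) * unit_ball_vol DIM('a) + 1) * I / l)"
    using l I by (simp add: ennreal_mult[symmetric] unit_ball_vol_nonneg del: ennreal_plus)
  finally show ?thesis
    using l by (subst (asm) ennreal_mult_le_mult_iff) auto
qed

text \<open>Real powers of the maximal function are taken after \<open>enn2real\<close>, which sends \<open>\<infinity>\<close> to 0; this is harmless
  because the maximal function turns out to be finite almost everywhere (\<open>maxfun_finite_AE\<close>).\<close>

lemma kolmogorov_maxfun:
  fixes \<theta> :: real
  assumes \<theta>: "0 < \<theta>" "\<theta> < 1"
  shows "\<exists>C>0. \<forall>(h::'a::euclidean_space \<Rightarrow> ennreal) S m L. h \<in> borel_measurable borel \<longrightarrow> S \<in> sets borel \<longrightarrow>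
    0 \<le> m \<longrightarrow> 0 < L \<longrightarrow> emeasure lborel S \<le> ennreal m \<longrightarrow> (\<integral>\<^sup>+y. h y \<partial>lborel) \<le> ennreal (L * m) \<longrightarrow>
    (\<integral>\<^sup>+x. ennreal (enn2real (maxfun h x) powr \<theta>) * indicator S x \<partial>lborel) \<le> ennreal (C * m * L powr \<theta>)"
proof -
  define W where "W = 5 ^ DIM('a) * unit_ball_vol DIM('a) + 1"
  have W: "W > 0" unfolding W_def by (intro add_nonneg_pos) (auto simp: unit_ball_vol_nonneg)
  \<comment> \<open>The layer at height \<open>2 ^ j * L\<close> contributes at most
    \<open>(2 ^ Suc j * L) powr \<theta>\<close> times a measure of order \<open>1 / 2 ^ j\<close>.
    So q is the ratio of consecutive layer bounds, and q < 1 is exactly \<theta> < 1.\<close>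
  define q where "q = 2 powr (\<theta> - 1)"
  have q: "0 < q" "q < 1" unfolding q_def using \<theta> by (auto simp: powr_less_one)
  \<comment> \<open>The 1 accounts for the points with \<open>V x \<le> L\<close>, the geometric
    series for the dyadic layers above L.\<close>
  define C where "C = 1 + 2 powr \<theta> * W * (1 / (1 - q))"
  have C: "C > 0" unfolding C_def using W q by (intro add_pos_nonneg) auto
  show ?thesis
  proof (intro exI[of _ C] conjI C allI impI)
    fix h :: "'a \<Rightarrow> ennreal" and S :: "'a set" and m L
    assume [measurable]: "h \<in> borel_measurable borel" "S \<in> sets borel" and m: "0 \<le> m" and L: "0 < L"
      and S: "emeasure lborel S \<le> ennreal m" and h: "(\<integral>\<^sup>+y. h y \<partial>lborel) \<le> ennreal (L * m)"
    define V where "V x = enn2real (maxfun h x)" for x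
    define T where "T j = {x. ennreal (2 ^ j * L) < maxfun h x}" for j :: nat
    have [measurable]: "T j \<in> sets borel" for j unfolding T_def by measurable
    have pw: "ennreal (V x powr \<theta>) \<le> ennreal (L powr \<theta>) + (\<Sum>j. ennreal ((2 ^ Suc j * L) powr \<theta>) * indicator (T j) x)" for x
    proof (cases "V x \<le> L")
      case True
      then have "V x powr \<theta> \<le> L powr \<theta>" using \<theta> by (intro powr_mono2) (auto simp: V_def)
      then show ?thesis by (intro add_increasing2 ennreal_leI) auto
    next
      case False
      define j where "j = (LEAST j. V x \<le> 2 ^ Suc j * L)"
      obtain n where n: "V x / L < 2 ^ n" using real_arch_pow[of 2 "V x / L"] by auto
      have "V x \<le> 2 ^ Suc n * L" proof -
        have "V x < 2 ^ n * L" using n L by (simp add: pos_divide_less_eq)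
        moreover have "0 < 2 ^ n * L" using L by simp
        ultimately show ?thesis unfolding power_Suc mult.assoc by linarith
      qed
      then have j1: "V x \<le> 2 ^ Suc j * L" unfolding j_def by (rule LeastI)
      have j2: "2 ^ j * L < V x"
      proof (cases j)
        case 0 then show ?thesis using False by simp
      next
        case (Suc i)
        then have "\<not> V x \<le> 2 ^ Suc i * L" using not_less_Least[of i "\<lambda>j. V x \<le> 2 ^ Suc j * L"] j_def by auto
        then show ?thesis using Suc by simp
      qed
      have "x \<in> T j"
      proof -
        \<comment> \<open>By \<open>j2\<close> the value \<open>V x\<close> is positive, which
          excludes \<open>maxfun h x = \<infinity>\<close> because \<open>enn2real\<close> sends
          infinity to 0.\<close>
        have "maxfun h x = ennreal (V x)" using j2 L unfolding V_def
          by (metis ennreal_enn2real_if enn2real_top less_asym mult_pos_pos zero_less_numeral zero_less_power)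
        then show ?thesis unfolding T_def using j2 L by (simp add: ennreal_less_iff)
      qed
      have "ennreal (V x powr \<theta>) \<le> ennreal ((2 ^ Suc j * L) powr \<theta>) * indicator (T j) x"
        using j1 \<theta> \<open>x \<in> T j\<close> by (auto intro!: ennreal_leI powr_mono2 simp: V_def)
      also have "\<dots> \<le> (\<Sum>j. ennreal ((2 ^ Suc j * L) powr \<theta>) * indicator (T j) x)"
      proof -
        define t where "t i = ennreal ((2 ^ Suc i * L) powr \<theta>) * indicator (T i) x" for i
        have "t j = (\<Sum>i\<in>{j}. t i)" by simp
        also have "\<dots> \<le> (\<Sum>i. t i)" by (intro sum_le_suminf) auto
        finally show ?thesis by (simp only: t_def)
      qed
      finally show ?thesis by (simp add: add_increasing)
    qed
    have tb: "(\<integral>\<^sup>+x. ennreal ((2 ^ Suc j * L) powr \<theta>) * indicator (T j) x \<partial>lborel)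
      \<le> ennreal (m * L powr \<theta> * (2 powr \<theta> * W) * q ^ j)" for j
    proof -
      have "(\<integral>\<^sup>+x. ennreal ((2 ^ Suc j * L) powr \<theta>) * indicator (T j) x \<partial>lborel)
        = ennreal ((2 ^ Suc j * L) powr \<theta>) * emeasure lborel (T j)"
        by (subst nn_integral_cmult_indicator) auto
      also have "\<dots> \<le> ennreal ((2 ^ Suc j * L) powr \<theta>) * ennreal (W * (L * m) / (2 ^ j * L))"
        unfolding T_def W_def using L m h by (intro mult_left_mono weak_type_maxfun_le) auto
      also have "\<dots> = ennreal ((2 ^ Suc j * L) powr \<theta> * (W * (L * m) / (2 ^ j * L)))"
        using W L m by (intro ennreal_mult[symmetric]) auto
      also have "(2 ^ Suc j * L) powr \<theta> * (W * (L * m) / (2 ^ j * L)) = m * L powr \<theta> * (2 powr \<theta> * W) * q ^ j"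
      proof -
        have "(2 ^ Suc j * L) powr \<theta> = 2 powr \<theta> * L powr \<theta> * (2 powr \<theta>) ^ j"
          using L by (simp add: powr_mult powr_power mult.commute powr_realpow[symmetric] powr_powr)
        then show ?thesis using L by (simp add: q_def powr_diff power_divide field_simps)
      qed
      finally show ?thesis .
    qed
    \<comment> \<open>Only the constant part \<open>L powr \<theta>\<close> is confined to S; the
      layers are already summable over the whole space, so their restriction to S is
      dropped.\<close>
    have "(\<integral>\<^sup>+x. ennreal (V x powr \<theta>) * indicator S x \<partial>lborel)
       \<le> (\<integral>\<^sup>+x. ennreal (L powr \<theta>) * indicator S x + (\<Sum>j. ennreal ((2 ^ Suc j * L) powr \<theta>) * indicator (T j) x) \<partial>lborel)"
    proof (rule nn_integral_mono)
      fix x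
      show "ennreal (V x powr \<theta>) * indicator S x \<le> ennreal (L powr \<theta>) * indicator S x + (\<Sum>j. ennreal ((2 ^ Suc j * L) powr \<theta>) * indicator (T j) x)"
        using pw[of x] by (cases "x \<in> S") (simp_all del: power_Suc)
    qed
    also have "\<dots> = (\<integral>\<^sup>+x. ennreal (L powr \<theta>) * indicator S x \<partial>lborel) +
        (\<Sum>j. (\<integral>\<^sup>+x. ennreal ((2 ^ Suc j * L) powr \<theta>) * indicator (T j) x \<partial>lborel))"
      by (subst nn_integral_add) (auto simp: nn_integral_suminf)
    also have "(\<integral>\<^sup>+x. ennreal (L powr \<theta>) * indicator S x \<partial>lborel) = ennreal (L powr \<theta>) * emeasure lborel S"
      by (subst nn_integral_cmult_indicator) auto
    also have "\<dots> \<le> ennreal (L powr \<theta>) * ennreal m" by (intro mult_left_mono S) auto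
    also have "\<dots> = ennreal (m * L powr \<theta>)" using m by (simp add: ennreal_mult mult.commute)
    also have "(\<Sum>j. (\<integral>\<^sup>+x. ennreal ((2 ^ Suc j * L) powr \<theta>) * indicator (T j) x \<partial>lborel))
       \<le> (\<Sum>j. ennreal (m * L powr \<theta> * (2 powr \<theta> * W) * q ^ j))"
      by (intro suminf_le tb) auto
    also have "\<dots> = ennreal (m * L powr \<theta> * (2 powr \<theta> * W) * (1 / (1 - q)))"
      using m W q by (intro suminf_ennreal_eq sums_mult geometric_sums) auto
    also have "ennreal (m * L powr \<theta>) + \<dots> = ennreal (C * m * L powr \<theta>)"
      using m W q unfolding C_def by (subst ennreal_plus[symmetric]) (auto simp: algebra_simps)
    finally show "(\<integral>\<^sup>+x. ennreal (enn2real (maxfun h x) powr \<theta>) * indicator S x \<partial>lborel) \<le> ennreal (C * m * L powr \<theta>)"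
      by (simp add: V_def add_mono)
  qed
qed

section \<open>Localisation of the maximal function and averages of its powers\<close>

lemma ball_avg_mono:
  assumes "\<And>y. g y \<le> h y" shows "ball_avg \<rho> g x \<le> ball_avg \<rho> h x"
  unfolding ball_avg_def using assms by (intro mult_left_mono nn_integral_mono) auto

lemma maxfun_mono:
  assumes "\<And>y. g y \<le> h y" shows "maxfun g x \<le> maxfun h x"
  unfolding maxfun_def using assms by (intro max.mono SUP_mono) (auto intro: ball_avg_mono)

lemma nn_integral_ball_eq_avg:
  fixes h :: "'a::euclidean_space \<Rightarrow> ennreal"
  assumes "\<rho> > 0"
  shows "(\<integral>\<^sup>+y. (if dist x y < \<rho> then h y else 0) \<partial>lborel) = ennreal (\<rho> powr real DIM('a)) * ball_avg \<rho> h x"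
proof -
  have "ennreal (\<rho> powr real DIM('a)) * ennreal (\<rho> powr - real DIM('a)) = 1"
    using assms by (simp add: ennreal_mult[symmetric] powr_add[symmetric])
  then show ?thesis unfolding ball_avg_def by (simp add: mult.assoc[symmetric])
qed

text \<open>For y within \<open>2 powr k\<close> of x, a ball about y of radius at most
  \<open>2 powr k\<close> lies in the ball of radius \<open>2 powr (k+1)\<close> about x, so it sees
  only the truncated h. A larger ball about y lies in the ball of twice its radius about x, which is
  controlled by L at the price of the doubling factor \<open>2 ^ d\<close>.\<close>

lemma maxfun_local:
  fixes h :: "'a::euclidean_space \<Rightarrow> ennreal" and k :: int
  assumes y: "dist x y < 2 powr k" and L: "0 \<le> L"
    and avg: "\<And>j::int. j > k \<Longrightarrow> ball_avg (2 powr j) h x \<le> ennreal L"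
  shows "maxfun h y \<le> max (maxfun (\<lambda>z. if dist x z < 2 powr (k+1) then h z else 0) y) (ennreal (2 ^ DIM('a) * L))"
proof -
  let ?h1 = "\<lambda>z. if dist x z < 2 powr (k+1) then h z else 0"
  have two: "2 powr (real_of_int j + 1) = 2 * 2 powr real_of_int j" for j :: int
    by (simp add: powr_add)
  have 1: "h y \<le> maxfun ?h1 y"
  proof -
    have "dist x y < 2 powr (k+1)" using y by (rule less_le_trans) simp
    then show ?thesis using maxfun_ge(1)[of ?h1 y] by simp
  qed
  have 2: "ball_avg (2 powr j) h y \<le> max (maxfun ?h1 y) (ennreal (2 ^ DIM('a) * L))" for j :: int
  proof (cases "j \<le> k")
    case True
    have "dist x z < 2 powr (k+1)" if "dist y z < 2 powr j" for z
    proof -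
      have "(2::real) powr j \<le> 2 powr k" using True by simp
      then show ?thesis unfolding of_int_add of_int_1 two[of k] using that y dist_triangle[of x z y] by linarith
    qed
    then have "ball_avg (2 powr j) h y = ball_avg (2 powr j) ?h1 y"
      unfolding ball_avg_def by (intro arg_cong2[where f="(*)"] nn_integral_cong) auto
    then show ?thesis using maxfun_ge(2)[of j ?h1 y] by (simp add: le_max_iff_disj)
  next
    case False
    have *: "dist x z < 2 powr (j+1)" if "dist y z < 2 powr j" for z
    proof -
      have "(2::real) powr k \<le> 2 powr j" using False by simp
      then show ?thesis unfolding of_int_add of_int_1 two[of j] using that y dist_triangle[of x z y] by linarith
    qed
    have "ball_avg (2 powr j) h y \<le> ennreal ((2 powr j) powr - real DIM('a)) * (\<integral>\<^sup>+z. (if dist x z < 2 powr (j+1) then h z else 0) \<partial>lborel)"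
      unfolding ball_avg_def using * by (intro mult_left_mono nn_integral_mono) auto
    also have "\<dots> = ennreal ((2 powr j) powr - real DIM('a)) * (ennreal ((2 powr (j+1)) powr real DIM('a)) * ball_avg (2 powr (j+1)) h x)"
      by (subst nn_integral_ball_eq_avg) auto
    also have "\<dots> \<le> ennreal ((2 powr j) powr - real DIM('a)) * (ennreal ((2 powr (j+1)) powr real DIM('a)) * ennreal L)"
      using avg[of "j+1"] False by (intro mult_left_mono) auto
    also have "\<dots> = ennreal ((2 powr j) powr - real DIM('a) * (2 powr (j+1)) powr real DIM('a) * L)"
      using L by (simp add: ennreal_mult mult.assoc)
    also have "(2 powr j) powr - real DIM('a) * (2 powr (j+1)) powr real DIM('a) = 2 ^ DIM('a)"
      by (simp add: powr_powr powr_add[symmetric] algebra_simps powr_realpow[symmetric])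
    finally show ?thesis by (simp add: le_max_iff_disj)
  qed
  show ?thesis
    unfolding maxfun_def[of h] using 1 2 by (intro max.boundedI SUP_least) (auto simp: le_max_iff_disj)
qed

text \<open>After \<open>maxfun_local\<close> the far part is constant on the ball and Kolmogorov's
  inequality handles the truncated part. Leaving L free lets one lemma give two facts: L =
  \<open>maxfun h x\<close> yields the A1 property of the power, and L taken from the Morrey bound
  yields the Morrey bound of the power.\<close>

lemma avg_maxfun_powr:
  fixes \<theta> :: real
  assumes \<theta>: "0 < \<theta>" "\<theta> < 1"
  shows "\<exists>C>0. \<forall>(h::'a::euclidean_space \<Rightarrow> ennreal) (k::int) x L. h \<in> borel_measurable borel \<longrightarrow> 0 < L \<longrightarrow>
    (\<forall>j::int. k < j \<longrightarrow> ball_avg (2 powr real_of_int j) h x \<le> ennreal L) \<longrightarrow>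
    ball_avg (2 powr real_of_int k) (\<lambda>y. ennreal (enn2real (maxfun h y) powr \<theta>)) x \<le> ennreal (C * L powr \<theta>)"
proof -
  define d where "d = real DIM('a)"
  define v where "v = unit_ball_vol d"
  have v: "v > 0" unfolding v_def d_def by (rule unit_ball_vol_pos) auto
  obtain C1 where C1: "C1 > 0" "\<And>(h::'a \<Rightarrow> ennreal) S m L. h \<in> borel_measurable borel \<Longrightarrow> S \<in> sets borel \<Longrightarrow>
    0 \<le> m \<Longrightarrow> 0 < L \<Longrightarrow> emeasure lborel S \<le> ennreal m \<Longrightarrow> (\<integral>\<^sup>+y. h y \<partial>lborel) \<le> ennreal (L * m) \<Longrightarrow>
    (\<integral>\<^sup>+x. ennreal (enn2real (maxfun h x) powr \<theta>) * indicator S x \<partial>lborel) \<le> ennreal (C1 * m * L powr \<theta>)"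
    using kolmogorov_maxfun[OF \<theta>, where 'a='a] by blast
  define C where "C = C1 * (2 powr d + v) + (2 powr d) powr \<theta> * v"
  have C: "C > 0" unfolding C_def using C1 v by (intro add_pos_nonneg mult_pos_pos) (auto simp: add_pos_pos)
  show ?thesis
  proof (intro exI[of _ C] conjI C allI impI)
    fix h :: "'a \<Rightarrow> ennreal" and k :: int and x L
    assume [measurable]: "h \<in> borel_measurable borel" and L: "0 < L"
      and avg: "\<forall>j::int. k < j \<longrightarrow> ball_avg (2 powr j) h x \<le> ennreal L"
    define \<rho> where "\<rho> = 2 powr real_of_int k"
    have \<rho>: "\<rho> > 0" by (simp add: \<rho>_def)
    have two: "2 powr real_of_int (k+1) = 2 * \<rho>" by (simp add: \<rho>_def powr_add)
    define h1 where "h1 z = (if dist x z < 2 powr (k+1) then h z else 0)" for z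
    have [measurable]: "h1 \<in> borel_measurable borel" unfolding h1_def by measurable
    \<comment> \<open>Kolmogorov's inequality asks for a single m that bounds both the volume of the
      ball (the summand v) and the mass of \<open>h1\<close> divided by L (the summand
      \<open>2 powr d\<close>).\<close>
    define m where "m = (2 powr d + v) * \<rho> powr d"
    have m: "m \<ge> 0" unfolding m_def using v by auto
    have "(\<integral>\<^sup>+y. h1 y \<partial>lborel) = ennreal ((2 * \<rho>) powr d) * ball_avg (2 powr (k+1)) h x"
      unfolding h1_def d_def using \<rho> two by (subst nn_integral_ball_eq_avg) auto
    also have "\<dots> \<le> ennreal ((2 * \<rho>) powr d) * ennreal L"
      using avg[rule_format, of "k+1"] by (intro mult_left_mono) auto
    also have "\<dots> = ennreal (L * (2 powr d * \<rho> powr d))"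
      using L \<rho> by (simp add: ennreal_mult powr_mult mult_ac)
    also have "\<dots> \<le> ennreal (L * m)"
      unfolding m_def using L v \<rho> by (intro ennreal_leI mult_left_mono mult_right_mono) auto
    finally have h1: "(\<integral>\<^sup>+y. h1 y \<partial>lborel) \<le> ennreal (L * m)" .
    have eb: "emeasure lborel (ball x \<rho>) = ennreal (v * \<rho> powr d)"
      using \<rho> by (simp add: emeasure_ball v_def d_def powr_realpow)
    have S: "emeasure lborel (ball x \<rho>) \<le> ennreal m"
      unfolding eb m_def by (intro ennreal_leI mult_right_mono) auto
    have K: "(\<integral>\<^sup>+y. ennreal (enn2real (maxfun h1 y) powr \<theta>) * indicator (ball x \<rho>) y \<partial>lborel) \<le> ennreal (C1 * m * L powr \<theta>)"
      by (rule C1(2)[OF _ _ m L S h1]) auto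
    have pw: "ennreal (enn2real (maxfun h y) powr \<theta>) \<le> ennreal (enn2real (maxfun h1 y) powr \<theta>) + ennreal ((2 powr d * L) powr \<theta>)"
      if "dist x y < \<rho>" for y
    proof -
      have a: "maxfun h y \<le> max (maxfun h1 y) (ennreal (2 powr d * L))"
        using maxfun_local[of x y k L h] that avg L unfolding \<rho>_def h1_def d_def by (simp add: powr_realpow)
      have b: "maxfun h1 y \<le> maxfun h y" by (intro maxfun_mono) (auto simp: h1_def)
      have "enn2real (maxfun h y) \<le> max (enn2real (maxfun h1 y)) (2 powr d * L)"
      proof (cases "maxfun h1 y = \<infinity>")
        \<comment> \<open>Here \<open>maxfun h y\<close> is infinite as well, so its
          \<open>enn2real\<close> is 0 and the bound still holds.\<close>
        case True then show ?thesis using b by (simp add: top_unique le_max_iff_disj)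
      next
        case False
        then obtain w where "maxfun h1 y = ennreal w" "0 \<le> w" by (cases "maxfun h1 y") auto
        then have "maxfun h y \<le> ennreal (max w (2 powr d * L))" using a mult_pos_pos[OF _ L, of "2 powr d"] by (cases "w \<le> 2 powr d * L") (auto simp: max_def ennreal_le_iff2 split: if_splits)
        then have "enn2real (maxfun h y) \<le> max w (2 powr d * L)" using \<open>0 \<le> w\<close> by (intro enn2real_leI) auto
        then show ?thesis using \<open>maxfun h1 y = ennreal w\<close> \<open>0 \<le> w\<close> by simp
      qed
      then have "enn2real (maxfun h y) powr \<theta> \<le> max (enn2real (maxfun h1 y)) (2 powr d * L) powr \<theta>"
        using \<theta> by (intro powr_mono2) auto
      also have "\<dots> \<le> enn2real (maxfun h1 y) powr \<theta> + (2 powr d * L) powr \<theta>" by (auto simp: max_def)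
      finally show ?thesis by (subst ennreal_plus[symmetric]) (auto intro: ennreal_leI simp del: ennreal_plus)
    qed
    have "(\<integral>\<^sup>+y. (if dist x y < \<rho> then ennreal (enn2real (maxfun h y) powr \<theta>) else 0) \<partial>lborel)
      \<le> (\<integral>\<^sup>+y. ennreal (enn2real (maxfun h1 y) powr \<theta>) * indicator (ball x \<rho>) y + ennreal ((2 powr d * L) powr \<theta>) * indicator (ball x \<rho>) y \<partial>lborel)"
      using pw by (intro nn_integral_mono) (auto simp: indicator_def)
    also have "\<dots> = (\<integral>\<^sup>+y. ennreal (enn2real (maxfun h1 y) powr \<theta>) * indicator (ball x \<rho>) y \<partial>lborel) + ennreal ((2 powr d * L) powr \<theta>) * emeasure lborel (ball x \<rho>)"
    proof -
      have [measurable]: "ball x \<rho> \<in> sets borel" by (rule borel_open) auto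
      have "(\<lambda>y. ennreal (enn2real (maxfun h1 y) powr \<theta>) * indicator (ball x \<rho>) y) \<in> borel_measurable lborel"
        by measurable
      then show ?thesis by (subst nn_integral_add) (simp_all add: nn_integral_cmult_indicator)
    qed
    also have "\<dots> \<le> ennreal (C1 * m * L powr \<theta>) + ennreal ((2 powr d * L) powr \<theta>) * ennreal (v * \<rho> powr d)"
      unfolding eb by (intro add_mono K) auto
    also have "\<dots> = ennreal (C1 * m * L powr \<theta> + (2 powr d * L) powr \<theta> * (v * \<rho> powr d))"
      using C1 m v by (subst ennreal_plus) (auto simp: ennreal_mult)
    also have "C1 * m * L powr \<theta> + (2 powr d * L) powr \<theta> * (v * \<rho> powr d) = \<rho> powr d * (C * L powr \<theta>)"
      using L by (simp add: m_def C_def powr_mult algebra_simps)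
    finally have "ball_avg \<rho> (\<lambda>y. ennreal (enn2real (maxfun h y) powr \<theta>)) x \<le> ennreal (\<rho> powr - d) * ennreal (\<rho> powr d * (C * L powr \<theta>))"
      unfolding ball_avg_def d_def by (intro mult_left_mono) auto
    also have "\<dots> = ennreal (C * L powr \<theta>)"
      using \<rho> C by (simp add: ennreal_mult[symmetric] mult.assoc[symmetric] powr_add[symmetric])
    finally show "ball_avg (2 powr k) (\<lambda>y. ennreal (enn2real (maxfun h y) powr \<theta>)) x \<le> ennreal (C * L powr \<theta>)"
      by (simp add: \<rho>_def)
  qed
qed

text \<open>Inside a fixed ball the far part is bounded, so infinite values must come from a
  truncation of h, which has finite integral. Letting the level tend to infinity in the weak type
  estimate makes the set of such points null.\<close>

lemma maxfun_finite_AE: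
  fixes h :: "'a::euclidean_space \<Rightarrow> ennreal"
  assumes [measurable]: "h \<in> borel_measurable borel"
    and avg: "\<And>(k::int) x. \<exists>L. 0 \<le> L \<and> (\<forall>j::int. k < j \<longrightarrow> ball_avg (2 powr real_of_int j) h x \<le> ennreal L)"
  shows "AE x in lborel. maxfun h x < \<infinity>"
proof -
  define Z where "Z k = {y \<in> ball (0::'a) (2 powr real_of_int k). maxfun h y = \<infinity>}" for k
  have "Z k \<in> null_sets lborel" for k
  proof -
    obtain L where L: "0 \<le> L" "\<And>j::int. j > k \<Longrightarrow> ball_avg (2 powr j) h 0 \<le> ennreal L" using avg[of k 0] by auto
    define h1 where "h1 z = (if dist 0 z < 2 powr (k+1) then h z else 0)" for z
    have [measurable]: "h1 \<in> borel_measurable borel" unfolding h1_def by measurable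
    have "(\<integral>\<^sup>+y. h1 y \<partial>lborel) = ennreal ((2 powr (k+1)) powr real DIM('a)) * ball_avg (2 powr (k+1)) h 0"
      unfolding h1_def by (subst nn_integral_ball_eq_avg) auto
    also have "\<dots> \<le> ennreal ((2 powr (k+1)) powr real DIM('a)) * ennreal L"
      using L(2)[of "k+1"] by (intro mult_left_mono) auto
    also have "\<dots> = ennreal ((2 powr (k+1)) powr real DIM('a) * L)" using L by (simp add: ennreal_mult)
    finally have h1: "(\<integral>\<^sup>+y. h1 y \<partial>lborel) \<le> ennreal ((2 powr (k+1)) powr real DIM('a) * L)" .
    define D where "D = (5 ^ DIM('a) * unit_ball_vol DIM('a) + 1) * ((2 powr (k+1)) powr real DIM('a) * L)"
    have [measurable]: "Z k \<in> sets borel" unfolding Z_def by measurable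
    have sub: "emeasure lborel (Z k) \<le> ennreal (D / l)" if "l > 0" for l
    proof -
      have "maxfun h1 y = \<infinity>" if "y \<in> Z k" for y
        using maxfun_local[of 0 y k L h] L that unfolding Z_def h1_def[symmetric] by (auto simp: top_unique max_def split: if_splits)
      then have "Z k \<subseteq> {x. ennreal l < maxfun h1 x}" by auto
      then have "emeasure lborel (Z k) \<le> emeasure lborel {x. ennreal l < maxfun h1 x}"
        by (intro emeasure_mono) auto
      also have "\<dots> \<le> ennreal (D / l)"
        unfolding D_def using that h1 L by (intro weak_type_maxfun_le) auto
      finally show ?thesis .
    qed
    have D: "D \<ge> 0" unfolding D_def using L by (auto simp: unit_ball_vol_nonneg)
    have "emeasure lborel (Z k) \<le> 0"
    proof (rule LIMSEQ_le_const)
      show "(\<lambda>n. ennreal (D / real (Suc n))) \<longlonglongrightarrow> 0"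
        using tendsto_ennrealI[OF LIMSEQ_Suc[OF lim_const_over_n[of D]]] by simp
      show "\<exists>N. \<forall>n\<ge>N. emeasure lborel (Z k) \<le> ennreal (D / real (Suc n))"
        by (intro exI[of _ 0] allI impI sub) auto
    qed
    then show ?thesis by (auto simp: null_sets_def)
  qed
  then have "(\<Union>k. Z k) \<in> null_sets lborel" by (intro null_sets_UN') auto
  moreover have "{x \<in> space lborel. \<not> maxfun h x < \<infinity>} \<subseteq> (\<Union>k. Z k)"
  proof
    fix x assume "x \<in> {x \<in> space lborel. \<not> maxfun h x < \<infinity>}"
    then have x: "maxfun h x = \<infinity>" by (simp add: less_top[symmetric])
    obtain n where "norm x < 2 ^ n" using real_arch_pow[of 2 "norm x"] by auto
    then have "x \<in> Z (int n)" using x by (simp add: Z_def powr_realpow)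
    then show "x \<in> (\<Union>k. Z k)" by auto
  qed
  ultimately show ?thesis by (rule AE_I')
qed

section \<open>Riesz potentials of powers of the maximal function\<close>

text \<open>In the shell \<open>2 powr (m - 1) \<le> norm z < 2 powr m\<close> the single term with
  index m already dominates the kernel; the other terms are merely nonnegative. Indices m \<le> k
  fall into the first sum, m > k into the second. At z = 0 the left side is 0, because
  \<open>0 powr \<beta> = 0\<close>.\<close>

lemma riesz_kernel_split:
  fixes z :: "'a::real_normed_vector" and \<beta> :: real and k :: int
  assumes \<beta>: "\<beta> < 0"
  shows "ennreal (norm z powr \<beta>) \<le>
     (\<Sum>n. ennreal (2 powr (- \<beta>) * (2 powr (k - int n)) powr \<beta>) * (if norm z < 2 powr (k - int n) then 1 else 0))
   + (\<Sum>n. ennreal (2 powr (- \<beta>) * (2 powr (k + 1 + int n)) powr \<beta>) * (if norm z < 2 powr (k + 1 + int n) then 1 else 0))"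
    (is "_ \<le> (\<Sum>n. ?f (k - int n)) + (\<Sum>n. ?f (k + 1 + int n))")
proof (cases "z = 0")
  case False
  define m where "m = \<lfloor>log 2 (norm z)\<rfloor> + 1"
  have z: "norm z > 0" using False by simp
  have m1: "norm z < 2 powr m"
  proof -
    have "log 2 (norm z) < m" unfolding m_def by linarith
    then show ?thesis using z by (simp add: log_less_iff)
  qed
  have m2: "2 powr (real_of_int m - 1) \<le> norm z"
  proof -
    have "real_of_int m - 1 \<le> log 2 (norm z)" unfolding m_def by simp
    then show ?thesis using z by (simp add: le_log_iff)
  qed
  have "norm z powr \<beta> \<le> (2 powr (real_of_int m - 1)) powr \<beta>"
    using m2 \<beta> by (intro powr_mono2') auto
  also have "\<dots> = 2 powr (- \<beta>) * (2 powr m) powr \<beta>"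
    by (simp add: powr_powr powr_add[symmetric] algebra_simps)
  finally have le: "ennreal (norm z powr \<beta>) \<le> ?f m" using m1 by (simp add: ennreal_leI)
  show ?thesis
  proof (cases "m \<le> k")
    case True
    have "?f m = (\<Sum>n\<in>{nat (k - m)}. ?f (k - int n))" using True by simp
    also have "\<dots> \<le> (\<Sum>n. ?f (k - int n))" by (intro sum_le_suminf) auto
    finally show ?thesis using le by (intro add_increasing2) auto
  next
    case False
    have "?f m = (\<Sum>n\<in>{nat (m - k - 1)}. ?f (k + 1 + int n))" using False by simp
    also have "\<dots> \<le> (\<Sum>n. ?f (k + 1 + int n))" by (intro sum_le_suminf) auto
    finally show ?thesis using le by (intro add_increasing) auto
  qed
qed simp

text \<open>The integral of one kernel term carries the radius to the power
  \<open>\<alpha> - d\<close> and the unnormalised average contributes d, which leaves the power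
  \<alpha>. The cut k remains free so that small and large radii can be estimated
  differently.\<close>

lemma riesz_le_sum_avg:
  fixes F :: "'a::euclidean_space \<Rightarrow> ennreal" and \<alpha> :: real and k :: int
  assumes \<alpha>: "\<alpha> < DIM('a)" and [measurable]: "F \<in> borel_measurable borel"
  shows "(\<integral>\<^sup>+y. ennreal (norm (x - y) powr (\<alpha> - DIM('a))) * F y \<partial>lborel) \<le>
     (\<Sum>n. ennreal (2 powr (DIM('a) - \<alpha>) * (2 powr (k - int n)) powr \<alpha>) * ball_avg (2 powr (k - int n)) F x)
   + (\<Sum>n. ennreal (2 powr (DIM('a) - \<alpha>) * (2 powr (k + 1 + int n)) powr \<alpha>) * ball_avg (2 powr (k + 1 + int n)) F x)"
proof -
  define \<beta> where "\<beta> = \<alpha> - DIM('a)"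
  let ?c = "2 powr (- \<beta>)"
  have \<beta>: "\<beta> < 0" using \<alpha> by (simp add: \<beta>_def)
  let ?g = "\<lambda>j::int. \<lambda>y. ennreal (?c * (2 powr j) powr \<beta>) * (if dist x y < 2 powr j then 1 else 0) * F y"
  have pt: "ennreal (norm (x - y) powr \<beta>) * F y \<le> (\<Sum>n. ?g (k - int n) y) + (\<Sum>n. ?g (k + 1 + int n) y)" for y
  proof -
    have "ennreal (norm (x - y) powr \<beta>) * F y \<le> ((\<Sum>n. ennreal (?c * (2 powr (k - int n)) powr \<beta>) * (if norm (x - y) < 2 powr (k - int n) then 1 else 0))
   + (\<Sum>n. ennreal (?c * (2 powr (k + 1 + int n)) powr \<beta>) * (if norm (x - y) < 2 powr (k + 1 + int n) then 1 else 0))) * F y"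
      by (intro mult_right_mono riesz_kernel_split \<beta>) auto
    then show ?thesis by (simp add: distrib_right ennreal_suminf_multc dist_norm)
  qed
  have int: "(\<integral>\<^sup>+y. ?g j y \<partial>lborel) = ennreal (?c * (2 powr j) powr \<alpha>) * ball_avg (2 powr j) F x" for j
  proof -
    have "(\<integral>\<^sup>+y. ?g j y \<partial>lborel) = (\<integral>\<^sup>+y. ennreal (?c * (2 powr j) powr \<beta>) * (if dist x y < 2 powr j then F y else 0) \<partial>lborel)"
      by (intro nn_integral_cong) auto
    also have "\<dots> = ennreal (?c * (2 powr j) powr \<beta>) * (\<integral>\<^sup>+y. (if dist x y < 2 powr j then F y else 0) \<partial>lborel)"
      by (subst nn_integral_cmult) auto
    also have "\<dots> = ennreal (?c * (2 powr j) powr \<beta>) * ennreal ((2 powr j) powr DIM('a)) * ball_avg (2 powr j) F x"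
      by (subst nn_integral_ball_eq_avg) (auto simp: mult.assoc)
    also have "ennreal (?c * (2 powr j) powr \<beta>) * ennreal ((2 powr j) powr DIM('a)) = ennreal (?c * (2 powr j) powr \<alpha>)"
      by (simp add: ennreal_mult[symmetric] mult.assoc powr_add[symmetric] \<beta>_def)
    finally show ?thesis .
  qed
  have "(\<integral>\<^sup>+y. ennreal (norm (x - y) powr \<beta>) * F y \<partial>lborel) \<le> (\<integral>\<^sup>+y. (\<Sum>n. ?g (k - int n) y) + (\<Sum>n. ?g (k + 1 + int n) y) \<partial>lborel)"
    by (intro nn_integral_mono pt)
  also have "\<dots> = (\<integral>\<^sup>+y. (\<Sum>n. ?g (k - int n) y) \<partial>lborel) + (\<integral>\<^sup>+y. (\<Sum>n. ?g (k + 1 + int n) y) \<partial>lborel)"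
    by (intro nn_integral_add) auto
  also have "\<dots> = (\<Sum>n. (\<integral>\<^sup>+y. ?g (k - int n) y \<partial>lborel)) + (\<Sum>n. (\<integral>\<^sup>+y. ?g (k + 1 + int n) y \<partial>lborel))"
    by (intro arg_cong2[where f="(+)"] nn_integral_suminf) auto
  finally show ?thesis unfolding int by (simp add: \<beta>_def)
qed

lemma suminf_geometric_le:
  fixes a :: "nat \<Rightarrow> ennreal" and c q :: real
  assumes "0 \<le> c" "0 < q" "q < 1" "\<And>n. a n \<le> ennreal (c * q ^ n)"
  shows "(\<Sum>n. a n) \<le> ennreal (c * (1 / (1 - q)))"
proof -
  have "(\<Sum>n. a n) \<le> (\<Sum>n. ennreal (c * q ^ n))" by (intro suminf_le assms) auto
  also have "\<dots> = ennreal (c * (1 / (1 - q)))"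
    using assms by (intro suminf_ennreal_eq sums_mult geometric_sums) auto
  finally show ?thesis .
qed

text \<open>Hedberg's argument: radii below a threshold use the uniform bound X, radii above it the
  decaying bound. The first series converges because \<alpha> > 0, the second because s > 1, and the
  threshold is chosen to balance them.\<close>

lemma riesz_bound:
  fixes \<alpha> s :: real
  assumes \<alpha>: "0 < \<alpha>" "\<alpha> < DIM('a::euclidean_space)" and s: "1 < s"
  shows "\<exists>C>0. \<forall>(F::'a \<Rightarrow> ennreal) x X Y. F \<in> borel_measurable borel \<longrightarrow> 0 < X \<longrightarrow> 0 < Y \<longrightarrow>
    (\<forall>k::int. ball_avg (2 powr k) F x \<le> ennreal X) \<longrightarrow>
    (\<forall>k::int. ball_avg (2 powr k) F x \<le> ennreal (Y powr s * (2 powr k) powr (- \<alpha> * s))) \<longrightarrow>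
    (\<integral>\<^sup>+y. ennreal (norm (x - y) powr (\<alpha> - DIM('a))) * F y \<partial>lborel) \<le> ennreal (C * Y * X powr (1 - 1 / s))"
proof -
  define c where "c = 2 powr (DIM('a) - \<alpha>)"
  have c: "c > 0" by (simp add: c_def)
  \<comment> \<open>q1 is the ratio of the terms when the radius is halved (small radii, factor
    radius to the \<alpha>), q2 when it is doubled (large radii, factor radius to the
    \<open>\<alpha> * (1 - s)\<close>).\<close>
  define q1 where "q1 = 2 powr (- \<alpha>)"
  define q2 where "q2 = 2 powr (\<alpha> * (1 - s))"
  have q1: "0 < q1" "q1 < 1" unfolding q1_def using \<alpha> by (auto simp: powr_less_one)
  have q2: "0 < q2" "q2 < 1" unfolding q2_def using \<alpha> s by (auto intro!: powr_less_one simp: mult_pos_neg)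
  define C where "C = c * (1 / (1 - q1)) + c * (1 / (1 - q2))"
  have C: "C > 0" unfolding C_def using c q1 q2 by (intro add_pos_pos mult_pos_pos) auto
  show ?thesis
  proof (intro exI[of _ C] conjI C allI impI)
    fix F :: "'a \<Rightarrow> ennreal" and x X Y
    assume [measurable]: "F \<in> borel_measurable borel" and X: "0 < X" and Y: "0 < Y"
     and b1: "\<forall>k::int. ball_avg (2 powr k) F x \<le> ennreal X"
     and b2: "\<forall>k::int. ball_avg (2 powr k) F x \<le> ennreal (Y powr s * (2 powr k) powr (- \<alpha> * s))"
    \<comment> \<open>\<open>\<delta>\<close> is the radius at which the two bounds X and \<open>Y\<^sup>s \<delta>\<^sup>-\<^sup>\<alpha>\<^sup>s\<close> agree.\<close>
    define \<delta> where "\<delta> = (Y * X powr (- 1 / s)) powr (1 / \<alpha>)"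
    have \<delta>: "\<delta> > 0" unfolding \<delta>_def using X Y by simp
    have \<delta>\<alpha>: "\<delta> powr \<alpha> = Y * X powr (- 1 / s)"
      unfolding \<delta>_def using X Y \<alpha> by (simp add: powr_powr)
    define k where "k = \<lfloor>log 2 \<delta>\<rfloor>"
    have k1: "2 powr real_of_int k \<le> \<delta>"
    proof -
      have "real_of_int k \<le> log 2 \<delta>" unfolding k_def by simp
      then show ?thesis using \<delta> by (simp add: le_log_iff)
    qed
    have k2: "\<delta> \<le> 2 powr (real_of_int k + 1)"
    proof -
      have "log 2 \<delta> \<le> real_of_int k + 1" unfolding k_def by linarith
      then show ?thesis using \<delta> by (simp add: log_le_iff)
    qed
    \<comment> \<open>R is the common value of both contributions at the threshold, as
      \<open>R1\<close> and \<open>R2\<close> verify; each series is then R times a geometric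
      series.\<close>
    define R where "R = Y * X powr (1 - 1 / s)"
    have R: "R > 0" using X Y by (simp add: R_def)
    have R1: "\<delta> powr \<alpha> * X = R"
      unfolding R_def \<delta>\<alpha> using X by (simp add: powr_diff powr_minus field_simps)
    have R2: "\<delta> powr (\<alpha> * (1 - s)) * Y powr s = R"
    proof -
      have "\<delta> powr (\<alpha> * (1 - s)) = (Y * X powr (- 1 / s)) powr (1 - s)"
        using \<delta> by (simp add: powr_powr[symmetric] \<delta>\<alpha>)
      also have "\<dots> = Y powr (1 - s) * X powr ((- 1 / s) * (1 - s))"
        using X Y by (simp add: powr_mult powr_powr)
      also have "(- 1 / s) * (1 - s) = 1 - 1 / s" using s by (simp add: field_simps)
      finally show ?thesis unfolding R_def using Y by (simp add: powr_add[symmetric] mult_ac)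
    qed
    have "(\<Sum>n. ennreal (c * (2 powr (k - int n)) powr \<alpha>) * ball_avg (2 powr (k - int n)) F x) \<le> ennreal (c * R * (1 / (1 - q1)))"
    proof (rule suminf_geometric_le)
      fix n
      have "(2 powr real_of_int (k - int n)) powr \<alpha> = (2 powr real_of_int k) powr \<alpha> * q1 ^ n"
        by (simp add: q1_def powr_powr powr_power powr_add[symmetric] algebra_simps powr_realpow[symmetric])
      also have "\<dots> \<le> \<delta> powr \<alpha> * q1 ^ n"
        using k1 \<alpha> q1 by (intro mult_right_mono powr_mono2) auto
      finally have e: "c * (2 powr (k - int n)) powr \<alpha> * X \<le> c * R * q1 ^ n"
        using c X R1 by (simp add: mult_left_mono mult_right_mono mult.assoc mult.left_commute[of X] mult.commute[of X] flip: R1)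
      have "ennreal (c * (2 powr (k - int n)) powr \<alpha>) * ball_avg (2 powr (k - int n)) F x
          \<le> ennreal (c * (2 powr (k - int n)) powr \<alpha>) * ennreal X"
        by (intro mult_left_mono b1[rule_format]) auto
      also have "\<dots> = ennreal (c * (2 powr (k - int n)) powr \<alpha> * X)" using c X by (simp add: ennreal_mult)
      also have "\<dots> \<le> ennreal (c * R * q1 ^ n)" by (intro ennreal_leI e)
      finally show "ennreal (c * (2 powr (k - int n)) powr \<alpha>) * ball_avg (2 powr (k - int n)) F x \<le> ennreal (c * R * q1 ^ n)" .
    qed (use c R q1 in auto)
    moreover have "(\<Sum>n. ennreal (c * (2 powr (k + 1 + int n)) powr \<alpha>) * ball_avg (2 powr (k + 1 + int n)) F x) \<le> ennreal (c * R * (1 / (1 - q2)))"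
    proof (rule suminf_geometric_le)
      fix n
      let ?r = "2 powr real_of_int (k + 1 + int n)"
      have "?r powr \<alpha> * ?r powr (- \<alpha> * s) = (2 powr (real_of_int k + 1)) powr (\<alpha> * (1 - s)) * q2 ^ n"
        by (simp add: q2_def powr_powr powr_power powr_add[symmetric] algebra_simps powr_realpow[symmetric])
      also have "\<dots> \<le> \<delta> powr (\<alpha> * (1 - s)) * q2 ^ n"
        using k2 \<delta> \<alpha> s q2 by (intro mult_right_mono powr_mono2') (auto simp: mult_le_0_iff)
      finally have "c * Y powr s * (?r powr \<alpha> * ?r powr (- \<alpha> * s)) \<le> c * Y powr s * (\<delta> powr (\<alpha> * (1 - s)) * q2 ^ n)"
        using c by (intro mult_left_mono) auto
      then have e: "c * ?r powr \<alpha> * (Y powr s * ?r powr (- \<alpha> * s)) \<le> c * R * q2 ^ n"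
        by (simp add: R2[symmetric] mult_ac)
      have "ennreal (c * ?r powr \<alpha>) * ball_avg ?r F x
          \<le> ennreal (c * ?r powr \<alpha>) * ennreal (Y powr s * ?r powr (- \<alpha> * s))"
        by (intro mult_left_mono b2[rule_format]) auto
      also have "\<dots> = ennreal (c * ?r powr \<alpha> * (Y powr s * ?r powr (- \<alpha> * s)))" using c by (simp add: ennreal_mult)
      also have "\<dots> \<le> ennreal (c * R * q2 ^ n)" by (intro ennreal_leI e)
      finally show "ennreal (c * ?r powr \<alpha>) * ball_avg ?r F x \<le> ennreal (c * R * q2 ^ n)" .
    qed (use c R q2 in auto)
    ultimately have "(\<integral>\<^sup>+y. ennreal (norm (x - y) powr (\<alpha> - DIM('a))) * F y \<partial>lborel) \<le> ennreal (c * R * (1 / (1 - q1))) + ennreal (c * R * (1 / (1 - q2)))"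
      by (intro order_trans[OF riesz_le_sum_avg[of \<alpha> F x k]] add_mono) (use \<alpha> in \<open>auto simp: c_def\<close>)
    also have "\<dots> = ennreal (c * R * (1 / (1 - q1)) + c * R * (1 / (1 - q2)))"
      using c R q1 q2 by (intro ennreal_plus[symmetric]) auto
    also have "c * R * (1 / (1 - q1)) + c * R * (1 / (1 - q2)) = C * Y * X powr (1 - 1 / s)"
      by (simp add: C_def R_def algebra_simps)
    finally show "(\<integral>\<^sup>+y. ennreal (norm (x - y) powr (\<alpha> - DIM('a))) * F y \<partial>lborel) \<le> ennreal (C * Y * X powr (1 - 1 / s))" .
  qed
qed

text \<open>\<open>riesz_bound\<close> is applied to the weight \<open>w^s = V^(s/p)\<close>, with X
  from its A1 property at x and Y from its Morrey bound. The factor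
  \<open>X powr (1 - 1 / s)\<close> turns \<open>w(x)^s\<close> into
  \<open>w(x)^(s-1)\<close>.\<close>

lemma riesz_maxfun_weight:
  fixes \<alpha> p s c :: real
  assumes \<alpha>: "0 < \<alpha>" "\<alpha> < DIM('a::euclidean_space)" and s: "1 < s" "s < p" and c: "0 < c"
  shows "\<exists>C>0. \<forall>A (h::'a \<Rightarrow> ennreal) x. 0 < A \<longrightarrow> h \<in> borel_measurable borel \<longrightarrow>
    (\<forall>(k::int) x. ball_avg (2 powr real_of_int k) h x \<le> ennreal (c * (A * (2 powr real_of_int k) powr (- \<alpha>)) powr p)) \<longrightarrow>
    0 < maxfun h x \<longrightarrow> maxfun h x < \<infinity> \<longrightarrow>
    (\<integral>\<^sup>+y. ennreal (norm (x - y) powr (\<alpha> - DIM('a))) * ennreal (enn2real (maxfun h y) powr (s / p)) \<partial>lborel)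
      \<le> ennreal (C * A * enn2real (maxfun h x) powr ((s - 1) / p))"
proof -
  define \<theta> where "\<theta> = s / p"
  have \<theta>: "0 < \<theta>" "\<theta> < 1" using s by (auto simp: \<theta>_def)
  obtain C1 where C1: "C1 > 0" and avg: "\<And>(h::'a \<Rightarrow> ennreal) (k::int) x L. h \<in> borel_measurable borel \<Longrightarrow> 0 < L \<Longrightarrow>
    (\<forall>j::int. k < j \<longrightarrow> ball_avg (2 powr real_of_int j) h x \<le> ennreal L) \<Longrightarrow>
    ball_avg (2 powr real_of_int k) (\<lambda>y. ennreal (enn2real (maxfun h y) powr \<theta>)) x \<le> ennreal (C1 * L powr \<theta>)"
    using avg_maxfun_powr[OF \<theta>, where 'a='a] by blast
  obtain C2 where C2: "C2 > 0" and rb: "\<And>(F::'a \<Rightarrow> ennreal) x X Y. F \<in> borel_measurable borel \<Longrightarrow> 0 < X \<Longrightarrow> 0 < Y \<Longrightarrow>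
    (\<forall>k::int. ball_avg (2 powr k) F x \<le> ennreal X) \<Longrightarrow>
    (\<forall>k::int. ball_avg (2 powr k) F x \<le> ennreal (Y powr s * (2 powr k) powr (- \<alpha> * s))) \<Longrightarrow>
    (\<integral>\<^sup>+y. ennreal (norm (x - y) powr (\<alpha> - DIM('a))) * F y \<partial>lborel) \<le> ennreal (C2 * Y * X powr (1 - 1 / s))"
    using riesz_bound[OF \<alpha> s(1)] by blast
  \<comment> \<open>Chosen so that \<open>(D * A) powr s\<close> absorbs the constant
    \<open>C1 * c powr \<theta>\<close> of the Morrey bound for the power; note
    \<open>p * \<theta> = s\<close>.\<close>
  define D where "D = (C1 * c powr \<theta>) powr (1 / s)"
  have D: "D > 0" using C1 c by (simp add: D_def)
  define C where "C = C2 * D * C1 powr (1 - 1 / s)"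
  have C: "C > 0" using C1 C2 D by (simp add: C_def)
  show ?thesis
  proof (intro exI[of _ C] conjI C allI impI)
    fix A and h :: "'a \<Rightarrow> ennreal" and x
    assume A: "0 < A" and [measurable]: "h \<in> borel_measurable borel"
      and M: "\<forall>(k::int) x. ball_avg (2 powr real_of_int k) h x \<le> ennreal (c * (A * (2 powr real_of_int k) powr (- \<alpha>)) powr p)"
      and x: "0 < maxfun h x" "maxfun h x < \<infinity>"
    define v where "v = enn2real (maxfun h x)"
    have v: "v > 0" "maxfun h x = ennreal v" unfolding v_def using x by (auto simp: enn2real_positive_iff)
    let ?F = "\<lambda>y. ennreal (enn2real (maxfun h y) powr \<theta>)"
    have 1: "ball_avg (2 powr real_of_int k) ?F x \<le> ennreal (C1 * v powr \<theta>)" for k :: int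
      using v maxfun_ge(2)[of _ h x] by (intro avg) auto
    have 2: "ball_avg (2 powr real_of_int k) ?F x \<le> ennreal ((D * A) powr s * (2 powr real_of_int k) powr (- \<alpha> * s))" for k :: int
    proof -
      let ?L = "c * (A * (2 powr real_of_int k) powr (- \<alpha>)) powr p"
      have "ball_avg (2 powr real_of_int k) ?F x \<le> ennreal (C1 * ?L powr \<theta>)"
      proof (rule avg)
        show "\<forall>j::int. k < j \<longrightarrow> ball_avg (2 powr real_of_int j) h x \<le> ennreal ?L"
        proof (intro allI impI)
          fix j :: int assume j: "k < j"
          \<comment> \<open>The Morrey bound decreases with the radius, so its value at scale k
            serves all larger scales at once.\<close>
          have "c * (A * (2 powr real_of_int j) powr (- \<alpha>)) powr p \<le> ?L"
            using j c A s \<alpha> by (intro mult_left_mono powr_mono2 powr_mono2') auto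
          then show "ball_avg (2 powr real_of_int j) h x \<le> ennreal ?L"
            using M by (meson ennreal_leI order_trans)
        qed
      qed (use c A in auto)
      also have "C1 * ?L powr \<theta> = (D * A) powr s * (2 powr real_of_int k) powr (- \<alpha> * s)"
        using c A C1 s by (simp add: D_def \<theta>_def powr_mult powr_powr)
      finally show ?thesis .
    qed
    have "(\<integral>\<^sup>+y. ennreal (norm (x - y) powr (\<alpha> - DIM('a))) * ?F y \<partial>lborel) \<le> ennreal (C2 * (D * A) * (C1 * v powr \<theta>) powr (1 - 1 / s))"
      using 1 2 C1 D A v by (intro rb) auto
    also have "C2 * (D * A) * (C1 * v powr \<theta>) powr (1 - 1 / s) = C * A * v powr (\<theta> * (1 - 1 / s))"
      using C1 v by (simp add: C_def powr_mult powr_powr)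
    also have "\<theta> * (1 - 1 / s) = (s - 1) / p" using s by (simp add: \<theta>_def field_simps)
    finally show "(\<integral>\<^sup>+y. ennreal (norm (x - y) powr (\<alpha> - DIM('a))) * ennreal (enn2real (maxfun h y) powr (s / p)) \<partial>lborel)
      \<le> ennreal (C * A * enn2real (maxfun h x) powr ((s - 1) / p))"
      by (simp add: \<theta>_def v_def)
  qed
qed

text \<open>Optimising over \<open>\<tau>\<close> after integration replaces Hoelder's inequality in Schur's test.\<close>

lemma young_scaled:
  fixes f \<psi> \<tau> r :: real
  assumes "0 \<le> f" "0 < \<psi>" "0 < \<tau>" "1 < r"
  shows "f \<le> \<tau> * \<psi> + \<tau> powr (1 - r) * (\<psi> powr (1 - r) * f powr r)"
proof (cases "f \<le> \<tau> * \<psi>")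
  case True then show ?thesis by (intro add_increasing2) auto
next
  case False
  then have f1: "f > \<tau> * \<psi>" by simp
  moreover have "0 < \<tau> * \<psi>" using assms by simp
  ultimately have f: "f > \<tau> * \<psi>" "f > 0" by linarith+
  have "f = f powr (1 - r) * f powr r" using f by (simp add: powr_add[symmetric])
  also have "\<dots> \<le> (\<tau> * \<psi>) powr (1 - r) * f powr r"
    using f assms by (intro mult_right_mono powr_mono2') auto
  also have "\<dots> = \<tau> powr (1 - r) * (\<psi> powr (1 - r) * f powr r)"
    using assms by (simp add: powr_mult)
  finally show ?thesis using assms by (intro add_increasing) auto
qed

text \<open>The free \<tau> is chosen so that both terms on the right of \<open>le\<close> coincide;
  their sum is then twice the geometric mean of a and \<beta> with exponents 1 - 1/r and 1/r, and
  raising to the power r gives the factor \<open>2 powr r\<close>.\<close>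

lemma powr_le_of_scaled:
  fixes u a r :: real and \<beta> :: ennreal
  assumes "0 \<le> u" and a: "0 < a" and r: "1 < r"
    and le: "\<And>\<tau>. 0 < \<tau> \<Longrightarrow> ennreal u \<le> ennreal (\<tau> * a) + ennreal (\<tau> powr (1 - r)) * \<beta>"
  shows "ennreal (u powr r) \<le> ennreal (2 powr r * a powr (r - 1)) * \<beta>"
proof (cases \<beta>)
  case top
  then show ?thesis using a by (simp add: ennreal_mult_top)
next
  case (real B)
  have le': "u \<le> \<tau> * a + \<tau> powr (1 - r) * B" if "0 < \<tau>" for \<tau>
  proof -
    have "ennreal u \<le> ennreal (\<tau> * a + \<tau> powr (1 - r) * B)"
      using le[OF that] real a that by (simp add: ennreal_mult ennreal_plus)
    then show ?thesis using real a that by (subst (asm) ennreal_le_iff) auto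
  qed
  show ?thesis
  proof (cases "B = 0")
    case True
    \<comment> \<open>With B = 0 there is no balancing \<tau>; letting \<tau> tend to 0 forces u =
      0.\<close>
    have "u \<le> 0"
    proof (rule field_le_epsilon)
      fix e :: real assume "0 < e"
      then show "u \<le> 0 + e" using le'[of "e / a"] a True by simp
    qed
    then show ?thesis using assms by simp
  next
    case False
    then have B: "B > 0" using real by simp
    define \<tau> where "\<tau> = (B / a) powr (1 / r)"
    have \<tau>: "\<tau> > 0" using B a by (simp add: \<tau>_def)
    define Q where "Q = B powr (1 / r) * a powr (1 - 1 / r)"
    have 1: "\<tau> * a = Q" using B a unfolding \<tau>_def Q_def by (simp add: powr_divide powr_diff)
    have 2: "\<tau> powr (1 - r) * B = Q"
    proof -
      have "\<tau> powr (1 - r) = (B / a) powr (1 / r - 1)"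
        unfolding \<tau>_def using r by (simp add: powr_powr diff_divide_distrib)
      also have "\<dots> * B = Q" using B a unfolding Q_def by (simp add: powr_divide powr_diff)
      finally show ?thesis .
    qed
    have "u \<le> 2 * Q" using le'[OF \<tau>] 1 2 by simp
    then have "u powr r \<le> (2 * Q) powr r" using assms by (intro powr_mono2) auto
    also have "\<dots> = 2 powr r * a powr (r - 1) * B"
    proof -
      have "(1 - 1 / r) * r = r - 1" using r by (simp add: field_simps)
      then show ?thesis unfolding Q_def using B a r by (simp add: powr_mult powr_powr mult.commute)
    qed
    finally show ?thesis using real by (simp add: ennreal_mult[symmetric] ennreal_leI)
  qed
qed

section \<open>The weighted inequality for Riesz potentials\<close>

lemma ball_avg_eq_0_imp_AE:
  fixes h :: "'a::euclidean_space \<Rightarrow> ennreal"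
  assumes [measurable]: "h \<in> borel_measurable borel" and 0: "\<And>k::int. ball_avg (2 powr real_of_int k) h x = 0"
  shows "AE y in lborel. h y = 0"
proof -
  have "AE y in lborel. (if dist x y < 2 powr real_of_int k then h y else 0) = 0" for k
  proof -
    have "(\<integral>\<^sup>+y. (if dist x y < 2 powr real_of_int k then h y else 0) \<partial>lborel) = 0"
      using 0 by (subst nn_integral_ball_eq_avg) auto
    then show ?thesis by (subst (asm) nn_integral_0_iff_AE) auto
  qed
  then have "AE y in lborel. \<forall>k::int. (if dist x y < 2 powr real_of_int k then h y else 0) = 0"
    by (subst AE_all_countable) auto
  then show ?thesis
  proof eventually_elim
    case (elim y)
    obtain n where "dist x y < 2 ^ n" using real_arch_pow[of 2 "dist x y"] by auto
    then show ?case using elim[rule_format, of "int n"] by (simp add: powr_realpow)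
  qed
qed

lemma maxfun_eq_0_imp_AE:
  fixes h :: "'a::euclidean_space \<Rightarrow> ennreal"
  assumes "h \<in> borel_measurable borel" and "maxfun h x = 0"
  shows "AE y in lborel. h y = 0"
  using assms(1)
proof (rule ball_avg_eq_0_imp_AE)
  show "ball_avg (2 powr real_of_int k) h x = 0" for k
    using maxfun_ge(2)[of k h x] assms(2) by simp
qed

text \<open>Schur's test: Young's inequality with weight \<psi> bounds \<open>u^r\<close> at x by
  the potential of \<psi> to the power r - 1, times the potential of
  \<open>\<psi>^(1-r) * f^r\<close>. Tonelli moves the second potential onto the weight collected at
  x, where the potential estimate applies again and cancels \<open>\<psi>^(1-r)\<close>.\<close>

lemma riesz_trace_inequality:
  fixes \<alpha> r p c :: real
  assumes \<alpha>: "0 < \<alpha>" "\<alpha> < DIM('a::euclidean_space)" and r: "1 < r" "r < p" and c: "0 < c"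
  shows "\<exists>N>0. \<forall>A (b::'a \<Rightarrow> real) f u. 0 < A \<longrightarrow> b \<in> borel_measurable borel \<longrightarrow> (\<forall>x. 0 \<le> b x) \<longrightarrow>
    (\<forall>(k::int) x. ball_avg (2 powr real_of_int k) (\<lambda>y. ennreal (b y powr p)) x \<le> ennreal (c * (A * (2 powr real_of_int k) powr (- \<alpha>)) powr p)) \<longrightarrow>
    f \<in> borel_measurable borel \<longrightarrow> (\<forall>x. 0 \<le> f x) \<longrightarrow> (\<forall>x. 0 \<le> u x) \<longrightarrow>
    (\<forall>x. ennreal (u x) \<le> (\<integral>\<^sup>+y. ennreal (norm (x - y) powr (\<alpha> - DIM('a))) * ennreal (f y) \<partial>lborel)) \<longrightarrow>
    (\<integral>\<^sup>+x. ennreal (b x powr r * u x powr r) \<partial>lborel) \<le> ennreal (N * A powr r) * (\<integral>\<^sup>+x. ennreal (f x powr r) \<partial>lborel)"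
proof -
  \<comment> \<open>The bound \<open>t < (p - 1) / (r - 1)\<close> is precisely \<open>s < p\<close>
    for the s defined below.\<close>
  have q: "(p - 1) / (r - 1) > 1" using r by simp
  then obtain t where t: "1 < t" "t < p" "t < (p - 1) / (r - 1)"
    using dense[of 1 "min p ((p - 1) / (r - 1))"] r by auto
  \<comment> \<open>With \<open>\<psi> = w\<^sup>t\<close> the weight \<open>\<psi>\<^sup>1\<^sup>-\<^sup>r = w\<^sup>1\<^sup>-\<^sup>s\<close> produced by \<open>young_scaled\<close> cancels \<open>I\<^sub>\<alpha>(w\<^sup>s) \<le> C A w\<^sup>s\<^sup>-\<^sup>1\<close>.\<close>
  define s where "s = 1 + t * (r - 1)"
  have s: "1 < s" "s < p"
    using t r by (auto simp: s_def pos_less_divide_eq)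
  have p: "p > 0" using r by simp
  obtain Ct where Ct: "Ct > 0" and Kt: "\<And>A (h::'a \<Rightarrow> ennreal) x. 0 < A \<Longrightarrow> h \<in> borel_measurable borel \<Longrightarrow>
    (\<forall>(k::int) x. ball_avg (2 powr real_of_int k) h x \<le> ennreal (c * (A * (2 powr real_of_int k) powr (- \<alpha>)) powr p)) \<Longrightarrow>
    0 < maxfun h x \<Longrightarrow> maxfun h x < \<infinity> \<Longrightarrow>
    (\<integral>\<^sup>+y. ennreal (norm (x - y) powr (\<alpha> - DIM('a))) * ennreal (enn2real (maxfun h y) powr (t / p)) \<partial>lborel)
      \<le> ennreal (Ct * A * enn2real (maxfun h x) powr ((t - 1) / p))"
    using riesz_maxfun_weight[OF \<alpha> t(1,2) c] by blast
  obtain Cs where Cs: "Cs > 0" and Ks: "\<And>A (h::'a \<Rightarrow> ennreal) x. 0 < A \<Longrightarrow> h \<in> borel_measurable borel \<Longrightarrow>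
    (\<forall>(k::int) x. ball_avg (2 powr real_of_int k) h x \<le> ennreal (c * (A * (2 powr real_of_int k) powr (- \<alpha>)) powr p)) \<Longrightarrow>
    0 < maxfun h x \<Longrightarrow> maxfun h x < \<infinity> \<Longrightarrow>
    (\<integral>\<^sup>+y. ennreal (norm (x - y) powr (\<alpha> - DIM('a))) * ennreal (enn2real (maxfun h y) powr (s / p)) \<partial>lborel)
      \<le> ennreal (Cs * A * enn2real (maxfun h x) powr ((s - 1) / p))"
    using riesz_maxfun_weight[OF \<alpha> s c] by blast
  \<comment> \<open>One factor for each stage: \<open>2 powr r\<close> from optimising \<tau>,
    \<open>Ct powr (r - 1)\<close> from the potential of \<psi>, and Cs from the potential after
    Tonelli.\<close>
  define N where "N = 2 powr r * Ct powr (r - 1) * Cs"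
  have N: "N > 0" using Ct Cs by (simp add: N_def)
  show ?thesis
  proof (intro exI[of _ N] conjI N allI impI)
    fix A and b f u :: "'a \<Rightarrow> real"
    assume A: "0 < A" and [measurable]: "b \<in> borel_measurable borel" and b: "\<forall>x. 0 \<le> b x"
      and M: "\<forall>(k::int) x. ball_avg (2 powr real_of_int k) (\<lambda>y. ennreal (b y powr p)) x \<le> ennreal (c * (A * (2 powr real_of_int k) powr (- \<alpha>)) powr p)"
      and [measurable]: "f \<in> borel_measurable borel" and f: "\<forall>x. 0 \<le> f x" and u: "\<forall>x. 0 \<le> u x"
      and uf: "\<forall>x. ennreal (u x) \<le> (\<integral>\<^sup>+y. ennreal (norm (x - y) powr (\<alpha> - DIM('a))) * ennreal (f y) \<partial>lborel)"
    define h where "h y = ennreal (b y powr p)" for y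
    have [measurable]: "h \<in> borel_measurable borel" unfolding h_def by measurable
    have Mh: "\<forall>(k::int) x. ball_avg (2 powr real_of_int k) h x \<le> ennreal (c * (A * (2 powr real_of_int k) powr (- \<alpha>)) powr p)"
      using M unfolding h_def[abs_def] .
    let ?I = "\<integral>\<^sup>+x. ennreal (b x powr r * u x powr r) \<partial>lborel"
    let ?J = "\<integral>\<^sup>+x. ennreal (f x powr r) \<partial>lborel"
    show "?I \<le> ennreal (N * A powr r) * ?J"
    proof (cases "\<exists>x. maxfun h x = 0")
      \<comment> \<open>Negative powers of V occur below, so zeros of the maximal function must be
        excluded. A single zero already forces b = 0 almost everywhere.\<close>
      case True
      then obtain x where "maxfun h x = 0" by auto
      then have "AE y in lborel. h y = 0" by (intro maxfun_eq_0_imp_AE) auto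
      then have "AE y in lborel. ennreal (b y powr r * u y powr r) = 0"
        by eventually_elim (auto simp: h_def)
      then have "?I = (\<integral>\<^sup>+x. 0 \<partial>(lborel :: 'a measure))" by (rule nn_integral_cong_AE)
      then show ?thesis by simp
    next
      case False
      then have pos: "0 < maxfun h x" for x by (simp add: zero_less_iff_neq_zero)
      have fin: "AE x in lborel. maxfun h x < \<infinity>"
      proof (rule maxfun_finite_AE)
        fix k :: int and x
        let ?L = "\<lambda>j::int. c * (A * (2 powr real_of_int j) powr (- \<alpha>)) powr p"
        have "ball_avg (2 powr real_of_int j) h x \<le> ennreal (?L k)" if "k < j" for j :: int
        proof -
          have "?L j \<le> ?L k"
            using that c A r \<alpha> by (intro mult_left_mono powr_mono2 powr_mono2') auto
          then show ?thesis using Mh by (meson ennreal_leI order_trans)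
        qed
        then show "\<exists>L. 0 \<le> L \<and> (\<forall>j::int. k < j \<longrightarrow> ball_avg (2 powr j) h x \<le> ennreal L)"
          using c by (intro exI[of _ "?L k"]) auto
      qed auto
      define V where "V x = enn2real (maxfun h x)" for x
      have [measurable]: "V \<in> borel_measurable borel" unfolding V_def by measurable
      have Vpos: "0 < V x" if "maxfun h x < \<infinity>" for x
        using that pos[of x] by (simp add: V_def enn2real_positive_iff)
      define K where "K x y = ennreal (norm (x - y) powr (\<alpha> - DIM('a)))" for x y :: 'a
      have [measurable]: "(\<lambda>(x, y). K x y) \<in> borel_measurable (lborel \<Otimes>\<^sub>M lborel)"
        unfolding K_def by measurable
      have [measurable]: "K x \<in> borel_measurable borel" for x unfolding K_def by measurable
      define g where "g y = ennreal (V y powr ((1 - s) / p) * f y powr r)" for y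
      have [measurable]: "g \<in> borel_measurable borel" unfolding g_def by measurable
      define \<beta> where "\<beta> x = (\<integral>\<^sup>+y. K x y * g y \<partial>lborel)" for x
      have pt: "ennreal (b x powr r * u x powr r) \<le> ennreal (2 powr r * (Ct * A) powr (r - 1)) * (ennreal (V x powr (s / p)) * \<beta> x)"
        if x: "maxfun h x < \<infinity>" for x
      proof -
        define a where "a = Ct * A * V x powr ((t - 1) / p)"
        have a: "a > 0" using Ct A Vpos[OF x] by (simp add: a_def)
        have "ennreal (u x) \<le> ennreal (\<tau> * a) + ennreal (\<tau> powr (1 - r)) * \<beta> x" if \<tau>: "0 < \<tau>" for \<tau>
        proof -
          have "ennreal (u x) \<le> (\<integral>\<^sup>+y. K x y * ennreal (f y) \<partial>lborel)" using uf by (simp add: K_def)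
          also have "\<dots> \<le> (\<integral>\<^sup>+y. ennreal \<tau> * (K x y * ennreal (V y powr (t / p))) + ennreal (\<tau> powr (1 - r)) * (K x y * g y) \<partial>lborel)"
          proof (rule nn_integral_mono_AE, use fin in eventually_elim)
            case (elim y)
            have "ennreal (f y) \<le> ennreal (\<tau> * V y powr (t / p) + \<tau> powr (1 - r) * ((V y powr (t / p)) powr (1 - r) * f y powr r))"
              using f Vpos[OF elim] \<tau> r by (intro ennreal_leI young_scaled) auto
            also have "(V y powr (t / p)) powr (1 - r) = V y powr ((1 - s) / p)"
              by (simp add: powr_powr s_def algebra_simps)
            also have "ennreal (\<tau> * V y powr (t / p) + \<tau> powr (1 - r) * (V y powr ((1 - s) / p) * f y powr r))
              = ennreal \<tau> * ennreal (V y powr (t / p)) + ennreal (\<tau> powr (1 - r)) * g y"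
              unfolding g_def using \<tau> by (simp add: ennreal_mult ennreal_plus)
            finally have "K x y * ennreal (f y) \<le> K x y * (ennreal \<tau> * ennreal (V y powr (t / p)) + ennreal (\<tau> powr (1 - r)) * g y)"
              by (intro mult_left_mono) auto
            then show ?case by (simp add: distrib_left mult_ac)
          qed
          also have "\<dots> = ennreal \<tau> * (\<integral>\<^sup>+y. K x y * ennreal (V y powr (t / p)) \<partial>lborel) + ennreal (\<tau> powr (1 - r)) * \<beta> x"
            unfolding \<beta>_def by (simp add: nn_integral_add nn_integral_cmult)
          also have "\<dots> \<le> ennreal \<tau> * ennreal a + ennreal (\<tau> powr (1 - r)) * \<beta> x"
            using Kt[OF A _ Mh pos x] by (intro add_mono mult_left_mono) (auto simp: a_def K_def V_def)
          finally show ?thesis using \<tau> a by (simp add: ennreal_mult)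
        qed
        then have "ennreal (u x powr r) \<le> ennreal (2 powr r * a powr (r - 1)) * \<beta> x"
          using u a r by (intro powr_le_of_scaled) auto
        moreover have "b x powr r \<le> V x powr (r / p)"
        proof -
          have "ennreal (b x powr p) \<le> ennreal (V x)" using maxfun_ge(1)[of h x] x by (simp add: h_def V_def)
          then have "b x powr p \<le> V x" using Vpos[OF x] by (simp add: ennreal_le_iff)
          then have "(b x powr p) powr (r / p) \<le> V x powr (r / p)" using r by (intro powr_mono2) auto
          then show ?thesis using p by (simp add: powr_powr)
        qed
        ultimately have "ennreal (b x powr r) * ennreal (u x powr r) \<le> ennreal (V x powr (r / p)) * (ennreal (2 powr r * a powr (r - 1)) * \<beta> x)"
          by (intro mult_mono ennreal_leI) auto
        also have "\<dots> = ennreal (V x powr (r / p) * (2 powr r * a powr (r - 1))) * \<beta> x"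
          by (simp add: ennreal_mult mult.assoc)
        \<comment> \<open>In powers of w the exponents add up as r + (t - 1)(r - 1) = 1 + t (r - 1)
          = s: the weight left at x is exactly one to which the potential estimate applies.\<close>
        also have "V x powr (r / p) * (2 powr r * a powr (r - 1)) = 2 powr r * (Ct * A) powr (r - 1) * V x powr (s / p)"
        proof -
          have "a powr (r - 1) = (Ct * A) powr (r - 1) * V x powr ((t - 1) / p * (r - 1))"
            unfolding a_def using Ct A by (simp add: powr_mult powr_powr)
          moreover have "r / p + (t - 1) / p * (r - 1) = s / p"
            by (simp add: s_def add_divide_distrib[symmetric] algebra_simps)
          ultimately show ?thesis by (simp add: powr_add[symmetric] mult_ac)
        qed
        finally show ?thesis by (simp add: ennreal_mult mult.assoc)
      qed
      have "?I \<le> (\<integral>\<^sup>+x. ennreal (2 powr r * (Ct * A) powr (r - 1)) * (ennreal (V x powr (s / p)) * \<beta> x) \<partial>lborel)"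
        using fin by (intro nn_integral_mono_AE) (auto elim!: eventually_mono intro: pt)
      also have "\<dots> = ennreal (2 powr r * (Ct * A) powr (r - 1)) * (\<integral>\<^sup>+x. ennreal (V x powr (s / p)) * \<beta> x \<partial>lborel)"
        unfolding \<beta>_def by (subst nn_integral_cmult) auto
      also have "(\<integral>\<^sup>+x. ennreal (V x powr (s / p)) * \<beta> x \<partial>lborel) = (\<integral>\<^sup>+x. (\<integral>\<^sup>+y. ennreal (V x powr (s / p)) * (K x y * g y) \<partial>lborel) \<partial>lborel)"
        unfolding \<beta>_def by (subst nn_integral_cmult) auto
      \<comment> \<open>After Tonelli the symmetry of K turns the x-integral into the potential of
        \<open>V powr (s / p)\<close> at y.\<close>
      also have "\<dots> = (\<integral>\<^sup>+y. (\<integral>\<^sup>+x. ennreal (V x powr (s / p)) * (K x y * g y) \<partial>lborel) \<partial>lborel)"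
        by (rule lborel_pair.Fubini'[symmetric]) measurable
      also have "\<dots> = (\<integral>\<^sup>+y. g y * (\<integral>\<^sup>+x. K y x * ennreal (V x powr (s / p)) \<partial>lborel) \<partial>lborel)"
      proof (rule nn_integral_cong)
        fix y
        have "(\<integral>\<^sup>+x. ennreal (V x powr (s / p)) * (K x y * g y) \<partial>lborel) = (\<integral>\<^sup>+x. g y * (K y x * ennreal (V x powr (s / p))) \<partial>lborel)"
          by (intro nn_integral_cong) (simp add: K_def norm_minus_commute mult_ac)
        then show "(\<integral>\<^sup>+x. ennreal (V x powr (s / p)) * (K x y * g y) \<partial>lborel) = g y * (\<integral>\<^sup>+x. K y x * ennreal (V x powr (s / p)) \<partial>lborel)"
          by (simp add: nn_integral_cmult)
      qed
      also have "\<dots> \<le> (\<integral>\<^sup>+y. ennreal (Cs * A) * ennreal (f y powr r) \<partial>lborel)"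
      proof (rule nn_integral_mono_AE, use fin in eventually_elim)
        case (elim y)
        have "g y * (\<integral>\<^sup>+x. K y x * ennreal (V x powr (s / p)) \<partial>lborel) \<le> g y * ennreal (Cs * A * V y powr ((s - 1) / p))"
          using Ks[OF A _ Mh pos elim] by (intro mult_left_mono) (auto simp: K_def V_def)
        also have "\<dots> = ennreal (Cs * A * f y powr r * (V y powr ((1 - s) / p) * V y powr ((s - 1) / p)))"
          unfolding g_def using Cs A by (subst ennreal_mult[symmetric]) (auto simp: mult_ac)
        also have "V y powr ((1 - s) / p) * V y powr ((s - 1) / p) = 1"
          using Vpos[OF elim] by (simp add: powr_add[symmetric] add_divide_distrib[symmetric])
        finally show ?case using Cs A by (simp add: ennreal_mult)
      qed
      also have "\<dots> = ennreal (Cs * A) * ?J" by (rule nn_integral_cmult) measurable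
      finally have "?I \<le> ennreal (2 powr r * (Ct * A) powr (r - 1)) * (ennreal (Cs * A) * ?J)"
        by (simp add: mult_left_mono)
      also have "\<dots> = ennreal (2 powr r * (Ct * A) powr (r - 1) * (Cs * A)) * ?J"
        using Cs A by (simp add: ennreal_mult mult.assoc)
      also have "2 powr r * (Ct * A) powr (r - 1) * (Cs * A) = N * A powr r"
        using A Ct unfolding N_def by (simp add: powr_mult powr_diff)
      finally show ?thesis .
    qed
  qed
qed

section \<open>The gradient\<close>

lemma Cc_infinityD:
  fixes u :: "real^'n \<Rightarrow> complex"
  assumes "u \<in> Cc_infinity"
  shows Cc_infinity_differentiable: "u differentiable (at x)"
    and Cc_infinity_continuous: "continuous_on UNIV u"
    and Cc_infinity_compact: "compact (closure {x. u x \<noteq> 0})"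
    and Cc_infinity_deriv: "(\<lambda>x. frechet_derivative u (at x) v) \<in> Cc_infinity"
proof -
  have C: "Ck k u" for k using assms by (simp add: Cc_infinity_def)
  show d: "u differentiable (at x)" for x using C[of 1] by simp
  show "continuous_on UNIV u" using C[of 0] by simp
  show K: "compact (closure {x. u x \<noteq> 0})" using assms by (simp add: Cc_infinity_def)
  have z: "frechet_derivative u (at x) v = 0" if "x \<notin> closure {x. u x \<noteq> 0}" for x
  proof -
    have "(u has_derivative (\<lambda>_. 0)) (at x)"
    proof (rule has_derivative_transform_within_open[OF has_derivative_const])
      show "open (- closure {x. u x \<noteq> 0})" by auto
      show "x \<in> - closure {x. u x \<noteq> 0}" using that by auto
      show "0 = u y" if "y \<in> - closure {x. u x \<noteq> 0}" for y
        using that closure_subset[of "{x. u x \<noteq> 0}"] by auto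
    qed
    then show ?thesis by (simp add: frechet_derivative_at[symmetric])
  qed
  have "{x. frechet_derivative u (at x) v \<noteq> 0} \<subseteq> closure {x. u x \<noteq> 0}" using z by auto
  then have "closure {x. frechet_derivative u (at x) v \<noteq> 0} \<subseteq> closure {x. u x \<noteq> 0}"
    by (simp add: closure_minimal)
  then have "compact (closure {x. frechet_derivative u (at x) v \<noteq> 0})"
    using K by (metis closed_closure compact_Int_closed inf.absorb_iff2)
  moreover have "Ck k (\<lambda>x. frechet_derivative u (at x) v)" for k using C[of "Suc k"] by simp
  ultimately show "(\<lambda>x. frechet_derivative u (at x) v) \<in> Cc_infinity" by (simp add: Cc_infinity_def)
qed

text \<open>Cauchy-Schwarz is applied to the moduli of the partial derivatives, since
  \<open>grad u x\<close> has complex entries while \<open>z\<close> is real.\<close>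

lemma norm_derivative_le_grad:
  fixes u :: "real^'n \<Rightarrow> complex"
  assumes "u differentiable (at x)"
  shows "norm (frechet_derivative u (at x) z) \<le> norm z * norm (grad u x)"
proof -
  let ?D = "frechet_derivative u (at x)"
  have lin: "linear ?D" by (rule linear_frechet_derivative[OF assms])
  have "?D z = ?D (\<Sum>i\<in>UNIV. z $ i *\<^sub>R axis i 1)"
    by (subst basis_expansion[of z, unfolded scalar_mult_eq_scaleR]) simp
  also have "\<dots> = (\<Sum>i\<in>UNIV. z $ i *\<^sub>R ?D (axis i 1))"
    by (simp add: linear_sum[OF lin] linear_cmul[OF lin])
  finally have "norm (?D z) \<le> (\<Sum>i\<in>UNIV. \<bar>z $ i\<bar> * \<bar>norm (?D (axis i 1))\<bar>)"
    by (metis (no_types, lifting) abs_norm_cancel norm_scaleR norm_sum sum.cong)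
  also have "\<dots> \<le> L2_set (($) z) UNIV * L2_set (\<lambda>i. norm (?D (axis i 1))) UNIV"
    by (rule L2_set_mult_ineq)
  also have "\<dots> = norm z * norm (grad u x)"
    by (simp add: norm_vec_def grad_def L2_set_def)
  finally show ?thesis .
qed

lemma borel_measurable_grad [measurable]:
  fixes u :: "real^'n \<Rightarrow> complex"
  assumes "u \<in> Cc_infinity"
  shows "(\<lambda>x. norm (grad u x)) \<in> borel_measurable borel"
proof -
  have "continuous_on UNIV (grad u)" unfolding grad_def[abs_def]
    by (intro continuous_on_vec_lambda Cc_infinity_continuous Cc_infinity_deriv assms)
  then show ?thesis by (intro borel_measurable_norm borel_measurable_continuous_onI) (auto intro: continuous_on_norm)
qed

lemma nn_integral_lborel_affine:
  fixes f :: "'a::euclidean_space \<Rightarrow> ennreal"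
  assumes [measurable]: "f \<in> borel_measurable borel" and c: "c \<noteq> (0::real)"
  shows "(\<integral>\<^sup>+y. f y \<partial>lborel) = ennreal (\<bar>c\<bar> ^ DIM('a)) * (\<integral>\<^sup>+z. f (t + c *\<^sub>R z) \<partial>lborel)"
  by (subst lborel_affine[OF c, of t])
     (simp add: nn_integral_density nn_integral_distr nn_integral_cmult)

lemma Cc_infinity_support:
  fixes u :: "real^'n \<Rightarrow> complex"
  assumes u: "u \<in> Cc_infinity" obtains R where "\<And>x. u x \<noteq> 0 \<Longrightarrow> norm x \<le> R"
  using compact_imp_bounded[OF Cc_infinity_compact[OF u]] closure_subset[of "{x. u x \<noteq> 0}"]
  unfolding bounded_iff by blast

lemma has_vector_derivative_line:
  fixes u :: "real^'n \<Rightarrow> complex"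
  assumes u: "u \<in> Cc_infinity"
  shows "((\<lambda>t. u (x + t *\<^sub>R z)) has_vector_derivative frechet_derivative u (at (x + t *\<^sub>R z)) z) (at t)"
proof -
  have "(u has_derivative frechet_derivative u (at (x + t *\<^sub>R z))) (at (x + t *\<^sub>R z))"
    using Cc_infinity_differentiable[OF u] frechet_derivative_works by blast
  then have "((u \<circ> (\<lambda>t. x + t *\<^sub>R z)) has_derivative (frechet_derivative u (at (x + t *\<^sub>R z)) \<circ> (\<lambda>s. s *\<^sub>R z))) (at t)"
    by (intro diff_chain_at) (auto intro!: derivative_eq_intros)
  moreover have "linear (frechet_derivative u (at (x + t *\<^sub>R z)))"
    by (rule linear_frechet_derivative[OF Cc_infinity_differentiable[OF u]])
  ultimately show ?thesis
    by (auto simp: has_vector_derivative_def o_def linear_cmul)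
qed

text \<open>The fundamental theorem of calculus on the ray from x in direction z, stopped at a time
  when the ray has left the support of u. No normalisation of z is imposed, so directions can later
  be averaged over a solid annulus with Lebesgue measure instead of over a sphere.\<close>

lemma norm_le_ray_integral:
  fixes u :: "real^'n \<Rightarrow> complex"
  assumes u: "u \<in> Cc_infinity" and z: "z \<noteq> 0"
  shows "ennreal (norm (u x)) \<le> (\<integral>\<^sup>+t. indicator {0..} t * ennreal (norm z * norm (grad u (x + t *\<^sub>R z))) \<partial>lborel)"
proof -
  obtain B where B: "\<And>y. u y \<noteq> 0 \<Longrightarrow> norm y \<le> B" using Cc_infinity_support[OF u] by blast
  \<comment> \<open>T makes the displacement have length \<open>\<bar>B\<bar> + norm x + 1\<close>,
    so the endpoint has norm at least \<open>\<bar>B\<bar> + 1\<close>, outside the support.\<close>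
  define T where "T = (\<bar>B\<bar> + norm x + 1) / norm z"
  have T: "T \<ge> 0" by (simp add: T_def)
  have "norm (T *\<^sub>R z) = \<bar>B\<bar> + norm x + 1" using z by (simp add: T_def)
  then have "norm (x + T *\<^sub>R z) > B" using norm_diff_triangle_ineq[of "x + T *\<^sub>R z" x 0 0]
    norm_triangle_ineq4[of "x + T *\<^sub>R z" x] by simp
  then have uT: "u (x + T *\<^sub>R z) = 0" using B by force
  let ?D = "\<lambda>t. frechet_derivative u (at (x + t *\<^sub>R z)) z"
  have vd: "((\<lambda>t. u (x + t *\<^sub>R z)) has_vector_derivative ?D t) (at t within {0..T})" for t
    by (rule has_vector_derivative_at_within[OF has_vector_derivative_line[OF u]])
  have cont: "continuous_on {0..T} ?D"
    by (rule continuous_on_compose2[OF Cc_infinity_continuous[OF Cc_infinity_deriv[OF u, of z]]])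
       (auto intro!: continuous_intros)
  have "(LINT t|lborel. indicator {0..T} t *\<^sub>R ?D t) = u (x + T *\<^sub>R z) - u (x + 0 *\<^sub>R z)"
    by (rule integral_FTC_atLeastAtMost[OF T vd cont])
  then have "ennreal (norm (u x)) = ennreal (norm (LINT t|lborel. indicator {0..T} t *\<^sub>R ?D t))"
    using uT by simp
  also have "\<dots> \<le> (\<integral>\<^sup>+t. ennreal (norm (indicator {0..T} t *\<^sub>R ?D t)) \<partial>lborel)"
    by (rule integral_norm_bound_ennreal) (rule borel_integrable_atLeastAtMost'[OF cont, unfolded set_integrable_def])
  also have "\<dots> \<le> (\<integral>\<^sup>+t. indicator {0..} t * ennreal (norm z * norm (grad u (x + t *\<^sub>R z))) \<partial>lborel)"
    using norm_derivative_le_grad[OF Cc_infinity_differentiable[OF u]]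
    by (intro nn_integral_mono) (auto simp: indicator_def intro!: ennreal_leI)
  finally show ?thesis .
qed

text \<open>Average \<open>norm_le_ray_integral\<close> over directions z in the annulus \<open>1 < |z| < 2\<close> and substitute \<open>y = x + t z\<close>.\<close>

lemma norm_le_riesz_grad:
  "\<exists>C>0. \<forall>u \<in> (Cc_infinity :: (real^'n \<Rightarrow> complex) set). \<forall>x.
    ennreal (norm (u x)) \<le> ennreal C * (\<integral>\<^sup>+y. ennreal (norm (x - y) powr (1 - real CARD('n))) * ennreal (norm (grad u y)) \<partial>lborel)"
proof -
  define d where "d = real CARD('n)"
  define Ann where "Ann = {z::real^'n. 1 < norm z \<and> norm z < 2}"
  have [measurable]: "Ann \<in> sets borel" unfolding Ann_def by measurable
  have opA: "open Ann" unfolding Ann_def by (intro open_Collect_conj open_Collect_less continuous_intros)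
  \<comment> \<open>Of the volume m of the annulus only \<open>0 < m < \<infinity>\<close> matters;
    a small ball about a point of norm 3/2 shows positivity.\<close>
  have "(3/2) *\<^sub>R (axis (undefined::'n) 1 :: real^'n) \<in> Ann" by (simp add: Ann_def)
  then obtain e where e: "e > 0" "ball ((3/2) *\<^sub>R (axis (undefined::'n) 1 :: real^'n)) e \<subseteq> Ann"
    using opA open_contains_ball by blast
  have "0 < ennreal (unit_ball_vol (real DIM(real^'n)) * e ^ DIM(real^'n))"
    using e unit_ball_vol_pos[of "real DIM(real^'n)"] by simp
  also have "\<dots> = emeasure lborel (ball ((3/2) *\<^sub>R (axis (undefined::'n) 1 :: real^'n)) e)"
    using e by (subst emeasure_ball) auto
  also have "\<dots> \<le> emeasure lborel Ann" using e by (intro emeasure_mono) auto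
  finally have "emeasure lborel Ann > 0" .
  moreover have "emeasure lborel Ann < \<infinity>"
    by (rule emeasure_bounded_finite) (auto simp: Ann_def bounded_iff intro!: exI[of _ 2])
  ultimately obtain m where m: "emeasure lborel Ann = ennreal m" "m > 0"
    by (cases "emeasure lborel Ann") auto
  show ?thesis
  proof (intro exI[of _ "2 powr d / m"] conjI ballI allI)
    show "2 powr d / m > 0" using m by simp
    fix u :: "real^'n \<Rightarrow> complex" and x
    assume u: "u \<in> Cc_infinity"
    define G where "G y = ennreal (norm (grad u y))" for y
    have [measurable]: "G \<in> borel_measurable borel" unfolding G_def using borel_measurable_grad[OF u] by measurable
    \<comment> \<open>This is the integrand in the variable \<open>y = x + t *\<^sub>R z\<close>:
      the Jacobian gives \<open>t powr - d\<close>, \<open>norm z\<close> becomes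
      \<open>norm (y - x) / t\<close>, and z in the annulus becomes
      \<open>t < norm (y - x) < 2 * t\<close>.\<close>
    define H where "H t y = (if 0 < t \<and> t < norm (y - x) \<and> norm (y - x) < 2 * t
      then ennreal (t powr (- d - 1)) * (ennreal (norm (y - x)) * G y) else 0)" for t :: real and y
    have H: "(\<lambda>(t, y). H t y) \<in> borel_measurable (lborel \<Otimes>\<^sub>M lborel)"
      unfolding H_def by measurable
    have [measurable]: "(\<lambda>(y, t). H t y) \<in> borel_measurable (lborel \<Otimes>\<^sub>M lborel)"
      unfolding H_def by measurable
    have [measurable]: "H t \<in> borel_measurable borel" for t unfolding H_def by measurable
    have "ennreal m * ennreal (norm (u x)) = (\<integral>\<^sup>+z. ennreal (norm (u x)) * indicator Ann z \<partial>lborel)"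
      by (subst nn_integral_cmult_indicator) (auto simp: m mult.commute)
    also have "\<dots> \<le> (\<integral>\<^sup>+z. (\<integral>\<^sup>+t. indicator {0<..} t * indicator Ann z * (ennreal (norm z) * G (x + t *\<^sub>R z)) \<partial>lborel) \<partial>lborel)"
    proof (rule nn_integral_mono)
      fix z :: "real^'n"
      show "ennreal (norm (u x)) * indicator Ann z \<le> (\<integral>\<^sup>+t. indicator {0<..} t * indicator Ann z * (ennreal (norm z) * G (x + t *\<^sub>R z)) \<partial>lborel)"
      proof (cases "z \<in> Ann")
        case True
        then have "z \<noteq> 0" by (auto simp: Ann_def)
        have "ennreal (norm (u x)) \<le> (\<integral>\<^sup>+t. indicator {0..} t * ennreal (norm z * norm (grad u (x + t *\<^sub>R z))) \<partial>lborel)"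
          by (rule norm_le_ray_integral[OF u \<open>z \<noteq> 0\<close>])
        \<comment> \<open>The endpoint t = 0, where the substitution would degenerate, is a null
          set.\<close>
        also have "\<dots> = (\<integral>\<^sup>+t. indicator {0<..} t * indicator Ann z * (ennreal (norm z) * G (x + t *\<^sub>R z)) \<partial>lborel)"
          using True AE_lborel_singleton[of "0::real"]
          by (intro nn_integral_cong_AE) (auto elim!: eventually_mono simp: indicator_def G_def ennreal_mult)
        finally show ?thesis using True by simp
      qed simp
    qed
    also have "\<dots> = (\<integral>\<^sup>+t. (\<integral>\<^sup>+z. indicator {0<..} t * indicator Ann z * (ennreal (norm z) * G (x + t *\<^sub>R z)) \<partial>lborel) \<partial>lborel)"
      by (rule lborel_pair.Fubini'[symmetric]) measurable
    also have "\<dots> = (\<integral>\<^sup>+t. (\<integral>\<^sup>+y. H t y \<partial>lborel) \<partial>lborel)"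
    proof (rule nn_integral_cong)
      fix t :: real
      show "(\<integral>\<^sup>+z. indicator {0<..} t * indicator Ann z * (ennreal (norm z) * G (x + t *\<^sub>R z)) \<partial>lborel)
        = (\<integral>\<^sup>+y. H t y \<partial>lborel)"
      proof (cases "t > 0")
        case True
        have "(\<integral>\<^sup>+y. H t y \<partial>lborel)
          = ennreal (\<bar>t\<bar> ^ DIM(real^'n)) * (\<integral>\<^sup>+z. H t (x + t *\<^sub>R z) \<partial>lborel)"
          using True by (intro nn_integral_lborel_affine) auto
        also have "\<dots> = (\<integral>\<^sup>+z. ennreal (\<bar>t\<bar> ^ DIM(real^'n)) * H t (x + t *\<^sub>R z) \<partial>lborel)"
          by (rule nn_integral_cmult[symmetric]) measurable
        also have "\<dots> = (\<integral>\<^sup>+z. indicator {0<..} t * indicator Ann z * (ennreal (norm z) * G (x + t *\<^sub>R z)) \<partial>lborel)"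
        proof (rule nn_integral_cong)
          fix z :: "real^'n"
          have "\<bar>t\<bar> ^ DIM(real^'n) * (t powr (- d - 1) * norm (t *\<^sub>R z)) = norm z"
            using True by (simp add: d_def powr_diff powr_minus powr_realpow)
          then have "ennreal (\<bar>t\<bar> ^ DIM(real^'n)) * (ennreal (t powr (- d - 1)) * ennreal (norm (t *\<^sub>R z))) = ennreal (norm z)"
            by (simp add: ennreal_mult[symmetric])
          then show "ennreal (\<bar>t\<bar> ^ DIM(real^'n)) * H t (x + t *\<^sub>R z)
             = indicator {0<..} t * indicator Ann z * (ennreal (norm z) * G (x + t *\<^sub>R z))"
            using True by (simp add: indicator_def Ann_def H_def mult.assoc[symmetric])
        qed
        finally show ?thesis by simp
      qed (simp add: H_def[abs_def])
    qed
    also have "\<dots> = (\<integral>\<^sup>+y. (\<integral>\<^sup>+t. H t y \<partial>lborel) \<partial>lborel)"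
      by (rule lborel_pair.Fubini'[symmetric]) measurable
    also have "\<dots> \<le> (\<integral>\<^sup>+y. ennreal (2 powr d) * (ennreal (norm (x - y) powr (1 - d)) * G y) \<partial>lborel)"
    proof (rule nn_integral_mono)
      fix y :: "real^'n"
      define n where "n = norm (y - x)"
      show "(\<integral>\<^sup>+t. H t y \<partial>lborel)
        \<le> ennreal (2 powr d) * (ennreal (norm (x - y) powr (1 - d)) * G y)"
      proof (cases "n = 0")
        case True
        then have "H t y = 0" for t by (auto simp: n_def H_def)
        then show ?thesis by simp
      next
        case False
        then have n: "n > 0" by (simp add: n_def)
        \<comment> \<open>For fixed y only times between n/2 and n contribute. Maximal integrand
          times length n/2 gives (n/2)^(-d-1) * n * (n/2) = 2^d * n^(1-d), the Riesz kernel of order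
          1.\<close>
        have "(\<integral>\<^sup>+t. H t y \<partial>lborel)
          \<le> (\<integral>\<^sup>+t. ennreal ((n / 2) powr (- d - 1)) * (ennreal n * G y) * indicator {n/2..n} t \<partial>lborel)"
          using n by (intro nn_integral_mono)
            (auto simp: indicator_def H_def d_def n_def intro!: mult_right_mono ennreal_leI powr_mono2')
        also have "\<dots> = ennreal ((n / 2) powr (- d - 1)) * (ennreal n * G y) * ennreal (n / 2)"
          using n by (subst nn_integral_cmult_indicator) auto
        also have "\<dots> = ennreal ((n / 2) powr (- d - 1)) * ennreal n * ennreal (n / 2) * G y"
          by (simp only: mult_ac)
        also have "ennreal ((n / 2) powr (- d - 1)) * ennreal n * ennreal (n / 2) = ennreal ((n / 2) powr (- d - 1) * n * (n / 2))"
          using n by (simp add: ennreal_mult[symmetric])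
        also have "(n / 2) powr (- d - 1) * n * (n / 2) = 2 powr d * n powr (1 - d)"
          using n by (simp add: powr_divide powr_diff powr_minus field_simps)
        finally show ?thesis by (simp add: n_def ennreal_mult mult.assoc norm_minus_commute)
      qed
    qed
    also have "\<dots> = ennreal (2 powr d) * (\<integral>\<^sup>+y. ennreal (norm (x - y) powr (1 - d)) * G y \<partial>lborel)"
      by (rule nn_integral_cmult) measurable
    finally have "ennreal (1 / m) * (ennreal m * ennreal (norm (u x))) \<le> ennreal (1 / m) * (ennreal (2 powr d) * (\<integral>\<^sup>+y. ennreal (norm (x - y) powr (1 - d)) * G y \<partial>lborel))"
      by (rule mult_left_mono) simp
    then show "ennreal (norm (u x)) \<le> ennreal (2 powr d / m) * (\<integral>\<^sup>+y. ennreal (norm (x - y) powr (1 - real CARD('n))) * ennreal (norm (grad u y)) \<partial>lborel)"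
      using m by (simp add: mult.assoc[symmetric] ennreal_mult[symmetric] d_def G_def)
  qed
qed

section \<open>The Fourier transform of test functions\<close>

lemma measurable_cis [measurable]: "cis \<in> borel_measurable borel"
  by (intro borel_measurable_continuous_onI continuous_intros)

lemma fourier_transform_lborel:
  assumes [measurable]: "u \<in> borel_measurable borel"
  shows "fourier_transform u \<xi> = (LINT x|lborel. cis (- (x \<bullet> \<xi>)) * u x)"
  unfolding fourier_transform_def by (rule integral_completion) measurable

lemma integral_lborel_affine:
  fixes f :: "'a::euclidean_space \<Rightarrow> complex"
  assumes [measurable]: "f \<in> borel_measurable borel" and c: "c \<noteq> (0::real)"
  shows "(LINT y|lborel. f y) = of_real (\<bar>c\<bar> ^ DIM('a)) * (LINT z|lborel. f (t + c *\<^sub>R z))"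
  by (subst lborel_affine[OF c, of t])
     (simp add: integral_density integral_distr scaleR_conv_of_real)

lemma Cc_infinity_measurable:
  fixes u :: "real^'n \<Rightarrow> complex"
  assumes "u \<in> Cc_infinity" shows "u \<in> borel_measurable borel"
  by (intro borel_measurable_continuous_onI Cc_infinity_continuous assms)

lemma Cc_infinity_integrable:
  fixes u :: "real^'n \<Rightarrow> complex"
  assumes u: "u \<in> Cc_infinity" shows "integrable lborel u"
proof -
  let ?K = "closure {x. u x \<noteq> 0}"
  have "integrable lborel (\<lambda>x. indicator ?K x *\<^sub>R u x)"
    using Cc_infinity_compact[OF u] Cc_infinity_continuous[OF u] by (intro borel_integrable_compact) (auto intro: continuous_on_subset)
  moreover have "indicator ?K x *\<^sub>R u x = u x" for x
    using closure_subset[of "{x. u x \<noteq> 0}"] by (auto simp: indicator_def)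
  ultimately show ?thesis by simp
qed

lemma Cc_infinity_bounded:
  fixes u :: "real^'n \<Rightarrow> complex"
  assumes u: "u \<in> Cc_infinity" obtains M where "M \<ge> 0" "\<And>x. norm (u x) \<le> M"
proof -
  let ?K = "closure {x. u x \<noteq> 0}"
  have "bounded (u ` ?K)"
    by (intro compact_imp_bounded compact_continuous_image Cc_infinity_compact u continuous_on_subset[OF Cc_infinity_continuous[OF u]]) auto
  then obtain M where M: "\<And>x. x \<in> ?K \<Longrightarrow> norm (u x) \<le> M"
    by (auto simp: bounded_iff)
  have "norm (u x) \<le> \<bar>M\<bar>" for x
  proof (cases "u x = 0")
    case False
    then have "x \<in> ?K" using closure_subset[of "{x. u x \<noteq> 0}"] by auto
    then show ?thesis using M[of x] by simp
  qed simp
  then show ?thesis using that[of "\<bar>M\<bar>"] by auto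
qed

section \<open>Decay and integrability of the Fourier transform\<close>

text \<open>Dominated convergence runs along sequences, so the derivative is recovered from the
  steps \<open>1 / real (Suc n)\<close>.\<close>

lemma has_vector_derivative_LIMSEQ:
  fixes f :: "real \<Rightarrow> 'b::real_normed_vector"
  assumes "(f has_vector_derivative D) (at 0)"
  shows "(\<lambda>n. real (Suc n) *\<^sub>R (f (1 / real (Suc n)) - f 0)) \<longlonglongrightarrow> D"
proof -
  have lim: "((\<lambda>y. norm (f y - f 0 - y *\<^sub>R D) / norm y) \<longlongrightarrow> 0) (at 0)"
    using assms by (simp add: has_vector_derivative_def has_derivative_iff_norm)
  have "filterlim (\<lambda>n. 1 / real (Suc n)) (at 0) sequentially"
    using LIMSEQ_Suc[OF lim_1_over_n] by (auto simp: filterlim_at)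
  from filterlim_compose[OF lim this]
  have "(\<lambda>n. norm (f (1 / real (Suc n)) - f 0 - (1 / real (Suc n)) *\<^sub>R D) / norm (1 / real (Suc n))) \<longlonglongrightarrow> 0" .
  also have "(\<lambda>n. norm (f (1 / real (Suc n)) - f 0 - (1 / real (Suc n)) *\<^sub>R D) / norm (1 / real (Suc n)))
     = (\<lambda>n. norm (real (Suc n) *\<^sub>R (f (1 / real (Suc n)) - f 0) - D))"
  proof
    fix n
    have "real (Suc n) *\<^sub>R (f (1 / real (Suc n)) - f 0) - D = real (Suc n) *\<^sub>R (f (1 / real (Suc n)) - f 0 - (1 / real (Suc n)) *\<^sub>R D)"
      by (simp add: scaleR_diff_right)
    then show "norm (f (1 / real (Suc n)) - f 0 - (1 / real (Suc n)) *\<^sub>R D) / norm (1 / real (Suc n))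
      = norm (real (Suc n) *\<^sub>R (f (1 / real (Suc n)) - f 0) - D)"
      by (simp add: mult.commute)
  qed
  finally show ?thesis
    by (simp add: LIM_zero_iff tendsto_norm_zero_iff)
qed

text \<open>Instead of integrating by parts, the transform of the difference quotients
  \<open>q n\<close> is computed in two ways: dominated convergence gives the transform of the
  derivative, and translation invariance gives a difference quotient of the phase
  \<open>cis (s * (e \<bullet> \<xi>))\<close> times the transform of u.\<close>

lemma fourier_transform_deriv:
  fixes u :: "real^'n \<Rightarrow> complex"
  assumes u: "u \<in> Cc_infinity"
  shows "fourier_transform (\<lambda>x. frechet_derivative u (at x) e) \<xi> = \<i> * of_real (e \<bullet> \<xi>) * fourier_transform u \<xi>"
proof -
  let ?D = "\<lambda>x. frechet_derivative u (at x) e"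
  have D: "?D \<in> Cc_infinity" by (rule Cc_infinity_deriv[OF u])
  note [measurable] = Cc_infinity_measurable[OF u] Cc_infinity_measurable[OF D]
  obtain M where M: "M \<ge> 0" "\<And>x. norm (?D x) \<le> M" using Cc_infinity_bounded[OF D] by blast
  obtain R where R: "\<And>x. u x \<noteq> 0 \<Longrightarrow> norm x \<le> R" using Cc_infinity_support[OF u] by blast
  define q where "q n x = real (Suc n) *\<^sub>R (u (x + (1 / real (Suc n)) *\<^sub>R e) - u x)" for n x
  have [measurable]: "q n \<in> borel_measurable borel" for n unfolding q_def by measurable
  have qlim: "(\<lambda>n. q n x) \<longlonglongrightarrow> ?D x" for x
    using has_vector_derivative_LIMSEQ[OF has_vector_derivative_line[OF u, of x e 0, simplified]] by (simp add: q_def)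
  \<comment> \<open>The mean value inequality bounds the quotients by M. All steps have length at
    most \<open>norm e\<close>, so the quotients share the ball of radius \<open>R + norm e\<close>
    as support.\<close>
  have qb: "norm (q n x) \<le> M * indicator (cball 0 (R + norm e)) x" for n x
  proof (cases "x \<in> cball 0 (R + norm e)")
    case True
    have "norm (u (x + (1 / real (Suc n)) *\<^sub>R e) - u (x + 0 *\<^sub>R e)) \<le> M * norm (1 / real (Suc n) - 0)"
    proof (rule differentiable_bound[of UNIV "\<lambda>t. u (x + t *\<^sub>R e)" "\<lambda>t s. s *\<^sub>R ?D (x + t *\<^sub>R e)"])
      fix t :: real
      show "((\<lambda>t. u (x + t *\<^sub>R e)) has_derivative (\<lambda>s. s *\<^sub>R ?D (x + t *\<^sub>R e))) (at t within UNIV)"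
        using has_vector_derivative_line[OF u, of x e t] by (simp add: has_vector_derivative_def)
      show "onorm (\<lambda>s. s *\<^sub>R ?D (x + t *\<^sub>R e)) \<le> M"
        using M by (intro onorm_bound) (auto simp: mult.commute[of M] intro: mult_left_mono)
    qed auto
    then have "norm (u (x + (1 / real (Suc n)) *\<^sub>R e) - u x) \<le> M / real (Suc n)" by simp
    then have "real (Suc n) * norm (u (x + (1 / real (Suc n)) *\<^sub>R e) - u x) \<le> M"
      by (simp add: pos_le_divide_eq mult.commute del: of_nat_Suc)
    then show ?thesis using True by (simp add: q_def del: of_nat_Suc)
  next
    case False
    then have x: "norm x > R + norm e" by simp
    then have "u x = 0" using R[of x] norm_ge_zero[of e] by fastforce
    moreover have "u (x + (1 / real (Suc n)) *\<^sub>R e) = 0"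
    proof (rule ccontr)
      assume "\<not> ?thesis"
      then have "norm (x + (1 / real (Suc n)) *\<^sub>R e) \<le> R" by (rule R)
      moreover have "norm ((1 / real (Suc n)) *\<^sub>R e) \<le> norm e" by (simp add: divide_le_eq mult_le_cancel_left1)
      ultimately show False using x norm_triangle_ineq4[of "x + (1 / real (Suc n)) *\<^sub>R e" "(1 / real (Suc n)) *\<^sub>R e"] by simp
    qed
    ultimately show ?thesis using False by (simp add: q_def)
  qed
  have lim1: "(\<lambda>n. LINT x|lborel. cis (- (x \<bullet> \<xi>)) * q n x) \<longlonglongrightarrow> (LINT x|lborel. cis (- (x \<bullet> \<xi>)) * ?D x)"
  proof (rule integral_dominated_convergence[where w="\<lambda>x. M * indicator (cball 0 (R + norm e)) x"])
    show "integrable lborel (\<lambda>x::real^'n. M * indicator (cball 0 (R + norm e)) x)"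
      by (intro integrable_mult_right integrable_real_indicator emeasure_bounded_finite) auto
    show "AE x in lborel. (\<lambda>n. cis (- (x \<bullet> \<xi>)) * q n x) \<longlonglongrightarrow> cis (- (x \<bullet> \<xi>)) * ?D x"
      by (intro AE_I2 tendsto_mult tendsto_const qlim)
    show "AE x in lborel. norm (cis (- (x \<bullet> \<xi>)) * q n x) \<le> M * indicator (cball 0 (R + norm e)) x" for n
      using qb by (simp add: norm_mult)
  qed measurable
  have int: "integrable lborel (\<lambda>x. cis (- (x \<bullet> \<xi>)) * u (x + a))" for a
  proof -
    have "integrable lborel (\<lambda>x. u (a + x))"
      using Cc_infinity_integrable[OF u] integrable_distr[of "(+) a" lborel borel u] by (simp add: lborel_distr_plus)
    then show ?thesis
      by (rule Bochner_Integration.integrable_bound) (auto simp: norm_mult add.commute)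
  qed
  have eq: "(LINT x|lborel. cis (- (x \<bullet> \<xi>)) * q n x)
     = (real (Suc n) *\<^sub>R (cis (1 / real (Suc n) * (e \<bullet> \<xi>)) - cis (0 * (e \<bullet> \<xi>)))) * fourier_transform u \<xi>" for n
  proof -
    define a where "a = (1 / real (Suc n)) *\<^sub>R e"
    have "(LINT x|lborel. cis (- (x \<bullet> \<xi>)) * q n x) = (LINT x|lborel. of_real (real (Suc n)) * (cis (- (x \<bullet> \<xi>)) * u (x + a) - cis (- (x \<bullet> \<xi>)) * u (x + 0)))"
      by (intro Bochner_Integration.integral_cong) (auto simp: q_def a_def scaleR_conv_of_real algebra_simps)
    also have "\<dots> = of_real (real (Suc n)) * ((LINT x|lborel. cis (- (x \<bullet> \<xi>)) * u (x + a)) - (LINT x|lborel. cis (- (x \<bullet> \<xi>)) * u (x + 0)))"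
      by (subst integral_mult_right_zero, subst Bochner_Integration.integral_diff[OF int int]) simp
    also have "(LINT x|lborel. cis (- (x \<bullet> \<xi>)) * u (x + a)) = (LINT x|lborel. cis (- ((- a + 1 *\<^sub>R x) \<bullet> \<xi>)) * u ((- a + 1 *\<^sub>R x) + a))"
      by (subst integral_lborel_affine[where c=1 and t="-a"]) auto
    also have "\<dots> = (LINT x|lborel. cis (a \<bullet> \<xi>) * (cis (- (x \<bullet> \<xi>)) * u x))"
      by (simp add: mult.assoc[symmetric] cis_mult inner_diff_left)
    also have "\<dots> = cis (a \<bullet> \<xi>) * fourier_transform u \<xi>"
      by (subst fourier_transform_lborel) auto
    also have "(LINT x|lborel. cis (- (x \<bullet> \<xi>)) * u (x + 0)) = fourier_transform u \<xi>"
      by (subst fourier_transform_lborel) auto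
    also have "a \<bullet> \<xi> = 1 / real (Suc n) * (e \<bullet> \<xi>)" by (simp add: a_def)
    finally show ?thesis by (simp add: scaleR_conv_of_real algebra_simps)
  qed
  have "((\<lambda>s. cis (s * (e \<bullet> \<xi>))) has_vector_derivative \<i> * of_real (e \<bullet> \<xi>)) (at 0)"
  proof -
    have "((\<lambda>s. s *\<^sub>R (\<i> * of_real (e \<bullet> \<xi>))) has_vector_derivative \<i> * of_real (e \<bullet> \<xi>)) (at 0)"
      by (auto simp: has_vector_derivative_def intro!: derivative_eq_intros)
    from field_vector_diff_chain_at[OF this, of exp 1] DERIV_exp[of "0::complex"]
    have "((\<lambda>s. exp (s *\<^sub>R (\<i> * of_real (e \<bullet> \<xi>)))) has_vector_derivative \<i> * of_real (e \<bullet> \<xi>)) (at 0)"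
      by (simp add: o_def)
    then show ?thesis by (simp add: cis_conv_exp scaleR_conv_of_real mult_ac)
  qed
  from has_vector_derivative_LIMSEQ[OF this]
  have "(\<lambda>n. (real (Suc n) *\<^sub>R (cis (1 / real (Suc n) * (e \<bullet> \<xi>)) - cis (0 * (e \<bullet> \<xi>)))) * fourier_transform u \<xi>)
    \<longlonglongrightarrow> (\<i> * of_real (e \<bullet> \<xi>)) * fourier_transform u \<xi>"
    by (intro tendsto_mult tendsto_const)
  with lim1 have "(LINT x|lborel. cis (- (x \<bullet> \<xi>)) * ?D x) = (\<i> * of_real (e \<bullet> \<xi>)) * fourier_transform u \<xi>"
    unfolding eq by (rule LIMSEQ_unique)
  then show ?thesis by (subst fourier_transform_lborel) auto
qed

text \<open>Each factor is paid for with two derivatives: the transform of the second derivative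
  along e has modulus \<open>(\<xi> \<bullet> e)\<^sup>2\<close> times that of u. Directions form a
  list so that they may repeat, and the induction is over all test functions because it also uses
  the derivative.\<close>

lemma fourier_transform_bound:
  fixes u :: "real^'n \<Rightarrow> complex"
  assumes u: "u \<in> Cc_infinity"
  shows "\<exists>C\<ge>0. \<forall>\<xi>. norm (fourier_transform u \<xi>) * (\<Prod>e\<leftarrow>es. 1 + (\<xi> \<bullet> e)\<^sup>2) \<le> C"
  using u
proof (induction es arbitrary: u)
  case Nil
  note [measurable] = Cc_infinity_measurable[OF Nil]
  have "norm (fourier_transform u \<xi>) \<le> (LINT x|lborel. norm (u x))" for \<xi>
  proof -
    have "norm (fourier_transform u \<xi>) \<le> (LINT x|lborel. norm (cis (- (x \<bullet> \<xi>)) * u x))"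
      by (subst fourier_transform_lborel) auto
    then show ?thesis by (simp add: norm_mult)
  qed
  then show ?case by (intro exI[of _ "LINT x|lborel. norm (u x)"]) auto
next
  case (Cons e es)
  let ?P = "\<lambda>\<xi>. \<Prod>e\<leftarrow>es. 1 + (\<xi> \<bullet> e)\<^sup>2"
  let ?v = "\<lambda>x. frechet_derivative (\<lambda>x. frechet_derivative u (at x) e) (at x) e"
  have v: "?v \<in> Cc_infinity" by (intro Cc_infinity_deriv Cons.prems)
  obtain C1 where C1: "C1 \<ge> 0" "\<And>\<xi>. norm (fourier_transform u \<xi>) * ?P \<xi> \<le> C1" using Cons.IH[OF Cons.prems] by blast
  obtain C2 where C2: "C2 \<ge> 0" "\<And>\<xi>. norm (fourier_transform ?v \<xi>) * ?P \<xi> \<le> C2" using Cons.IH[OF v] by blast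
  have "norm (fourier_transform u \<xi>) * (\<Prod>e\<leftarrow>e # es. 1 + (\<xi> \<bullet> e)\<^sup>2) \<le> C1 + C2" for \<xi>
  proof -
    have "fourier_transform ?v \<xi> = \<i> * of_real (e \<bullet> \<xi>) * (\<i> * of_real (e \<bullet> \<xi>) * fourier_transform u \<xi>)"
      by (simp only: fourier_transform_deriv[OF Cc_infinity_deriv[OF Cons.prems]] fourier_transform_deriv[OF Cons.prems])
    then have "norm (fourier_transform ?v \<xi>) = (\<xi> \<bullet> e)\<^sup>2 * norm (fourier_transform u \<xi>)"
      by (simp add: norm_mult power2_eq_square inner_commute flip: abs_mult)
    then show ?thesis using C1(2)[of \<xi>] C2(2)[of \<xi>] by (simp add: algebra_simps)
  qed
  then show ?case using C1 C2 by (intro exI[of _ "C1 + C2"]) auto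
qed

lemma norm_sq_Basis: "(norm (x::'a::euclidean_space))\<^sup>2 = (\<Sum>b\<in>Basis. (x \<bullet> b)\<^sup>2)"
  unfolding power2_norm_eq_inner by (subst euclidean_inner) (simp add: power2_eq_square)

text \<open>A product over the coordinates dominates \<open>1 + (norm \<xi>)\<^sup>2\<close>, while
  the integral of its reciprocal factors into one-dimensional integrals of 1 / (1 + x^2).\<close>

definition poly_weight :: "'a::euclidean_space \<Rightarrow> real" where
  "poly_weight \<xi> = (\<Prod>b\<in>Basis. 1 + (\<xi> \<bullet> b)\<^sup>2)"

lemma measurable_poly_weight [measurable]: "poly_weight \<in> borel_measurable borel"
  unfolding poly_weight_def[abs_def] by measurable

lemma poly_weight_ge: "1 + (norm \<xi>)\<^sup>2 \<le> poly_weight \<xi>"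
proof -
  have "1 + (\<Sum>b\<in>A. f b) \<le> (\<Prod>b\<in>A. 1 + f b)" if "finite A" "\<And>b. b \<in> A \<Longrightarrow> 0 \<le> f b" for f :: "'a \<Rightarrow> real" and A
    using that
  proof (induction A rule: finite_induct)
    case (insert a A)
    have "0 \<le> f a * (\<Sum>b\<in>A. f b)" using insert by (intro mult_nonneg_nonneg sum_nonneg) auto
    then have "1 + (f a + (\<Sum>b\<in>A. f b)) \<le> (1 + f a) * (1 + (\<Sum>b\<in>A. f b))" by (simp add: algebra_simps)
    also have "\<dots> \<le> (1 + f a) * (\<Prod>b\<in>A. 1 + f b)" using insert by (intro mult_left_mono) auto
    finally show ?case using insert by simp
  qed simp
  from this[of Basis "\<lambda>b. (\<xi> \<bullet> b)\<^sup>2"] have "1 + (\<Sum>b\<in>Basis. (\<xi> \<bullet> b)\<^sup>2) \<le> poly_weight \<xi>"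
    by (simp add: poly_weight_def)
  then show ?thesis by (simp add: norm_sq_Basis)
qed

lemma poly_weight_ge_1: "1 \<le> poly_weight \<xi>" and norm_le_poly_weight: "norm \<xi> \<le> poly_weight \<xi>"
proof -
  show "1 \<le> poly_weight \<xi>" using poly_weight_ge[of \<xi>] by (smt (verit) zero_le_power2)
  have "0 \<le> (norm \<xi> - 1)\<^sup>2" by simp
  then have "2 * norm \<xi> \<le> 1 + (norm \<xi>)\<^sup>2" unfolding power2_diff by simp
  then have "norm \<xi> \<le> 1 + (norm \<xi>)\<^sup>2" using norm_ge_zero[of \<xi>] by linarith
  then show "norm \<xi> \<le> poly_weight \<xi>" using poly_weight_ge[of \<xi>] by linarith
qed

lemma integrable_inverse_poly_weight: "integrable lborel (\<lambda>\<xi>::'a::euclidean_space. 1 / poly_weight \<xi>)"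
proof (rule integrableI_bounded)
  have fin: "(\<integral>\<^sup>+x. ennreal (1 / (1 + x\<^sup>2)) \<partial>lborel) < (\<infinity>::ennreal)"
    using integrable_inverse_1_plus_square
    by (simp add: set_integrable_def integrable_iff_bounded inverse_eq_divide)
  have "(\<integral>\<^sup>+\<xi>. ennreal (norm (1 / poly_weight (\<xi>::'a))) \<partial>lborel) = (\<integral>\<^sup>+\<xi>. (\<Prod>b\<in>(Basis::'a set). ennreal (1 / (1 + (\<xi> \<bullet> b)\<^sup>2))) \<partial>lborel)"
  proof (rule nn_integral_cong)
    fix \<xi> :: 'a
    have "norm (1 / poly_weight \<xi>) = (\<Prod>b\<in>Basis. 1 / (1 + (\<xi> \<bullet> b)\<^sup>2))"
      using poly_weight_ge_1[of \<xi>] by (simp add: poly_weight_def prod_dividef)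
    then show "ennreal (norm (1 / poly_weight \<xi>)) = (\<Prod>b\<in>Basis. ennreal (1 / (1 + (\<xi> \<bullet> b)\<^sup>2)))"
      by (simp add: prod_ennreal)
  qed
  also have "\<dots> = (\<Prod>b\<in>(Basis :: 'a set). (\<integral>\<^sup>+x. ennreal (1 / (1 + x\<^sup>2)) \<partial>lborel))"
    by (subst nn_integral_lborel_prod[where f="\<lambda>b x. ennreal (1 / (1 + x\<^sup>2))"]) auto
  also have "\<dots> < \<infinity>" using fin by (simp add: power_less_top_ennreal)
  finally show "(\<integral>\<^sup>+\<xi>. ennreal (norm (1 / poly_weight (\<xi>::'a))) \<partial>lborel) < \<infinity>" .
qed measurable

lemma fourier_transform_measurable:
  fixes u :: "real^'n \<Rightarrow> complex"
  assumes [measurable]: "u \<in> borel_measurable borel"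
  shows "fourier_transform u \<in> borel_measurable borel"
proof -
  have "(\<lambda>\<xi>. LINT x|lborel. cis (- (x \<bullet> \<xi>)) * u x) \<in> borel_measurable borel" by measurable
  then show ?thesis by (simp add: fourier_transform_lborel[OF assms, abs_def])
qed

lemma integrable_fourier_transform:
  fixes u :: "real^'n \<Rightarrow> complex" and \<beta> :: real
  assumes u: "u \<in> Cc_infinity" and \<beta>: "0 \<le> \<beta>"
  shows "integrable lborel (\<lambda>\<xi>. of_real (norm \<xi> powr \<beta>) * fourier_transform u \<xi>)"
    and "integrable lborel (fourier_transform u)"
proof -
  note [measurable] = fourier_transform_measurable[OF Cc_infinity_measurable[OF u]]
  obtain bs where bs: "set bs = (Basis :: (real^'n) set)" "distinct bs" using finite_distinct_list[OF finite_Basis] by blast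
  \<comment> \<open>The rounded-up exponent absorbs the growth of
    \<open>norm \<xi> powr \<beta>\<close>; the one additional factor leaves the integrable
    \<open>1 / poly_weight \<xi>\<close>.\<close>
  define m where "m = Suc (nat \<lceil>\<beta>\<rceil>)"
  have w: "(\<Prod>e\<leftarrow>concat (replicate k bs). 1 + (\<xi> \<bullet> e)\<^sup>2) = poly_weight \<xi> ^ k" for \<xi> :: "real^'n" and k
  proof -
    have "(\<Prod>e\<leftarrow>bs. 1 + (\<xi> \<bullet> e)\<^sup>2) = poly_weight \<xi>"
      unfolding poly_weight_def bs(1)[symmetric] by (rule prod.distinct_set_conv_list[OF bs(2), symmetric])
    then show ?thesis by (induction k) simp_all
  qed
  obtain C where C: "C \<ge> 0" "\<And>\<xi>. norm (fourier_transform u \<xi>) * poly_weight \<xi> ^ m \<le> C"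
    using fourier_transform_bound[OF u, of "concat (replicate m bs)"] unfolding w by blast
  have I: "integrable lborel (\<lambda>\<xi>::real^'n. C * (1 / poly_weight \<xi>))"
    by (intro integrable_mult_right integrable_inverse_poly_weight)
  have b: "poly_weight \<xi> powr \<beta> * norm (fourier_transform u \<xi>) \<le> C * (1 / poly_weight \<xi>)" for \<xi>
  proof -
    have P: "poly_weight \<xi> \<ge> 1" by (rule poly_weight_ge_1)
    have "poly_weight \<xi> powr \<beta> \<le> poly_weight \<xi> powr (real (nat \<lceil>\<beta>\<rceil>))"
      using P by (intro powr_mono) linarith+
    then have "poly_weight \<xi> powr \<beta> \<le> poly_weight \<xi> ^ nat \<lceil>\<beta>\<rceil>" using P by (simp add: powr_realpow)
    then have "poly_weight \<xi> * (poly_weight \<xi> powr \<beta> * norm (fourier_transform u \<xi>)) \<le> poly_weight \<xi> * (poly_weight \<xi> ^ nat \<lceil>\<beta>\<rceil> * norm (fourier_transform u \<xi>))"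
      using P by (intro mult_left_mono mult_right_mono) auto
    also have "\<dots> \<le> C" using C(2)[of \<xi>] by (simp add: m_def mult_ac)
    finally show ?thesis using P by (simp add: field_simps)
  qed
  show "integrable lborel (\<lambda>\<xi>. of_real (norm \<xi> powr \<beta>) * fourier_transform u \<xi>)"
  proof (rule Bochner_Integration.integrable_bound[OF I])
    show "AE \<xi> in lborel. norm (of_real (norm \<xi> powr \<beta>) * fourier_transform u \<xi>) \<le> norm (C * (1 / poly_weight \<xi>))"
    proof (rule AE_I2)
      fix \<xi> :: "real^'n"
      have "norm (of_real (norm \<xi> powr \<beta>) * fourier_transform u \<xi>) \<le> poly_weight \<xi> powr \<beta> * norm (fourier_transform u \<xi>)"
        using \<beta> norm_le_poly_weight[of \<xi>] by (simp add: norm_mult mult_right_mono powr_mono2)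
      also note b[of \<xi>]
      finally show "norm (of_real (norm \<xi> powr \<beta>) * fourier_transform u \<xi>) \<le> norm (C * (1 / poly_weight \<xi>))"
        using C poly_weight_ge_1[of \<xi>] by simp
    qed
  qed measurable
  show "integrable lborel (fourier_transform u)"
  proof (rule Bochner_Integration.integrable_bound[OF I])
    show "AE \<xi> in lborel. norm (fourier_transform u \<xi>) \<le> norm (C * (1 / poly_weight \<xi>))"
    proof (rule AE_I2)
      fix \<xi> :: "real^'n"
      have "1 * norm (fourier_transform u \<xi>) \<le> poly_weight \<xi> powr \<beta> * norm (fourier_transform u \<xi>)"
        using \<beta> poly_weight_ge_1[of \<xi>] by (intro mult_right_mono) (auto simp: ge_one_powr_ge_zero)
      also note b[of \<xi>]
      finally show "norm (fourier_transform u \<xi>) \<le> norm (C * (1 / poly_weight \<xi>))"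
        using C poly_weight_ge_1[of \<xi>] by simp
    qed
  qed measurable
qed

section \<open>Gaussians and Fourier inversion\<close>

lemma integral_lborel_prod:
  fixes f :: "'a::euclidean_space \<Rightarrow> real \<Rightarrow> complex"
  assumes int: "\<And>b. b \<in> Basis \<Longrightarrow> integrable lborel (f b)"
  shows "(LINT x|lborel. (\<Prod>b\<in>Basis. f b (x \<bullet> b))) = (\<Prod>b\<in>Basis. LINT x|lborel. f b x)"
proof -
  interpret product_sigma_finite "\<lambda>_::'a. lborel :: real measure" by standard
  have [measurable]: "b \<in> Basis \<Longrightarrow> f b \<in> borel_measurable borel" for b using int[of b] by auto
  have "(LINT x|lborel. (\<Prod>b\<in>Basis. f b (x \<bullet> b))) = (LINT x|(\<Pi>\<^sub>M b\<in>Basis. lborel). (\<Prod>b\<in>Basis. f b ((\<Sum>b'\<in>Basis. x b' *\<^sub>R b') \<bullet> b)))"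
    by (subst lborel_eq, subst integral_distr) auto
  also have "\<dots> = (LINT x|(\<Pi>\<^sub>M b\<in>Basis. lborel). (\<Prod>b\<in>Basis. f b (x b)))"
    by (intro Bochner_Integration.integral_cong refl prod.cong) simp
  also have "\<dots> = (\<Prod>b\<in>Basis. LINT x|lborel. f b x)"
    by (rule product_integral_prod) (auto intro: int)
  finally show ?thesis .
qed

lemma integrable_exp_square: "s > 0 \<Longrightarrow> integrable lborel (\<lambda>x::real. exp (- s * x\<^sup>2))"
proof -
  assume s: "s > 0"
  have "integrable lborel (\<lambda>x. sqrt (pi / s) * normal_density 0 (sqrt (1 / (2 * s))) x)"
    using s by (intro integrable_mult_right integrable_normal_density) auto
  moreover have "sqrt (pi / s) * normal_density 0 (sqrt (1 / (2 * s))) x = exp (- s * x\<^sup>2)" for x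
    using s by (simp add: normal_density_def real_sqrt_divide field_simps)
  ultimately show ?thesis by simp
qed

text \<open>A rescaling of the characteristic function of the standard normal distribution: with
  \<open>c = 1 / sqrt (2 * s)\<close>, the exponent \<open>s * (c * x)\<^sup>2\<close> becomes x^2 /
  2.\<close>

lemma cis_gaussian_1d:
  assumes s: "s > 0"
  shows "(LINT x|lborel. cis (x * t) * of_real (exp (- s * x\<^sup>2))) = of_real (sqrt (pi / s) * exp (- t\<^sup>2 / (4 * s)))"
proof -
  define c where "c = 1 / sqrt (2 * s)"
  have c: "c > 0" using s by (simp add: c_def)
  have "char std_normal_distribution (t * c) = of_real (exp (- (t * c)\<^sup>2 / 2))"
    by (simp add: char_std_normal_distribution)
  then have "(LINT x|lborel. std_normal_density x *\<^sub>R iexp (t * c * x)) = of_real (exp (- (t * c)\<^sup>2 / 2))"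
    unfolding char_def by (subst (asm) integral_density) auto
  moreover have "(LINT x|lborel. std_normal_density x *\<^sub>R iexp (t * c * x))
     = (LINT x|lborel. of_real (1 / sqrt (2 * pi)) * (cis ((0 + c *\<^sub>R x) * t) * of_real (exp (- s * (0 + c *\<^sub>R x)\<^sup>2))))"
  proof (intro Bochner_Integration.integral_cong refl)
    fix x
    have "s * (c * x)\<^sup>2 = x\<^sup>2 / 2" using s by (simp add: c_def power_mult_distrib power_divide)
    then have "std_normal_density x = 1 / sqrt (2 * pi) * exp (- s * (c * x)\<^sup>2)"
      by (simp add: std_normal_density_def)
    then show "std_normal_density x *\<^sub>R iexp (t * c * x)
      = of_real (1 / sqrt (2 * pi)) * (cis ((0 + c *\<^sub>R x) * t) * of_real (exp (- s * (0 + c *\<^sub>R x)\<^sup>2)))"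
      by (simp add: scaleR_conv_of_real cis_conv_exp mult_ac)
  qed
  moreover have "(LINT x|lborel. cis (x * t) * of_real (exp (- s * x\<^sup>2)))
    = of_real (\<bar>c\<bar> ^ DIM(real)) * (LINT x|lborel. cis ((0 + c *\<^sub>R x) * t) * of_real (exp (- s * (0 + c *\<^sub>R x)\<^sup>2)))"
    using c by (intro integral_lborel_affine) auto
  ultimately have "of_real (1 / sqrt (2 * pi)) * (LINT x|lborel. cis (x * t) * of_real (exp (- s * x\<^sup>2)))
    = of_real c * complex_of_real (exp (- (t * c)\<^sup>2 / 2))"
    using c by simp
  then have "(LINT x|lborel. cis (x * t) * of_real (exp (- s * x\<^sup>2))) = of_real (sqrt (2 * pi) * c) * complex_of_real (exp (- (t * c)\<^sup>2 / 2))"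
    by (simp add: field_simps)
  moreover have "sqrt (2 * pi) * c = sqrt (pi / s)" using s by (simp add: c_def real_sqrt_divide real_sqrt_mult)
  moreover have "- (t * c)\<^sup>2 / 2 = - t\<^sup>2 / (4 * s)" using s by (simp add: c_def power_mult_distrib power_divide)
  ultimately show ?thesis by (simp only: of_real_mult)
qed

lemma cis_gaussian:
  fixes \<xi> :: "'a::euclidean_space"
  assumes s: "s > 0"
  shows "(LINT x|lborel. cis (x \<bullet> \<xi>) * of_real (exp (- s * (norm x)\<^sup>2)))
    = of_real ((pi / s) powr (DIM('a) / 2) * exp (- (norm \<xi>)\<^sup>2 / (4 * s)))"
proof -
  let ?f = "\<lambda>b x. cis (x * (\<xi> \<bullet> b)) * complex_of_real (exp (- s * x\<^sup>2))"
  have cis_sum: "cis (\<Sum>b\<in>A. g b) = (\<Prod>b\<in>A. cis (g b))" if "finite A" for A and g :: "'a \<Rightarrow> real"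
    using that by (induction A rule: finite_induct) (auto simp: cis_mult[symmetric])
  have "(LINT x|lborel. cis (x \<bullet> \<xi>) * of_real (exp (- s * (norm x)\<^sup>2))) = (LINT x|lborel. (\<Prod>b\<in>Basis. ?f b (x \<bullet> b)))"
  proof (intro Bochner_Integration.integral_cong refl)
    fix x :: 'a
    have "x \<bullet> \<xi> = (\<Sum>b\<in>Basis. (x \<bullet> b) * (\<xi> \<bullet> b))" by (rule euclidean_inner)
    moreover have "exp (- s * (norm x)\<^sup>2) = (\<Prod>b\<in>Basis. exp (- s * (x \<bullet> b)\<^sup>2))"
      by (simp add: norm_sq_Basis sum_distrib_left exp_sum[symmetric] sum_negf)
    ultimately show "cis (x \<bullet> \<xi>) * of_real (exp (- s * (norm x)\<^sup>2)) = (\<Prod>b\<in>Basis. ?f b (x \<bullet> b))"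
      by (simp add: cis_sum prod.distrib)
  qed
  also have "\<dots> = (\<Prod>b\<in>Basis. LINT x|lborel. ?f b x)"
  proof (rule integral_lborel_prod)
    fix b :: 'a
    show "integrable lborel (?f b)"
      by (rule Bochner_Integration.integrable_bound[OF integrable_exp_square[OF s]]) (auto simp: norm_mult)
  qed
  also have "\<dots> = (\<Prod>b\<in>(Basis::'a set). of_real (sqrt (pi / s) * exp (- (\<xi> \<bullet> b)\<^sup>2 / (4 * s))))"
    by (intro prod.cong refl cis_gaussian_1d s)
  also have "\<dots> = of_real (sqrt (pi / s) ^ DIM('a) * exp (\<Sum>b\<in>Basis. - (\<xi> \<bullet> b)\<^sup>2 / (4 * s)))"
    by (simp add: prod.distrib exp_sum)
  also have "(\<Sum>b\<in>Basis. - (\<xi> \<bullet> b)\<^sup>2 / (4 * s)) = - (norm \<xi>)\<^sup>2 / (4 * s)"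
    by (simp add: norm_sq_Basis sum_divide_distrib sum_negf)
  also have "sqrt (pi / s) ^ DIM('a) = (pi / s) powr (DIM('a) / 2)"
    using s by (simp add: powr_half_sqrt[symmetric] powr_realpow[symmetric] powr_powr)
  finally show ?thesis .
qed

lemma integrable_gaussian:
  assumes s: "s > 0"
  shows "integrable lborel (\<lambda>x::'a::euclidean_space. exp (- s * (norm x)\<^sup>2))"
proof (rule integrableI_bounded)
  have "(\<integral>\<^sup>+x. ennreal (norm (exp (- s * (norm (x::'a))\<^sup>2))) \<partial>lborel) = (\<integral>\<^sup>+x. (\<Prod>b\<in>(Basis::'a set). ennreal (exp (- s * (x \<bullet> b)\<^sup>2))) \<partial>lborel)"
    by (intro nn_integral_cong) (simp add: norm_sq_Basis sum_distrib_left exp_sum[symmetric] sum_negf prod_ennreal)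
  also have "\<dots> = (\<Prod>b\<in>(Basis::'a set). (\<integral>\<^sup>+x. ennreal (exp (- s * x\<^sup>2)) \<partial>lborel))"
    by (subst nn_integral_lborel_prod[where f="\<lambda>b x. ennreal (exp (- s * x\<^sup>2))"]) auto
  also have "\<dots> < \<infinity>" using integrable_exp_square[OF s] by (simp add: integrable_iff_bounded power_less_top_ennreal)
  finally show "(\<integral>\<^sup>+x. ennreal (norm (exp (- s * (norm (x::'a))\<^sup>2))) \<partial>lborel) < \<infinity>" .
qed measurable

section \<open>The heat kernel and Fourier inversion\<close>

definition heat_kernel :: "real \<Rightarrow> 'a::euclidean_space \<Rightarrow> real" where
  "heat_kernel t z = (4 * pi * t) powr (- (DIM('a) / 2)) * exp (- (norm z)\<^sup>2 / (4 * t))"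

lemma measurable_heat_kernel [measurable]: "heat_kernel t \<in> borel_measurable (borel :: 'a::euclidean_space measure)"
  unfolding heat_kernel_def[abs_def] by measurable

lemma heat_kernel_nonneg [simp]: "0 \<le> heat_kernel t z"
  by (simp add: heat_kernel_def)

lemma integrable_heat_kernel:
  assumes "t > 0" shows "integrable lborel (heat_kernel t :: 'a::euclidean_space \<Rightarrow> real)"
proof -
  have "integrable lborel (\<lambda>z::'a. (4 * pi * t) powr (- (DIM('a) / 2)) * exp (- (1 / (4 * t)) * (norm z)\<^sup>2))"
    using assms by (intro integrable_mult_right integrable_gaussian) auto
  then show ?thesis unfolding heat_kernel_def[abs_def] by simp
qed

lemma cis_heat_kernel:
  fixes \<xi> :: "'a::euclidean_space"
  assumes t: "t > 0"
  shows "(LINT z|lborel. cis (z \<bullet> \<xi>) * of_real (heat_kernel t z)) = of_real (exp (- t * (norm \<xi>)\<^sup>2))"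
proof -
  have "(LINT z|lborel. cis (z \<bullet> \<xi>) * of_real (heat_kernel t z))
    = (LINT z|lborel. of_real ((4 * pi * t) powr (- (DIM('a) / 2))) * (cis (z \<bullet> \<xi>) * of_real (exp (- (1 / (4 * t)) * (norm z)\<^sup>2))))"
    by (intro Bochner_Integration.integral_cong refl) (simp add: heat_kernel_def)
  also have "\<dots> = of_real ((4 * pi * t) powr (- (DIM('a) / 2))) * of_real ((pi / (1 / (4 * t))) powr (DIM('a) / 2) * exp (- (norm \<xi>)\<^sup>2 / (4 * (1 / (4 * t)))))"
    using t by (subst integral_mult_right_zero, subst cis_gaussian) auto
  also have "\<dots> = of_real (exp (- t * (norm \<xi>)\<^sup>2) * ((4 * pi * t) powr (- (DIM('a) / 2)) * (4 * pi * t) powr (DIM('a) / 2)))"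
    using t by (simp add: mult_ac)
  also have "(4 * pi * t) powr (- (DIM('a) / 2)) * (4 * pi * t) powr (DIM('a) / 2) = 1"
    using t by (simp add: powr_add[symmetric])
  finally show ?thesis by simp
qed

text \<open>The converse of \<open>cis_heat_kernel\<close>: inversion is verified explicitly for
  Gaussians only, and \<open>fourier_inversion\<close> derives the case of test functions from it.
  The constant comes from (2 pi)^2 = (pi / t) (4 pi t).\<close>

lemma cis_gaussian_heat_kernel:
  fixes z :: "'a::euclidean_space"
  assumes t: "t > 0"
  shows "(LINT \<xi>|lborel. cis (\<xi> \<bullet> z) * of_real (exp (- t * (norm \<xi>)\<^sup>2))) = of_real ((2 * pi) ^ DIM('a) * heat_kernel t z)"
proof -
  have "(2 * pi) ^ DIM('a) = ((2 * pi) powr 2) powr (DIM('a) / 2)"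
    by (simp add: powr_powr powr_realpow del: powr_numeral)
  also have "(2 * pi) powr 2 = (pi / t) * (4 * pi * t)" using t by (simp add: power2_eq_square)
  also have "\<dots> powr (DIM('a) / 2) = (pi / t) powr (DIM('a) / 2) * (4 * pi * t) powr (DIM('a) / 2)"
    by (rule powr_mult)
  finally have "(2 * pi) ^ DIM('a) * (4 * pi * t) powr (- (DIM('a) / 2)) = (pi / t) powr (DIM('a) / 2)"
    using t by (simp add: mult.assoc powr_add[symmetric])
  note K = this
  show ?thesis by (subst cis_gaussian[OF t]) (simp only: K heat_kernel_def mult.assoc[symmetric])
qed

text \<open>Fubini, justified because the integrand has modulus |f(y)| |F(\<xi>)|. The sign \<sigma>
  covers both transforms: 1 is used in \<open>heat_convolution\<close>, -1 in
  \<open>fourier_inversion\<close>.\<close>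

lemma multiplication_formula:
  fixes f F :: "'a::euclidean_space \<Rightarrow> complex"
  assumes f: "integrable lborel f" and F: "integrable lborel F"
  shows "(LINT y|lborel. f y * (LINT \<xi>|lborel. cis (\<sigma> * (y \<bullet> \<xi>)) * F \<xi>)) = (LINT \<xi>|lborel. F \<xi> * (LINT y|lborel. cis (\<sigma> * (y \<bullet> \<xi>)) * f y))"
proof -
  have [measurable]: "f \<in> borel_measurable borel" "F \<in> borel_measurable borel" using f F by auto
  let ?g = "\<lambda>y \<xi>. f y * (cis (\<sigma> * (y \<bullet> \<xi>)) * F \<xi>)"
  have int: "integrable (lborel \<Otimes>\<^sub>M lborel) (\<lambda>(y, \<xi>). ?g y \<xi>)"
  proof (rule integrableI_bounded)
    have "(\<integral>\<^sup>+p. ennreal (norm (case p of (y, \<xi>) \<Rightarrow> ?g y \<xi>)) \<partial>(lborel \<Otimes>\<^sub>M lborel))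
      = (\<integral>\<^sup>+y. (\<integral>\<^sup>+\<xi>. ennreal (norm (f y)) * ennreal (norm (F \<xi>)) \<partial>lborel) \<partial>lborel)"
      by (subst lborel.nn_integral_fst[symmetric]) (auto simp: norm_mult ennreal_mult)
    also have "\<dots> = (\<integral>\<^sup>+y. ennreal (norm (f y)) \<partial>lborel) * (\<integral>\<^sup>+\<xi>. ennreal (norm (F \<xi>)) \<partial>lborel)"
      by (simp add: nn_integral_cmult nn_integral_multc)
    also have "\<dots> < \<infinity>" using f F by (simp add: integrable_iff_bounded ennreal_mult_less_top)
    finally show "(\<integral>\<^sup>+p. ennreal (norm (case p of (y, \<xi>) \<Rightarrow> ?g y \<xi>)) \<partial>(lborel \<Otimes>\<^sub>M lborel)) < \<infinity>" .
  qed measurable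
  have "(LINT y|lborel. f y * (LINT \<xi>|lborel. cis (\<sigma> * (y \<bullet> \<xi>)) * F \<xi>)) = (LINT y|lborel. LINT \<xi>|lborel. ?g y \<xi>)"
    by simp
  also have "\<dots> = (LINT \<xi>|lborel. LINT y|lborel. ?g y \<xi>)"
    by (rule lborel_pair.Fubini_integral[OF int, symmetric])
  also have "\<dots> = (LINT \<xi>|lborel. LINT y|lborel. F \<xi> * (cis (\<sigma> * (y \<bullet> \<xi>)) * f y))"
    by (intro Bochner_Integration.integral_cong refl) (simp add: mult_ac)
  finally show ?thesis by simp
qed

lemma integrable_reflect:
  fixes f :: "'a::euclidean_space \<Rightarrow> complex"
  assumes f: "integrable lborel f"
  shows "integrable lborel (\<lambda>y. f (x - y))"
proof -
  have [measurable]: "f \<in> borel_measurable borel" using f by auto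
  have "(\<integral>\<^sup>+y. ennreal (norm (f y)) \<partial>lborel) = ennreal (\<bar>-1\<bar> ^ DIM('a)) * (\<integral>\<^sup>+y. ennreal (norm (f (x + (-1) *\<^sub>R y))) \<partial>lborel)"
    by (rule nn_integral_lborel_affine) auto
  then show ?thesis using f by (simp add: integrable_iff_bounded)
qed

text \<open>The hypothesis concerns the frequency side F alone. This matters for
  \<open>F = norm \<xi> powr \<alpha>\<close> times the transform of u: its inverse transform is the
  fractional Laplacian up to a constant, and integrability of that function over space never has to
  be shown.\<close>

lemma heat_convolution:
  fixes F :: "'a::euclidean_space \<Rightarrow> complex"
  assumes t: "t > 0" and F: "integrable lborel F"
  shows "(LINT y|lborel. of_real (heat_kernel t (x - y)) * (LINT \<xi>|lborel. cis (y \<bullet> \<xi>) * F \<xi>))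
    = (LINT \<xi>|lborel. cis (x \<bullet> \<xi>) * of_real (exp (- t * (norm \<xi>)\<^sup>2)) * F \<xi>)"
proof -
  have I: "integrable lborel (\<lambda>y. complex_of_real (heat_kernel t (x - y)))"
    by (rule integrable_reflect[of "\<lambda>y. of_real (heat_kernel t y)"]) (use integrable_heat_kernel[OF t] in auto)
  have "(LINT y|lborel. of_real (heat_kernel t (x - y)) * (LINT \<xi>|lborel. cis (y \<bullet> \<xi>) * F \<xi>))
    = (LINT \<xi>|lborel. F \<xi> * (LINT y|lborel. cis (y \<bullet> \<xi>) * of_real (heat_kernel t (x - y))))"
    using multiplication_formula[OF I F, of 1] by simp
  also have "\<dots> = (LINT \<xi>|lborel. cis (x \<bullet> \<xi>) * of_real (exp (- t * (norm \<xi>)\<^sup>2)) * F \<xi>)"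
  proof (intro Bochner_Integration.integral_cong refl)
    fix \<xi> :: 'a
    have "(LINT y|lborel. cis (y \<bullet> \<xi>) * of_real (heat_kernel t (x - y)))
      = of_real (\<bar>-1\<bar> ^ DIM('a)) * (LINT z|lborel. cis ((x + (-1) *\<^sub>R z) \<bullet> \<xi>) * of_real (heat_kernel t (x - (x + (-1) *\<^sub>R z))))"
      by (rule integral_lborel_affine) auto
    also have "\<dots> = (LINT z|lborel. cis (x \<bullet> \<xi>) * (cis (z \<bullet> (- \<xi>)) * of_real (heat_kernel t z)))"
      by (simp add: cis_mult inner_diff_left mult.assoc[symmetric])
    also have "\<dots> = cis (x \<bullet> \<xi>) * of_real (exp (- t * (norm \<xi>)\<^sup>2))"
      using cis_heat_kernel[OF t, of "- \<xi>"] by simp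
    finally show "F \<xi> * (LINT y|lborel. cis (y \<bullet> \<xi>) * of_real (heat_kernel t (x - y))) = cis (x \<bullet> \<xi>) * of_real (exp (- t * (norm \<xi>)\<^sup>2)) * F \<xi>"
      by simp
  qed
  finally show ?thesis .
qed

text \<open>Gaussian regularisation: damping the transform by a Gaussian amounts to averaging u
  against the heat kernel. As the damping vanishes, integrability of the transform controls one
  side, and boundedness and continuity of u control the other.\<close>

lemma fourier_inversion:
  fixes u :: "real^'n \<Rightarrow> complex"
  assumes u: "u \<in> Cc_infinity"
  shows "(LINT \<xi>|lborel. cis (x \<bullet> \<xi>) * fourier_transform u \<xi>) = of_real ((2 * pi) ^ CARD('n)) * u x"
proof -
  note [measurable] = Cc_infinity_measurable[OF u] fourier_transform_measurable[OF Cc_infinity_measurable[OF u]]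
  obtain M where M: "M \<ge> 0" "\<And>x. norm (u x) \<le> M" using Cc_infinity_bounded[OF u] by blast
  \<comment> \<open>w is the square root of the heat time: substituting y = x - w z rescales the
    kernel at time w^2 to the one at time 1, so a single integrable majorant serves all n.\<close>
  define w where "w n = 1 / real (Suc n)" for n
  have w: "w n > 0" for n by (simp add: w_def)
  have wl: "w \<longlonglongrightarrow> 0" unfolding w_def using LIMSEQ_Suc[OF lim_1_over_n] by simp
  have wl2: "(\<lambda>n. (w n)\<^sup>2) \<longlonglongrightarrow> 0" using tendsto_power[OF wl, of 2] by simp
  let ?K = "(2 * pi) ^ CARD('n)"
  have eq: "(LINT \<xi>|lborel. cis (x \<bullet> \<xi>) * of_real (exp (- (w n)\<^sup>2 * (norm \<xi>)\<^sup>2)) * fourier_transform u \<xi>)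
     = of_real ?K * (LINT z|lborel. u (x + (- w n) *\<^sub>R z) * of_real (heat_kernel 1 z))" for n
  proof -
    let ?t = "(w n)\<^sup>2"
    have t: "?t > 0" using w[of n] by simp
    have I: "integrable lborel (\<lambda>\<xi>::real^'n. cis (x \<bullet> \<xi>) * complex_of_real (exp (- ?t * (norm \<xi>)\<^sup>2)))"
      by (rule Bochner_Integration.integrable_bound[OF integrable_gaussian[OF t]]) (auto simp: norm_mult)
    have "(LINT \<xi>|lborel. (cis (x \<bullet> \<xi>) * of_real (exp (- ?t * (norm \<xi>)\<^sup>2))) * fourier_transform u \<xi>)
      = (LINT \<xi>|lborel. (cis (x \<bullet> \<xi>) * of_real (exp (- ?t * (norm \<xi>)\<^sup>2))) * (LINT y|lborel. cis ((-1) * (\<xi> \<bullet> y)) * u y))"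
      by (simp add: fourier_transform_lborel inner_commute)
    also have "\<dots> = (LINT y|lborel. u y * (LINT \<xi>|lborel. cis ((-1) * (\<xi> \<bullet> y)) * (cis (x \<bullet> \<xi>) * of_real (exp (- ?t * (norm \<xi>)\<^sup>2)))))"
      by (rule multiplication_formula[OF I Cc_infinity_integrable[OF u]])
    also have "\<dots> = (LINT y|lborel. of_real ?K * (u y * of_real (heat_kernel ?t (x - y))))"
    proof (intro Bochner_Integration.integral_cong refl)
      fix y :: "real^'n"
      have "(LINT \<xi>|lborel. cis ((-1) * (\<xi> \<bullet> y)) * (cis (x \<bullet> \<xi>) * of_real (exp (- ?t * (norm \<xi>)\<^sup>2))))
        = (LINT \<xi>|lborel. cis (\<xi> \<bullet> (x - y)) * of_real (exp (- ?t * (norm \<xi>)\<^sup>2)))"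
        by (simp add: mult.assoc[symmetric] cis_mult inner_diff_right inner_commute)
      then show "u y * (LINT \<xi>|lborel. cis ((-1) * (\<xi> \<bullet> y)) * (cis (x \<bullet> \<xi>) * of_real (exp (- ?t * (norm \<xi>)\<^sup>2))))
        = of_real ?K * (u y * of_real (heat_kernel ?t (x - y)))"
        using cis_gaussian_heat_kernel[OF t, of "x - y"] by simp
    qed
    also have "\<dots> = of_real ?K * (LINT y|lborel. u y * of_real (heat_kernel ?t (x - y)))"
      by (rule integral_mult_right_zero)
    also have "(LINT y|lborel. u y * of_real (heat_kernel ?t (x - y)))
      = of_real (\<bar>- w n\<bar> ^ DIM(real^'n)) * (LINT z|lborel. u (x + (- w n) *\<^sub>R z) * of_real (heat_kernel ?t (x - (x + (- w n) *\<^sub>R z))))"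
      using w[of n] by (intro integral_lborel_affine) auto
    also have "\<dots> = (LINT z|lborel. u (x + (- w n) *\<^sub>R z) * of_real (heat_kernel 1 z))"
    proof -
      have h: "\<bar>- w n\<bar> ^ DIM(real^'n) * heat_kernel ?t (w n *\<^sub>R z) = heat_kernel 1 z" for z :: "real^'n"
      proof -
        have "(4 * pi * ?t) powr (- (CARD('n) / 2)) = (4 * pi) powr (- (CARD('n) / 2)) * ((w n) powr 2) powr (- (CARD('n) / 2))"
          using w[of n] by (subst powr_mult) auto
        also have "((w n) powr 2) powr (- (CARD('n) / 2)) = w n powr (- CARD('n))" by (simp add: powr_powr del: powr_numeral)
        finally have "w n ^ CARD('n) * (4 * pi * ?t) powr (- (CARD('n) / 2)) = (4 * pi) powr (- (CARD('n) / 2)) * (w n ^ CARD('n) * w n powr (- CARD('n)))"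
          by simp
        also have "w n ^ CARD('n) * w n powr (- CARD('n)) = 1" using w[of n] by (simp add: powr_realpow[symmetric] powr_add[symmetric])
        finally show ?thesis using w[of n] by (simp add: heat_kernel_def power_mult_distrib mult.assoc[symmetric])
      qed
      have "of_real (\<bar>- w n\<bar> ^ DIM(real^'n)) * (LINT z|lborel. u (x + (- w n) *\<^sub>R z) * of_real (heat_kernel ?t (x - (x + (- w n) *\<^sub>R z))))
        = (LINT z|lborel. u (x + (- w n) *\<^sub>R z) * of_real (\<bar>- w n\<bar> ^ DIM(real^'n) * heat_kernel ?t (w n *\<^sub>R z)))"
        by (subst integral_mult_right_zero[symmetric]) (simp add: mult_ac)
      then show ?thesis unfolding h .
    qed
    finally show ?thesis .
  qed
  have l1: "(\<lambda>n. LINT \<xi>|lborel. cis (x \<bullet> \<xi>) * of_real (exp (- (w n)\<^sup>2 * (norm \<xi>)\<^sup>2)) * fourier_transform u \<xi>)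
    \<longlonglongrightarrow> (LINT \<xi>|lborel. cis (x \<bullet> \<xi>) * of_real (exp (- 0 * (norm \<xi>)\<^sup>2)) * fourier_transform u \<xi>)"
  proof (rule integral_dominated_convergence[where w="\<lambda>\<xi>. norm (fourier_transform u \<xi>)"])
    show "integrable lborel (\<lambda>\<xi>. norm (fourier_transform u \<xi>))"
      using integrable_fourier_transform(2)[OF u, of 0] by simp
    show "AE \<xi> in lborel. (\<lambda>n. cis (x \<bullet> \<xi>) * of_real (exp (- (w n)\<^sup>2 * (norm \<xi>)\<^sup>2)) * fourier_transform u \<xi>)
      \<longlonglongrightarrow> cis (x \<bullet> \<xi>) * of_real (exp (- 0 * (norm \<xi>)\<^sup>2)) * fourier_transform u \<xi>"
      by (intro AE_I2 tendsto_mult tendsto_const tendsto_of_real tendsto_exp tendsto_minus wl2)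
    show "AE \<xi> in lborel. norm (cis (x \<bullet> \<xi>) * of_real (exp (- (w n)\<^sup>2 * (norm \<xi>)\<^sup>2)) * fourier_transform u \<xi>) \<le> norm (fourier_transform u \<xi>)" for n
      by (auto simp: norm_mult intro!: mult_left_le_one_le)
  qed measurable
  have "(\<lambda>n. LINT z|lborel. u (x + (- w n) *\<^sub>R z) * of_real (heat_kernel 1 z)) \<longlonglongrightarrow> (LINT z|lborel. u (x + (- 0) *\<^sub>R z) * of_real (heat_kernel 1 z))"
  proof (rule integral_dominated_convergence[where w="\<lambda>z. M * heat_kernel 1 z"])
    show "integrable lborel (\<lambda>z::real^'n. M * heat_kernel 1 z)"
      by (intro integrable_mult_right integrable_heat_kernel) auto
    have "isCont u y" for y using Cc_infinity_continuous[OF u] by (simp add: continuous_on_eq_continuous_at)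
    then show "AE z in lborel. (\<lambda>n. u (x + (- w n) *\<^sub>R z) * of_real (heat_kernel 1 z)) \<longlonglongrightarrow> u (x + (- 0) *\<^sub>R z) * of_real (heat_kernel 1 z)"
      by (intro AE_I2 tendsto_mult tendsto_const isCont_tendsto_compose[where g=u] tendsto_add tendsto_scaleR tendsto_minus wl)
    show "AE z in lborel. norm (u (x + (- w n) *\<^sub>R z) * of_real (heat_kernel 1 z)) \<le> M * heat_kernel 1 z" for n
      using M by (auto simp: norm_mult intro!: mult_right_mono)
  qed measurable
  \<comment> \<open>\<open>cis_heat_kernel\<close> at frequency 0 says that the heat kernel has
    total mass 1.\<close>
  then have l2: "(\<lambda>n. of_real ?K * (LINT z|lborel. u (x + (- w n) *\<^sub>R z) * of_real (heat_kernel 1 z))) \<longlonglongrightarrow> of_real ?K * u x"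
    using cis_heat_kernel[of 1 "0::real^'n"] by (intro tendsto_mult tendsto_const) simp
  show ?thesis using LIMSEQ_unique[OF l1[unfolded eq] l2] by simp
qed

section \<open>The fractional Laplacian\<close>

lemma nn_integral_gamma_scaled:
  fixes a \<mu> :: real
  assumes a: "a > 0" and l: "\<mu> > 0"
  shows "(\<integral>\<^sup>+t. ennreal (indicator {0<..} t * (t powr (a - 1) * exp (- t * \<mu>))) \<partial>lborel) = ennreal (Gamma a * \<mu> powr (- a))"
proof -
  let ?X = "\<integral>\<^sup>+t. ennreal (indicator {0<..} t * (t powr (a - 1) * exp (- t * \<mu>))) \<partial>lborel"
  have "ennreal (Gamma a) = ennreal \<bar>\<mu>\<bar> * (\<integral>\<^sup>+t. ennreal (indicator {0..} (0 + \<mu> * t) * (0 + \<mu> * t) powr (a - 1) / exp (0 + \<mu> * t)) \<partial>lborel)"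
    unfolding Gamma_conv_nn_integral_real[OF a] using l by (intro nn_integral_real_affine) auto
  also have "(\<integral>\<^sup>+t. ennreal (indicator {0..} (0 + \<mu> * t) * (0 + \<mu> * t) powr (a - 1) / exp (0 + \<mu> * t)) \<partial>lborel)
    = (\<integral>\<^sup>+t. ennreal (\<mu> powr (a - 1)) * ennreal (indicator {0<..} t * (t powr (a - 1) * exp (- t * \<mu>))) \<partial>lborel)"
  proof (rule nn_integral_cong)
    fix t :: real
    show "ennreal (indicator {0..} (0 + \<mu> * t) * (0 + \<mu> * t) powr (a - 1) / exp (0 + \<mu> * t))
      = ennreal (\<mu> powr (a - 1)) * ennreal (indicator {0<..} t * (t powr (a - 1) * exp (- t * \<mu>)))"
      using l by (cases "t > 0"; cases "t = 0")
        (auto simp: ennreal_mult[symmetric] powr_mult exp_minus indicator_def field_simps zero_le_mult_iff)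
  qed
  also have "\<dots> = ennreal (\<mu> powr (a - 1)) * ?X" by (rule nn_integral_cmult) measurable
  finally have "ennreal (Gamma a) = ennreal (\<mu> powr a) * ?X"
    using l by (simp add: mult.assoc[symmetric] ennreal_mult[symmetric] powr_diff)
  then have "ennreal (\<mu> powr (- a)) * ennreal (Gamma a) = ennreal (\<mu> powr (- a)) * ennreal (\<mu> powr a) * ?X"
    by (simp add: mult.assoc)
  also have "ennreal (\<mu> powr (- a)) * ennreal (\<mu> powr a) = 1"
    using l by (simp add: ennreal_mult[symmetric] powr_add[symmetric])
  finally show ?thesis using Gamma_real_pos[OF a] by (simp add: ennreal_mult[symmetric] mult.commute)
qed

text \<open>The left side is largest at s = 4 b; accordingly \<open>ln x \<le> x - 1\<close> is used
  at x = s / (4 b).\<close>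

lemma powr_times_exp_le:
  fixes b s :: real
  assumes "b > 0" "s > 0"
  shows "s powr b * exp (- s / 4) \<le> (4 * b) powr b"
proof -
  have "ln (s / (4 * b)) \<le> s / (4 * b) - 1" using assms by (intro ln_le_minus_one) auto
  then have "b * ln (s / (4 * b)) \<le> b * (s / (4 * b) - 1)" using assms by (intro mult_left_mono) auto
  also have "\<dots> \<le> s / 4" using assms by (simp add: field_simps)
  finally have "b * ln s \<le> b * ln (4 * b) + s / 4" using assms by (simp add: ln_div algebra_simps)
  then have "exp (b * ln s + (- s / 4)) \<le> exp (b * ln (4 * b))" by simp
  then show ?thesis using assms by (simp add: powr_def exp_add[symmetric])
qed

text \<open>Near 0 the exponential beats any power of 1/t; near infinity the power is integrable
  because \<gamma> > 0. This is what remains of the time integral in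
  \<open>heat_time_integral\<close> after scaling z out, and there \<gamma> > 0 means \<alpha> <
  d.\<close>

lemma inverse_gamma_integral_finite:
  fixes \<gamma> :: real
  assumes g: "\<gamma> > 0"
  shows "(\<integral>\<^sup>+t. ennreal (indicator {0<..} t * (t powr (- \<gamma> - 1) * exp (- 1 / (4 * t)))) \<partial>lborel) < \<infinity>"
proof -
  define b where "b = \<gamma> + 1"
  have b: "b > 0" using g by (simp add: b_def)
  have "(\<integral>\<^sup>+t. ennreal (indicator {0<..} t * (t powr (- \<gamma> - 1) * exp (- 1 / (4 * t)))) \<partial>lborel)
    \<le> (\<integral>\<^sup>+t. ennreal ((4 * b) powr b) * indicator {0..1} t + ennreal (t powr (- \<gamma> - 1)) * indicator {1..} t \<partial>lborel)"
  proof (rule nn_integral_mono)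
    fix t :: real
    show "ennreal (indicator {0<..} t * (t powr (- \<gamma> - 1) * exp (- 1 / (4 * t))))
      \<le> ennreal ((4 * b) powr b) * indicator {0..1} t + ennreal (t powr (- \<gamma> - 1)) * indicator {1..} t"
    proof (cases "t > 0")
      case t: True
      show ?thesis
      proof (cases "t < 1")
        case True
        have "t powr (- \<gamma> - 1) * exp (- 1 / (4 * t)) = (1 / t) powr b * exp (- (1 / t) / 4)"
          using t by (simp add: b_def powr_divide powr_minus_divide powr_add powr_diff powr_minus field_simps)
        also have "\<dots> \<le> (4 * b) powr b" using t b by (intro powr_times_exp_le) auto
        finally show ?thesis using t True by (simp add: ennreal_leI)
      next
        case False
        then have "t powr (- \<gamma> - 1) * exp (- 1 / (4 * t)) \<le> t powr (- \<gamma> - 1) * 1"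
          using t by (intro mult_left_mono) auto
        then have "ennreal (t powr (- \<gamma> - 1) * exp (- 1 / (4 * t))) \<le> ennreal (t powr (- \<gamma> - 1))" by (simp add: ennreal_leI)
        then show ?thesis using t False by (simp add: add_increasing)
      qed
    qed simp
  qed
  also have "\<dots> = ennreal ((4 * b) powr b) + (\<integral>\<^sup>+t. ennreal (t powr (- \<gamma> - 1)) * indicator {1..} t \<partial>lborel)"
    by (subst nn_integral_add) (auto simp: nn_integral_cmult_indicator)
  also have "(\<integral>\<^sup>+t. ennreal (t powr (- \<gamma> - 1)) * indicator {1..} t \<partial>lborel) = ennreal (0 - (- (1 powr (- \<gamma>) / \<gamma>)))"
  proof (rule nn_integral_FTC_atLeast)
    fix t :: real assume t: "1 \<le> t"
    show "((\<lambda>t. - (t powr (- \<gamma>) / \<gamma>)) has_real_derivative t powr (- \<gamma> - 1)) (at t)"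
      using t g by (auto intro!: derivative_eq_intros simp: field_simps powr_diff)
  next
    have "((\<lambda>t::real. t powr (- \<gamma>)) \<longlongrightarrow> 0) at_top"
      using g by (intro tendsto_neg_powr filterlim_ident) auto
    then show "((\<lambda>t. - (t powr (- \<gamma>) / \<gamma>)) \<longlongrightarrow> 0) at_top"
      using tendsto_minus[OF tendsto_divide[OF _ tendsto_const[of \<gamma>], of "\<lambda>t. t powr (- \<gamma>)" 0 at_top]] g by simp
  qed auto
  finally show ?thesis by (rule le_less_trans) simp
qed

text \<open>Scaling time by the square of \<open>norm z\<close> removes z from the exponential and
  extracts the power n^2 * n^(-2 \<gamma> - 2) = n^(\<alpha> - d). What is left is a finite number
  independent of z.\<close>

lemma heat_time_integral:
  fixes \<alpha> :: real
  assumes \<alpha>: "0 < \<alpha>" "\<alpha> < DIM('a::euclidean_space)"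
  shows "\<exists>c>0. \<forall>z::'a. z \<noteq> 0 \<longrightarrow>
    (\<integral>\<^sup>+t. ennreal (indicator {0<..} t * t powr (\<alpha> / 2 - 1)) * ennreal (heat_kernel t z) \<partial>lborel) \<le> ennreal (c * norm z powr (\<alpha> - DIM('a)))"
proof -
  define d where "d = real DIM('a)"
  define \<gamma> where "\<gamma> = (d - \<alpha>) / 2"
  have g: "\<gamma> > 0" using \<alpha> by (simp add: \<gamma>_def d_def)
  obtain I where I: "(\<integral>\<^sup>+t. ennreal (indicator {0<..} t * (t powr (- \<gamma> - 1) * exp (- 1 / (4 * t)))) \<partial>lborel) = ennreal I" "I \<ge> 0"
    using inverse_gamma_integral_finite[OF g] by (cases "\<integral>\<^sup>+t. ennreal (indicator {0<..} t * (t powr (- \<gamma> - 1) * exp (- 1 / (4 * t)))) \<partial>lborel") auto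
  define K where "K = (4 * pi) powr (- (d / 2))"
  have K: "K \<ge> 0" by (simp add: K_def)
  show ?thesis
  \<comment> \<open>The summand 1 makes the constant positive when only \<open>K \<ge> 0\<close> and
    \<open>I \<ge> 0\<close> are at hand.\<close>
  proof (intro exI[of _ "K * I + 1"] conjI allI impI)
    show "0 < K * I + 1" using K I by (intro add_nonneg_pos) auto
    fix z :: 'a assume z: "z \<noteq> 0"
    define n where "n = norm z"
    have n: "n > 0" using z by (simp add: n_def)
    let ?f = "\<lambda>t. ennreal (indicator {0<..} t * t powr (\<alpha> / 2 - 1)) * ennreal (heat_kernel t z)"
    have "(\<integral>\<^sup>+t. ?f t \<partial>lborel) = ennreal \<bar>n\<^sup>2\<bar> * (\<integral>\<^sup>+t. ?f (0 + n\<^sup>2 * t) \<partial>lborel)"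
      using n by (intro nn_integral_real_affine) (auto simp: heat_kernel_def)
    also have "(\<integral>\<^sup>+t. ?f (0 + n\<^sup>2 * t) \<partial>lborel) = (\<integral>\<^sup>+t. ennreal (K * n powr (- 2 * \<gamma> - 2)) * ennreal (indicator {0<..} t * (t powr (- \<gamma> - 1) * exp (- 1 / (4 * t)))) \<partial>lborel)"
    proof (rule nn_integral_cong)
      fix t :: real
      show "?f (0 + n\<^sup>2 * t) = ennreal (K * n powr (- 2 * \<gamma> - 2)) * ennreal (indicator {0<..} t * (t powr (- \<gamma> - 1) * exp (- 1 / (4 * t))))"
      proof (cases "t > 0")
        case True
        have n2: "(n\<^sup>2) powr q = n powr (2 * q)" for q
          using n by (simp add: powr_powr[symmetric])
        have "(n\<^sup>2 * t) powr (\<alpha> / 2 - 1) * ((4 * pi * (n\<^sup>2 * t)) powr (- (d / 2)))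
          = K * ((n\<^sup>2) powr (\<alpha> / 2 - 1) * (n\<^sup>2) powr (- (d / 2))) * (t powr (\<alpha> / 2 - 1) * t powr (- (d / 2)))"
          by (simp add: K_def powr_mult mult_ac)
        also have "(n\<^sup>2) powr (\<alpha> / 2 - 1) * (n\<^sup>2) powr (- (d / 2)) = n powr (- 2 * \<gamma> - 2)"
          unfolding n2 powr_add[symmetric] by (simp add: \<gamma>_def field_simps)
        also have "t powr (\<alpha> / 2 - 1) * t powr (- (d / 2)) = t powr (- \<gamma> - 1)"
        proof -
          have "\<alpha> / 2 - 1 + - (d / 2) = - \<gamma> - 1" by (simp add: \<gamma>_def field_simps)
          then show ?thesis unfolding powr_add[symmetric] by (simp only:)
        qed
        finally have e: "(n\<^sup>2 * t) powr (\<alpha> / 2 - 1) * ((4 * pi * (n\<^sup>2 * t)) powr (- (d / 2))) = K * n powr (- 2 * \<gamma> - 2) * t powr (- \<gamma> - 1)" .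
        have x: "- (norm z)\<^sup>2 / (4 * (n\<^sup>2 * t)) = - 1 / (4 * t)" using n by (simp add: n_def)
        have "?f (0 + n\<^sup>2 * t) = ennreal ((n\<^sup>2 * t) powr (\<alpha> / 2 - 1) * ((4 * pi * (n\<^sup>2 * t)) powr (- (d / 2))) * exp (- 1 / (4 * t)))"
          unfolding heat_kernel_def d_def[symmetric] using True n x by (simp add: ennreal_mult[symmetric] mult.assoc)
        also have "\<dots> = ennreal (K * n powr (- 2 * \<gamma> - 2) * (t powr (- \<gamma> - 1) * exp (- 1 / (4 * t))))"
          unfolding e by (simp only: mult.assoc)
        finally show ?thesis using True K by (simp add: ennreal_mult)
      next
        case False
        then show ?thesis using n by (simp add: zero_less_mult_iff)
      qed
    qed
    also have "\<dots> = ennreal (K * n powr (- 2 * \<gamma> - 2)) * ennreal I"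
      unfolding I(1)[symmetric] by (rule nn_integral_cmult) measurable
    also have "ennreal \<bar>n\<^sup>2\<bar> * (ennreal (K * n powr (- 2 * \<gamma> - 2)) * ennreal I) = ennreal (n\<^sup>2 * (K * n powr (- 2 * \<gamma> - 2) * I))"
      using n K I by (simp add: ennreal_mult[symmetric])
    also have "n\<^sup>2 * (K * n powr (- 2 * \<gamma> - 2) * I) = K * I * (n powr 2 * n powr (- 2 * \<gamma> - 2))"
      using n by simp
    also have "n powr 2 * n powr (- 2 * \<gamma> - 2) = n powr (\<alpha> - d)"
    proof -
      have "2 + (- 2 * \<gamma> - 2) = \<alpha> - d" by (simp add: \<gamma>_def)
      then show ?thesis unfolding powr_add[symmetric] by (simp only:)
    qed
    also have "ennreal (K * I * n powr (\<alpha> - d)) \<le> ennreal ((K * I + 1) * n powr (\<alpha> - d))"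
      by (intro ennreal_leI mult_right_mono) auto
    finally show "(\<integral>\<^sup>+t. ?f t \<partial>lborel) \<le> ennreal ((K * I + 1) * norm z powr (\<alpha> - DIM('a)))"
      by (simp add: n_def d_def)
  qed
qed

lemma frac_laplacian_lborel:
  fixes u :: "real^'n \<Rightarrow> complex"
  assumes [measurable]: "u \<in> borel_measurable borel"
  shows "frac_laplacian (\<alpha> / 2) u y = of_real (1 / (2 * pi) ^ CARD('n)) * (LINT \<xi>|lborel. cis (y \<bullet> \<xi>) * (of_real (norm \<xi> powr \<alpha>) * fourier_transform u \<xi>))"
    and "frac_laplacian (\<alpha> / 2) u \<in> borel_measurable borel"
proof -
  note [measurable] = fourier_transform_measurable[OF assms]
  show *: "frac_laplacian (\<alpha> / 2) u y = of_real (1 / (2 * pi) ^ CARD('n)) * (LINT \<xi>|lborel. cis (y \<bullet> \<xi>) * (of_real (norm \<xi> powr \<alpha>) * fourier_transform u \<xi>))" for y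
    unfolding frac_laplacian_def fourier_multiplier_def
    by (subst integral_completion) (auto simp: mult.assoc)
  have "(\<lambda>y. of_real (1 / (2 * pi) ^ CARD('n)) * (LINT \<xi>|lborel. cis (y \<bullet> \<xi>) * (of_real (norm \<xi> powr \<alpha>) * fourier_transform u \<xi>))) \<in> borel_measurable (borel :: (real^'n) measure)"
    by measurable
  then show "frac_laplacian (\<alpha> / 2) u \<in> borel_measurable borel"
    unfolding *[abs_def] .
qed

text \<open>In the inversion formula, 1 is written as
  \<open>norm \<xi> powr (- \<alpha>) * norm \<xi> powr \<alpha>\<close> and the negative power as a
  Gamma integral in t. For each t, \<open>heat_convolution\<close> turns the frequency integral into
  a heat average of the fractional Laplacian, and only then are absolute values taken.\<close>

lemma norm_le_heat_integral:
  fixes u :: "real^'n \<Rightarrow> complex" and \<alpha> :: real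
  assumes u: "u \<in> Cc_infinity" and \<alpha>: "0 < \<alpha>"
  shows "ennreal (Gamma (\<alpha> / 2) * norm (u x)) \<le> (\<integral>\<^sup>+t. ennreal (indicator {0<..} t * t powr (\<alpha> / 2 - 1)) *
     (\<integral>\<^sup>+y. ennreal (heat_kernel t (x - y)) * ennreal (norm (frac_laplacian (\<alpha> / 2) u y)) \<partial>lborel) \<partial>lborel)"
proof -
  note um [measurable] = Cc_infinity_measurable[OF u]
  note [measurable] = fourier_transform_measurable[OF um] frac_laplacian_lborel(2)[OF um, of \<alpha>]
  define F where "F \<xi> = of_real (norm \<xi> powr \<alpha>) * fourier_transform u \<xi>" for \<xi>
  have F: "integrable lborel F" unfolding F_def using integrable_fourier_transform(1)[OF u, of \<alpha>] \<alpha> by simp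
  have [measurable]: "F \<in> borel_measurable borel" using F by auto
  define f where "f = frac_laplacian (\<alpha> / 2) u"
  have [measurable]: "f \<in> borel_measurable borel" unfolding f_def by measurable
  let ?K = "(2 * pi) ^ CARD('n)"
  have f: "(LINT \<xi>|lborel. cis (y \<bullet> \<xi>) * F \<xi>) = of_real ?K * f y" for y
    unfolding f_def frac_laplacian_lborel(1)[OF um] F_def by simp
  define k where "k t \<xi> = indicator {0<..} t * (t powr (\<alpha> / 2 - 1) * exp (- t * (norm \<xi>)\<^sup>2))" for t :: real and \<xi> :: "real^'n"
  have k0: "k t \<xi> \<ge> 0" for t \<xi> by (simp add: k_def)
  have [measurable]: "(\<lambda>(t, \<xi>). k t \<xi>) \<in> borel_measurable (lborel \<Otimes>\<^sub>M lborel)" unfolding k_def by measurable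
  have [measurable]: "(\<lambda>t. k t \<xi>) \<in> borel_measurable borel" for \<xi> unfolding k_def by measurable
  have kint: "(\<integral>\<^sup>+t. ennreal (k t \<xi>) \<partial>lborel) = ennreal (Gamma (\<alpha> / 2) * norm \<xi> powr (- \<alpha>))" if "\<xi> \<noteq> 0" for \<xi>
  proof -
    have "((norm \<xi>)\<^sup>2) powr (- (\<alpha> / 2)) = norm \<xi> powr (- \<alpha>)"
      using that powr_powr[of "norm \<xi>" 2 "- (\<alpha> / 2)"] by simp
    then show ?thesis using nn_integral_gamma_scaled[of "\<alpha> / 2" "(norm \<xi>)\<^sup>2"] \<alpha> that by (simp add: k_def)
  qed
  have G: "Gamma (\<alpha> / 2) > 0" using \<alpha> by (intro Gamma_real_pos) auto
  let ?\<Phi> = "\<lambda>t \<xi>. of_real (k t \<xi>) * (cis (x \<bullet> \<xi>) * F \<xi>)"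
  have nz: "AE \<xi> in lborel. (\<xi> :: real^'n) \<noteq> 0" by (rule AE_lborel_singleton)
  \<comment> \<open>Absolute convergence: integrating k over t gives a multiple of
    \<open>norm \<xi> powr (- \<alpha>)\<close>, which cancels the factor in F and leaves the
    integrable modulus of the transform of u. The frequency 0 is a null set and is left out by
    \<open>nz\<close>.\<close>
  have int: "integrable (lborel \<Otimes>\<^sub>M lborel) (\<lambda>(\<xi>, t). ?\<Phi> t \<xi>)"
  proof (rule integrableI_bounded)
    show "(\<lambda>(\<xi>, t). ?\<Phi> t \<xi>) \<in> borel_measurable (lborel \<Otimes>\<^sub>M lborel)"
      unfolding k_def by measurable
    have "(\<integral>\<^sup>+p. ennreal (norm (case p of (\<xi>, t) \<Rightarrow> ?\<Phi> t \<xi>)) \<partial>(lborel \<Otimes>\<^sub>M lborel))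
      = (\<integral>\<^sup>+\<xi>. (\<integral>\<^sup>+t. ennreal (norm (F \<xi>)) * ennreal (k t \<xi>) \<partial>lborel) \<partial>lborel)"
      by (subst lborel.nn_integral_fst[symmetric]) (auto simp: norm_mult ennreal_mult k_def mult_ac)
    also have "\<dots> = (\<integral>\<^sup>+\<xi>. ennreal (norm (F \<xi>)) * (\<integral>\<^sup>+t. ennreal (k t \<xi>) \<partial>lborel) \<partial>lborel)"
      by (simp add: nn_integral_cmult)
    also have "\<dots> = (\<integral>\<^sup>+\<xi>. ennreal (Gamma (\<alpha> / 2)) * ennreal (norm (fourier_transform u \<xi>)) \<partial>lborel)"
    proof (rule nn_integral_cong_AE, use nz in eventually_elim)
      case (elim \<xi>)
      have "ennreal (norm (F \<xi>)) * ennreal (Gamma (\<alpha> / 2) * norm \<xi> powr (- \<alpha>)) = ennreal (Gamma (\<alpha> / 2) * norm (fourier_transform u \<xi>) * (norm \<xi> powr \<alpha> * norm \<xi> powr (- \<alpha>)))"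
        using G by (simp add: F_def norm_mult ennreal_mult[symmetric] mult_ac)
      also have "norm \<xi> powr \<alpha> * norm \<xi> powr (- \<alpha>) = 1" using elim by (simp add: powr_add[symmetric])
      finally show ?case using G by (simp add: kint[OF elim] ennreal_mult)
    qed
    also have "\<dots> = ennreal (Gamma (\<alpha> / 2)) * (\<integral>\<^sup>+\<xi>. ennreal (norm (fourier_transform u \<xi>)) \<partial>lborel)"
      by (rule nn_integral_cmult) measurable
    also have "\<dots> < \<infinity>"
      using integrable_fourier_transform(2)[OF u, of 0] by (simp add: integrable_iff_bounded ennreal_mult_less_top)
    finally show "(\<integral>\<^sup>+p. ennreal (norm (case p of (\<xi>, t) \<Rightarrow> ?\<Phi> t \<xi>)) \<partial>(lborel \<Otimes>\<^sub>M lborel)) < \<infinity>" .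
  qed
  have "of_real (Gamma (\<alpha> / 2)) * (of_real ?K * u x) = (LINT \<xi>|lborel. of_real (Gamma (\<alpha> / 2)) * (cis (x \<bullet> \<xi>) * fourier_transform u \<xi>))"
    by (subst integral_mult_right_zero) (simp add: fourier_inversion[OF u])
  also have "\<dots> = (LINT \<xi>|lborel. LINT t|lborel. ?\<Phi> t \<xi>)"
  proof (rule integral_cong_AE)
    show "AE \<xi> in lborel. of_real (Gamma (\<alpha> / 2)) * (cis (x \<bullet> \<xi>) * fourier_transform u \<xi>) = (LINT t|lborel. ?\<Phi> t \<xi>)"
      using nz
    proof eventually_elim
      case (elim \<xi>)
      have "(LINT t|lborel. k t \<xi>) = Gamma (\<alpha> / 2) * norm \<xi> powr (- \<alpha>)"
        using kint[OF elim] G k0 by (subst integral_eq_nn_integral) auto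
      then have "(LINT t|lborel. complex_of_real (k t \<xi>)) = of_real (Gamma (\<alpha> / 2) * norm \<xi> powr (- \<alpha>))"
        by (simp only: integral_complex_of_real)
      then have "(LINT t|lborel. ?\<Phi> t \<xi>) = of_real (Gamma (\<alpha> / 2) * norm \<xi> powr (- \<alpha>)) * (cis (x \<bullet> \<xi>) * F \<xi>)"
        by (subst integral_mult_left_zero) simp
      also have "\<dots> = of_real (norm \<xi> powr (- \<alpha>) * norm \<xi> powr \<alpha>) * (of_real (Gamma (\<alpha> / 2)) * (cis (x \<bullet> \<xi>) * fourier_transform u \<xi>))"
        by (simp add: F_def mult_ac)
      also have "norm \<xi> powr (- \<alpha>) * norm \<xi> powr \<alpha> = 1" using elim by (simp add: powr_add[symmetric])
      finally show ?case by simp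
    qed
    show "(\<lambda>\<xi>. LINT t|lborel. ?\<Phi> t \<xi>) \<in> borel_measurable lborel" unfolding k_def by measurable
  qed measurable
  also have "\<dots> = (LINT t|lborel. LINT \<xi>|lborel. ?\<Phi> t \<xi>)"
    by (rule lborel_pair.Fubini_integral[OF int, symmetric])
  finally have eq: "of_real (Gamma (\<alpha> / 2)) * (of_real ?K * u x) = (LINT t|lborel. LINT \<xi>|lborel. ?\<Phi> t \<xi>)" .
  have int2: "integrable lborel (\<lambda>t. LINT \<xi>|lborel. ?\<Phi> t \<xi>)"
    using lborel_pair.integrable_snd[OF int] by simp
  have inner: "(LINT \<xi>|lborel. ?\<Phi> t \<xi>) = of_real (indicator {0<..} t * t powr (\<alpha> / 2 - 1)) * (of_real ?K * (LINT y|lborel. of_real (heat_kernel t (x - y)) * f y))" for t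
  proof (cases "t > 0")
    case True
    have "(LINT \<xi>|lborel. ?\<Phi> t \<xi>) = (LINT \<xi>|lborel. of_real (t powr (\<alpha> / 2 - 1)) * (cis (x \<bullet> \<xi>) * of_real (exp (- t * (norm \<xi>)\<^sup>2)) * F \<xi>))"
      using True by (intro Bochner_Integration.integral_cong refl) (simp add: k_def mult_ac)
    also have "\<dots> = of_real (t powr (\<alpha> / 2 - 1)) * (LINT \<xi>|lborel. cis (x \<bullet> \<xi>) * of_real (exp (- t * (norm \<xi>)\<^sup>2)) * F \<xi>)"
      by (rule integral_mult_right_zero)
    also have "(LINT \<xi>|lborel. cis (x \<bullet> \<xi>) * of_real (exp (- t * (norm \<xi>)\<^sup>2)) * F \<xi>) = (LINT y|lborel. of_real (heat_kernel t (x - y)) * (of_real ?K * f y))"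
      using heat_convolution[OF True F, of x] by (simp add: f)
    also have "\<dots> = (LINT y|lborel. of_real ?K * (of_real (heat_kernel t (x - y)) * f y))"
      by (intro Bochner_Integration.integral_cong refl) (simp only: mult_ac)
    also have "\<dots> = of_real ?K * (LINT y|lborel. of_real (heat_kernel t (x - y)) * f y)"
      by (rule integral_mult_right_zero)
    finally show ?thesis using True by simp
  qed (simp add: k_def)
  have "ennreal (Gamma (\<alpha> / 2) * (?K * norm (u x))) = ennreal (norm (LINT t|lborel. LINT \<xi>|lborel. ?\<Phi> t \<xi>))"
    unfolding eq[symmetric] using G by (simp add: norm_mult norm_power)
  also have "\<dots> \<le> (\<integral>\<^sup>+t. ennreal (norm (LINT \<xi>|lborel. ?\<Phi> t \<xi>)) \<partial>lborel)"
    by (rule integral_norm_bound_ennreal[OF int2])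
  also have "\<dots> \<le> (\<integral>\<^sup>+t. ennreal ?K * (ennreal (indicator {0<..} t * t powr (\<alpha> / 2 - 1)) * (\<integral>\<^sup>+y. ennreal (heat_kernel t (x - y)) * ennreal (norm (f y)) \<partial>lborel)) \<partial>lborel)"
  proof (rule nn_integral_mono)
    fix t :: real
    \<comment> \<open>If the function is not integrable, its Bochner integral is 0 and the bound is
      trivial.\<close>
    have "ennreal (norm (LINT y|lborel. of_real (heat_kernel t (x - y)) * f y)) \<le> (\<integral>\<^sup>+y. ennreal (norm (of_real (heat_kernel t (x - y)) * f y)) \<partial>lborel)"
      by (cases "integrable lborel (\<lambda>y. of_real (heat_kernel t (x - y)) * f y)")
        (auto intro: integral_norm_bound_ennreal simp: not_integrable_integral_eq)
    also have "\<dots> = (\<integral>\<^sup>+y. ennreal (heat_kernel t (x - y)) * ennreal (norm (f y)) \<partial>lborel)"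
      by (intro nn_integral_cong) (simp add: norm_mult ennreal_mult)
    finally have a: "ennreal (norm (LINT y|lborel. of_real (heat_kernel t (x - y)) * f y)) \<le> (\<integral>\<^sup>+y. ennreal (heat_kernel t (x - y)) * ennreal (norm (f y)) \<partial>lborel)" .
    have "ennreal (norm (LINT \<xi>|lborel. ?\<Phi> t \<xi>)) = ennreal ((indicator {0<..} t * t powr (\<alpha> / 2 - 1)) * (?K * norm (LINT y|lborel. of_real (heat_kernel t (x - y)) * f y)))"
      unfolding inner by (simp add: norm_mult norm_power abs_mult)
    also have "\<dots> = ennreal ?K * (ennreal (indicator {0<..} t * t powr (\<alpha> / 2 - 1)) * ennreal (norm (LINT y|lborel. of_real (heat_kernel t (x - y)) * f y)))"
    proof -
      have "ennreal (a * (K * b)) = ennreal K * (ennreal a * ennreal b)" if "0 \<le> a" "0 \<le> K" "0 \<le> b" for a K b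
        using that by (simp add: ennreal_mult mult_ac)
      then show ?thesis by this auto
    qed
    also have "\<dots> \<le> ennreal ?K * (ennreal (indicator {0<..} t * t powr (\<alpha> / 2 - 1)) * (\<integral>\<^sup>+y. ennreal (heat_kernel t (x - y)) * ennreal (norm (f y)) \<partial>lborel))"
      by (intro mult_left_mono a) auto
    finally show "ennreal (norm (LINT \<xi>|lborel. ?\<Phi> t \<xi>)) \<le> \<dots>" .
  qed
  also have "\<dots> = ennreal ?K * (\<integral>\<^sup>+t. ennreal (indicator {0<..} t * t powr (\<alpha> / 2 - 1)) * (\<integral>\<^sup>+y. ennreal (heat_kernel t (x - y)) * ennreal (norm (f y)) \<partial>lborel) \<partial>lborel)"
    by (rule nn_integral_cmult) (unfold heat_kernel_def, measurable)
  finally have "ennreal ?K * ennreal (Gamma (\<alpha> / 2) * norm (u x)) \<le> \<dots>"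
    using G by (simp add: ennreal_mult[symmetric] mult_ac)
  then show ?thesis unfolding f_def by (subst (asm) ennreal_mult_le_mult_iff) auto
qed

lemma norm_le_riesz_frac_laplacian:
  fixes \<alpha> :: real
  assumes \<alpha>: "0 < \<alpha>" "\<alpha> < real CARD('n)"
  shows "\<exists>C>0. \<forall>u \<in> (Cc_infinity :: (real^'n \<Rightarrow> complex) set). \<forall>x.
    ennreal (norm (u x)) \<le> ennreal C * (\<integral>\<^sup>+y. ennreal (norm (x - y) powr (\<alpha> - real CARD('n))) * ennreal (norm (frac_laplacian (\<alpha> / 2) u y)) \<partial>lborel)"
proof -
  obtain c where c: "c > 0" and hc: "\<And>z::real^'n. z \<noteq> 0 \<Longrightarrow>
    (\<integral>\<^sup>+t. ennreal (indicator {0<..} t * t powr (\<alpha> / 2 - 1)) * ennreal (heat_kernel t z) \<partial>lborel) \<le> ennreal (c * norm z powr (\<alpha> - real CARD('n)))"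
    using heat_time_integral[of \<alpha>, where 'a="real^'n"] \<alpha> by auto
  have G: "Gamma (\<alpha> / 2) > 0" using \<alpha> by (intro Gamma_real_pos) auto
  show ?thesis
  proof (intro exI[of _ "c / Gamma (\<alpha> / 2)"] conjI ballI allI)
    show "c / Gamma (\<alpha> / 2) > 0" using c G by simp
    fix u :: "real^'n \<Rightarrow> complex" and x
    assume u: "u \<in> Cc_infinity"
    define f where "f y = ennreal (norm (frac_laplacian (\<alpha> / 2) u y))" for y
    have [measurable]: "f \<in> borel_measurable borel"
      unfolding f_def using frac_laplacian_lborel(2)[OF Cc_infinity_measurable[OF u], of \<alpha>] by measurable
    let ?w = "\<lambda>t::real. ennreal (indicator {0<..} t * t powr (\<alpha> / 2 - 1))"
    have "ennreal (Gamma (\<alpha> / 2) * norm (u x)) \<le> (\<integral>\<^sup>+t. ?w t * (\<integral>\<^sup>+y. ennreal (heat_kernel t (x - y)) * f y \<partial>lborel) \<partial>lborel)"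
      unfolding f_def by (rule norm_le_heat_integral[OF u \<alpha>(1)])
    also have "\<dots> = (\<integral>\<^sup>+t. (\<integral>\<^sup>+y. ?w t * (ennreal (heat_kernel t (x - y)) * f y) \<partial>lborel) \<partial>lborel)"
      by (intro nn_integral_cong nn_integral_cmult[symmetric]) measurable
    also have "\<dots> = (\<integral>\<^sup>+y. (\<integral>\<^sup>+t. ?w t * (ennreal (heat_kernel t (x - y)) * f y) \<partial>lborel) \<partial>lborel)"
      by (rule lborel_pair.Fubini'[symmetric]) (unfold heat_kernel_def, measurable)
    also have "\<dots> \<le> (\<integral>\<^sup>+y. ennreal c * (ennreal (norm (x - y) powr (\<alpha> - real CARD('n))) * f y) \<partial>lborel)"
    \<comment> \<open>The point y = x must be omitted: the time integral diverges there, whereas the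
      power of 0 on the right is 0.\<close>
    proof (rule nn_integral_mono_AE, use AE_lborel_singleton[of x] in eventually_elim)
      case (elim y)
      have "(\<integral>\<^sup>+t. ?w t * (ennreal (heat_kernel t (x - y)) * f y) \<partial>lborel) = (\<integral>\<^sup>+t. ?w t * ennreal (heat_kernel t (x - y)) \<partial>lborel) * f y"
        by (subst nn_integral_multc[symmetric]) (unfold heat_kernel_def, measurable, simp only: mult.assoc)
      also have "\<dots> \<le> ennreal (c * norm (x - y) powr (\<alpha> - real CARD('n))) * f y"
        using elim by (intro mult_right_mono hc) auto
      finally show ?case using c by (simp add: ennreal_mult mult.assoc)
    qed
    also have "\<dots> = ennreal c * (\<integral>\<^sup>+y. ennreal (norm (x - y) powr (\<alpha> - real CARD('n))) * f y \<partial>lborel)"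
      by (rule nn_integral_cmult) measurable
    finally have "ennreal (1 / Gamma (\<alpha> / 2)) * ennreal (Gamma (\<alpha> / 2) * norm (u x)) \<le> ennreal (1 / Gamma (\<alpha> / 2)) * (ennreal c * (\<integral>\<^sup>+y. ennreal (norm (x - y) powr (\<alpha> - real CARD('n))) * f y \<partial>lborel))"
      by (rule mult_left_mono) simp
    moreover have "ennreal (1 / Gamma (\<alpha> / 2)) * ennreal (Gamma (\<alpha> / 2) * norm (u x)) = ennreal (norm (u x))"
      using G by (simp add: ennreal_mult[symmetric])
    moreover have "ennreal (1 / Gamma (\<alpha> / 2)) * ennreal c = ennreal (c / Gamma (\<alpha> / 2))"
      using G c by (simp add: ennreal_mult[symmetric])
    ultimately show "ennreal (norm (u x)) \<le> ennreal (c / Gamma (\<alpha> / 2)) * (\<integral>\<^sup>+y. ennreal (norm (x - y) powr (\<alpha> - real CARD('n))) * ennreal (norm (frac_laplacian (\<alpha> / 2) u y)) \<partial>lborel)"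
      by (simp add: mult.assoc[symmetric] f_def)
  qed
qed

section \<open>Morrey bounds\<close>

lemma morrey_bound_nonneg:
  assumes "morrey_bound p \<alpha> A (b :: real^'n \<Rightarrow> real)" shows "0 \<le> A"
proof -
  note conjunct2[OF assms[unfolded morrey_bound_def, rule_format, OF zero_less_one, of 0]]
  from order_trans[OF powr_ge_zero this] show ?thesis by simp
qed

text \<open>The maximal function estimates require Borel functions, but \<open>b\<close> is only
  Lebesgue measurable. Averages ignore null sets, so the bound passes to a modification
  \<open>b'\<close>.\<close>

lemma morrey_bound_ball_avg:
  fixes b b' :: "real^'n \<Rightarrow> real"
  assumes M: "morrey_bound p \<alpha> A b" and p: "0 < p" and \<rho>: "0 < \<rho>"
    and ae: "AE x in lborel. b x = b' x"
  shows "ball_avg \<rho> (\<lambda>y. ennreal (b' y powr p)) x \<le> ennreal (unit_ball_vol (real CARD('n)) * (A * \<rho> powr (- \<alpha>)) powr p)"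
proof -
  define d where "d = real CARD('n)"
  define v where "v = unit_ball_vol d"
  have v: "v > 0" unfolding v_def d_def by (rule unit_ball_vol_pos) simp
  define I where "I = (LINT y:ball x \<rho>|lebesgue. b y powr p)"
  have int: "set_integrable lebesgue (ball x \<rho>) (\<lambda>y. b y powr p)"
    and le: "((1 / measure lebesgue (ball x \<rho>)) * I) powr (1 / p) \<le> A * \<rho> powr (- \<alpha>)"
    using M \<rho> unfolding morrey_bound_def I_def by blast+
  have I0: "0 \<le> I" unfolding I_def set_lebesgue_integral_def by (intro integral_nonneg_AE) (auto simp: indicator_def)
  have "measure lebesgue (ball x \<rho>) = v * \<rho> powr d"
    using \<rho> by (simp add: content_ball v_def d_def powr_realpow)
  then have le': "(I / (v * \<rho> powr d)) powr (1 / p) \<le> A * \<rho> powr (- \<alpha>)" using le by simp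
  have "I / (v * \<rho> powr d) = ((I / (v * \<rho> powr d)) powr (1 / p)) powr p"
    using p I0 v by (simp add: powr_powr)
  also have "\<dots> \<le> (A * \<rho> powr (- \<alpha>)) powr p"
    using le' p by (intro powr_mono2) auto
  finally have Ile: "\<rho> powr (- d) * I \<le> v * (A * \<rho> powr (- \<alpha>)) powr p"
    using v \<rho> by (simp add: powr_minus divide_simps mult_ac)
  have "(\<integral>\<^sup>+y. (if dist x y < \<rho> then ennreal (b' y powr p) else 0) \<partial>lborel)
    = (\<integral>\<^sup>+y. ennreal (indicator (ball x \<rho>) y *\<^sub>R b y powr p) \<partial>lborel)"
    using ae by (intro nn_integral_cong_AE) (auto elim!: eventually_mono simp: indicator_def)
  also have "\<dots> = (\<integral>\<^sup>+y. ennreal (indicator (ball x \<rho>) y *\<^sub>R b y powr p) \<partial>lebesgue)"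
    by (rule nn_integral_completion[symmetric])
  also have "\<dots> = ennreal I"
    using int unfolding I_def set_lebesgue_integral_def set_integrable_def
    by (intro nn_integral_eq_integral) (auto simp: indicator_def)
  finally have "ball_avg \<rho> (\<lambda>y. ennreal (b' y powr p)) x = ennreal (\<rho> powr (- d) * I)"
    using I0 by (simp add: ball_avg_def d_def ennreal_mult)
  then show ?thesis using Ile by (simp add: ennreal_leI v_def d_def)
qed

text \<open>Both pointwise representations of test functions come with a constant C; it is absorbed
  by applying the weighted inequality to \<open>C * f\<close>, which produces
  \<open>C powr r\<close>.\<close>

lemma morrey_trace_inequality:
  fixes \<alpha> r p :: real
  assumes \<alpha>: "0 < \<alpha>" "\<alpha> < real CARD('n::finite)" and r: "1 < r" "r < p"
  shows "\<exists>N>0. \<forall>A C (b :: real^'n \<Rightarrow> real) f u. b \<in> borel_measurable lebesgue \<longrightarrow> (\<forall>x. 0 \<le> b x) \<longrightarrow>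
    morrey_bound p \<alpha> A b \<longrightarrow> 0 < C \<longrightarrow> f \<in> borel_measurable borel \<longrightarrow> (\<forall>x. 0 \<le> f x) \<longrightarrow> (\<forall>x. 0 \<le> u x) \<longrightarrow>
    (\<forall>x. ennreal (u x) \<le> ennreal C * (\<integral>\<^sup>+y. ennreal (norm (x - y) powr (\<alpha> - real CARD('n))) * ennreal (f y) \<partial>lborel)) \<longrightarrow>
    (\<integral>\<^sup>+x. ennreal (b x powr r * u x powr r) \<partial>lebesgue)
      \<le> ennreal (N * C powr r * A powr r) * (\<integral>\<^sup>+x. ennreal (f x powr r) \<partial>lebesgue)"
proof -
  define v where "v = unit_ball_vol (real CARD('n))"
  have v: "v > 0" unfolding v_def by (rule unit_ball_vol_pos) simp
  have \<alpha>': "\<alpha> < DIM(real^'n)" using \<alpha> by simp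
  obtain N where N: "N > 0" and trace: "\<And>A (b::real^'n \<Rightarrow> real) f u. 0 < A \<Longrightarrow> b \<in> borel_measurable borel \<Longrightarrow> (\<forall>x. 0 \<le> b x) \<Longrightarrow>
    (\<forall>(k::int) x. ball_avg (2 powr real_of_int k) (\<lambda>y. ennreal (b y powr p)) x \<le> ennreal (v * (A * (2 powr real_of_int k) powr (- \<alpha>)) powr p)) \<Longrightarrow>
    f \<in> borel_measurable borel \<Longrightarrow> (\<forall>x. 0 \<le> f x) \<Longrightarrow> (\<forall>x. 0 \<le> u x) \<Longrightarrow>
    (\<forall>x. ennreal (u x) \<le> (\<integral>\<^sup>+y. ennreal (norm (x - y) powr (\<alpha> - DIM(real^'n))) * ennreal (f y) \<partial>lborel)) \<Longrightarrow>
    (\<integral>\<^sup>+x. ennreal (b x powr r * u x powr r) \<partial>lborel) \<le> ennreal (N * A powr r) * (\<integral>\<^sup>+x. ennreal (f x powr r) \<partial>lborel)"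
    using riesz_trace_inequality[OF \<alpha>(1) \<alpha>' r v] by blast
  show ?thesis
  proof (intro exI[of _ N] conjI N allI impI)
    fix A C :: real and b f u :: "real^'n \<Rightarrow> real"
    assume bm: "b \<in> borel_measurable lebesgue" and b: "\<forall>x. 0 \<le> b x" and M: "morrey_bound p \<alpha> A b" and C: "0 < C"
      and [measurable]: "f \<in> borel_measurable borel" and f: "\<forall>x. 0 \<le> f x" and u: "\<forall>x. 0 \<le> u x"
      and uf: "\<forall>x. ennreal (u x) \<le> ennreal C * (\<integral>\<^sup>+y. ennreal (norm (x - y) powr (\<alpha> - real CARD('n))) * ennreal (f y) \<partial>lborel)"
    have A: "0 \<le> A" by (rule morrey_bound_nonneg[OF M])
    obtain b0 where b0: "b0 \<in> borel_measurable lborel" "AE x in lborel. b x = b0 x"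
      using completion_ex_borel_measurable_real[OF bm] by blast
    \<comment> \<open>Truncation at 0 makes the Borel representative nonnegative everywhere, not
      just almost everywhere.\<close>
    define b1 where "b1 x = max 0 (b0 x)" for x
    have [measurable]: "b1 \<in> borel_measurable borel" using b0(1) unfolding b1_def by measurable
    have b1: "0 \<le> b1 x" for x by (simp add: b1_def)
    have ae: "AE x in lborel. b x = b1 x" using b0(2) b by (auto elim!: eventually_mono simp: b1_def) (metis max.absorb2)
    have avg: "ball_avg (2 powr real_of_int k) (\<lambda>y. ennreal (b1 y powr p)) x \<le> ennreal (v * (A * (2 powr real_of_int k) powr (- \<alpha>)) powr p)"
      for k :: int and x
      unfolding v_def by (rule morrey_bound_ball_avg[OF M _ _ ae]) (use r in auto)
    have L: "(\<integral>\<^sup>+x. ennreal (b x powr r * u x powr r) \<partial>lebesgue) = (\<integral>\<^sup>+x. ennreal (b1 x powr r * u x powr r) \<partial>lborel)"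
      unfolding nn_integral_completion using ae by (intro nn_integral_cong_AE) (auto elim!: eventually_mono)
    show "(\<integral>\<^sup>+x. ennreal (b x powr r * u x powr r) \<partial>lebesgue) \<le> ennreal (N * C powr r * A powr r) * (\<integral>\<^sup>+x. ennreal (f x powr r) \<partial>lebesgue)"
    proof (cases "A = 0")
      \<comment> \<open>The weighted inequality needs A > 0. For A = 0 all averages of
        \<open>b1 powr p\<close> vanish, so b1 = 0 almost everywhere.\<close>
      case True
      have "AE y in lborel. ennreal (b1 y powr p) = 0"
        using avg True r by (intro ball_avg_eq_0_imp_AE[where x=0]) auto
      then have "AE y in lborel. ennreal (b1 y powr r * u y powr r) = 0"
        by eventually_elim auto
      then have "(\<integral>\<^sup>+x. ennreal (b1 x powr r * u x powr r) \<partial>lborel) = (\<integral>\<^sup>+x. 0 \<partial>(lborel :: (real^'n) measure))" by (rule nn_integral_cong_AE)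
      then show ?thesis by (simp add: L)
    next
      case False
      have "(\<integral>\<^sup>+x. ennreal (b1 x powr r * u x powr r) \<partial>lborel) \<le> ennreal (N * A powr r) * (\<integral>\<^sup>+x. ennreal ((C * f x) powr r) \<partial>lborel)"
      proof (rule trace)
        show "\<forall>x. ennreal (u x) \<le> (\<integral>\<^sup>+y. ennreal (norm (x - y) powr (\<alpha> - DIM(real^'n))) * ennreal (C * f y) \<partial>lborel)"
        proof
          fix x
          have "ennreal (u x) \<le> ennreal C * (\<integral>\<^sup>+y. ennreal (norm (x - y) powr (\<alpha> - real CARD('n))) * ennreal (f y) \<partial>lborel)"
            using uf by blast
          also have "\<dots> = (\<integral>\<^sup>+y. ennreal C * (ennreal (norm (x - y) powr (\<alpha> - real CARD('n))) * ennreal (f y)) \<partial>lborel)"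
            by (rule nn_integral_cmult[symmetric]) measurable
          finally show "ennreal (u x) \<le> (\<integral>\<^sup>+y. ennreal (norm (x - y) powr (\<alpha> - DIM(real^'n))) * ennreal (C * f y) \<partial>lborel)"
            using C f by (simp add: ennreal_mult mult_ac)
        qed
      qed (use False A C f u avg b1 in auto)
      also have "(\<integral>\<^sup>+x. ennreal ((C * f x) powr r) \<partial>lborel) = (\<integral>\<^sup>+x. ennreal (C powr r) * ennreal (f x powr r) \<partial>lborel)"
        by (intro nn_integral_cong) (simp only: powr_mult ennreal_mult powr_ge_zero)
      also have "\<dots> = ennreal (C powr r) * (\<integral>\<^sup>+x. ennreal (f x powr r) \<partial>lborel)"
        by (rule nn_integral_cmult) measurable
      also have "ennreal (N * A powr r) * (ennreal (C powr r) * (\<integral>\<^sup>+x. ennreal (f x powr r) \<partial>lborel))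
        = ennreal (N * C powr r * A powr r) * (\<integral>\<^sup>+x. ennreal (f x powr r) \<partial>lborel)"
        using N by (simp add: ennreal_mult mult_ac)
      finally show ?thesis by (subst L) (simp only: nn_integral_completion)
    qed
  qed
qed

theorem corollary2:
  fixes \<alpha> r p :: real
  assumes "0 < \<alpha>" and "\<alpha> < real CARD('n::finite)"
    and "\<alpha> \<le> r" and "1 < r" and "r < p" and "p \<le> real CARD('n)"
  shows "\<exists>N\<ge>0. \<forall>(A::real) (b :: real^'n \<Rightarrow> real).
    b \<in> borel_measurable lebesgue \<longrightarrow> (\<forall>x. 0 \<le> b x) \<longrightarrow> morrey_bound p \<alpha> A b \<longrightarrow>
    (\<forall>u \<in> (Cc_infinity :: (real^'n \<Rightarrow> complex) set).
      (\<integral>\<^sup>+x. ennreal (b x powr r * norm (u x) powr r) \<partial>lebesgue)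
        \<le> ennreal (N * A powr r) *
           (\<integral>\<^sup>+x. ennreal (norm (frac_laplacian (\<alpha> / 2) u x) powr r) \<partial>lebesgue) \<and>
      (\<alpha> = 1 \<longrightarrow>
        (\<integral>\<^sup>+x. ennreal (b x powr r * norm (u x) powr r) \<partial>lebesgue)
          \<le> ennreal (N * A powr r) *
             (\<integral>\<^sup>+x. ennreal (norm (grad u x) powr r) \<partial>lebesgue)))"
proof -
  obtain N0 where N0: "N0 > 0" and trace: "\<And>A C (b :: real^'n \<Rightarrow> real) f u. b \<in> borel_measurable lebesgue \<Longrightarrow> (\<forall>x. 0 \<le> b x) \<Longrightarrow>
    morrey_bound p \<alpha> A b \<Longrightarrow> 0 < C \<Longrightarrow> f \<in> borel_measurable borel \<Longrightarrow> (\<forall>x. 0 \<le> f x) \<Longrightarrow> (\<forall>x. 0 \<le> u x) \<Longrightarrow>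
    (\<forall>x. ennreal (u x) \<le> ennreal C * (\<integral>\<^sup>+y. ennreal (norm (x - y) powr (\<alpha> - real CARD('n))) * ennreal (f y) \<partial>lborel)) \<Longrightarrow>
    (\<integral>\<^sup>+x. ennreal (b x powr r * u x powr r) \<partial>lebesgue)
      \<le> ennreal (N0 * C powr r * A powr r) * (\<integral>\<^sup>+x. ennreal (f x powr r) \<partial>lebesgue)"
    using morrey_trace_inequality[OF assms(1,2,4,5)] by blast
  obtain C1 where C1: "C1 > 0" and frac: "\<And>(u :: real^'n \<Rightarrow> complex) x. u \<in> Cc_infinity \<Longrightarrow>
    ennreal (norm (u x)) \<le> ennreal C1 * (\<integral>\<^sup>+y. ennreal (norm (x - y) powr (\<alpha> - real CARD('n))) * ennreal (norm (frac_laplacian (\<alpha> / 2) u y)) \<partial>lborel)"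
    using norm_le_riesz_frac_laplacian[OF assms(1,2)] by blast
  obtain C2 where C2: "C2 > 0" and gr: "\<And>(u :: real^'n \<Rightarrow> complex) x. u \<in> Cc_infinity \<Longrightarrow>
    ennreal (norm (u x)) \<le> ennreal C2 * (\<integral>\<^sup>+y. ennreal (norm (x - y) powr (1 - real CARD('n))) * ennreal (norm (grad u y)) \<partial>lborel)"
    using norm_le_riesz_grad[where 'n='n] by blast
  \<comment> \<open>C1 and C2 are fixed before A, b and u, so the sum is one constant for both
    estimates that depends only on \<alpha>, d, r and p.\<close>
  define N where "N = N0 * (C1 powr r + C2 powr r)"
  have N: "N0 * C1 powr r \<le> N" "N0 * C2 powr r \<le> N" "0 \<le> N"
    using N0 by (auto simp: N_def algebra_simps)
  have weaken: "X \<le> ennreal (N * A powr r) * Y" if "X \<le> ennreal (K * A powr r) * Y" "K \<le> N" for X Y :: ennreal and K A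
    using that(1) by (rule order_trans) (intro mult_right_mono ennreal_leI that(2), auto)
  show ?thesis
  proof (intro exI[of _ N] conjI N(3) allI impI ballI)
    fix A and b :: "real^'n \<Rightarrow> real" and u :: "real^'n \<Rightarrow> complex"
    assume b: "b \<in> borel_measurable lebesgue" "\<forall>x. 0 \<le> b x" "morrey_bound p \<alpha> A b" and u: "u \<in> Cc_infinity"
    have "(\<lambda>x. norm (frac_laplacian (\<alpha> / 2) u x)) \<in> borel_measurable borel"
      using frac_laplacian_lborel(2)[OF Cc_infinity_measurable[OF u], of \<alpha>] by measurable
    then show "(\<integral>\<^sup>+x. ennreal (b x powr r * norm (u x) powr r) \<partial>lebesgue)
        \<le> ennreal (N * A powr r) * (\<integral>\<^sup>+x. ennreal (norm (frac_laplacian (\<alpha> / 2) u x) powr r) \<partial>lebesgue)"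
      by (intro weaken[OF trace[OF b C1] N(1)]) (use frac[OF u] in auto)
    \<comment> \<open>For this \<alpha> the gradient kernel with exponent 1 - d is the Riesz kernel
      with exponent \<alpha> - d.\<close>
    assume "\<alpha> = 1"
    then show "(\<integral>\<^sup>+x. ennreal (b x powr r * norm (u x) powr r) \<partial>lebesgue)
          \<le> ennreal (N * A powr r) * (\<integral>\<^sup>+x. ennreal (norm (grad u x) powr r) \<partial>lebesgue)"
      by (intro weaken[OF trace[OF b C2 borel_measurable_grad[OF u]] N(2)]) (use gr[OF u] in auto)
  qed
qed

end
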